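(* Let $G\subseteq GL(V)$ be a reflection group all of whose transvection root spaces are maximal, with $\mathrm{char}\,\mathbb{F}\neq2$. Suppose $(S\otimes V)^G$ is a free $S^G$-module with basic derivations $\theta_1,\dots,\theta_n$ and dual $1$-forms $\omega_1,\dots,\omega_n$. Then for any $r\in\{1,\dots,n\}$, $(S\otimes\wedge V^*\otimes V)^G$ is a free $S^G$-module with basis $$\{\omega_I^{\curlywedge}\theta_j: I\subseteq[n],\ r\in I,\ 1\le j\le n,\ j\neq r\}\ \cup\ \{\omega_I^{\curlywedge}d\theta_E,\ \omega_I^{\curlywedge}\theta_1,\dots,\omega_I^{\curlywedge}\theta_n: I\subseteq[n],\ r\notin I\}.$$
   Context: $\mathbb{F}$ a field, $V=\mathbb{F}^n$ with basis $v_1,\dots,v_n$, dual basis $x_1,\dots,x_n$, $S=\mathbb{F}[x_1,\dots,x_n]$ with induced $G$-action; $S\otimes M$ with diagonal action and $S$ on the first factor. $S\otimes\wedge V^*\otimes V$ is a module over $S\otimes\wedge V^*$ via $(f\otimes x)(f'\otimes x'\otimes v)=ff'\otimes x\wedge x'\otimes v$, and $S\otimes V$ is embedded via $f\otimes v\mapsto f\otimes 1\otimes v$. $d\theta_E=\sum_i1\otimes x_i\otimes v_i$. Reflections are non-identity elements of $GL(V)$ fixing a hyperplane pointwise; transvections are non-diagonalizable reflections; a reflection group is a finite group generated by reflections. $\mathcal A$ = reflecting hyperplanes, $\ell_H$ with kernel $H$, $Q=\prod_H\ell_H$; the root vector of a reflection $s$ about $H$ satisfies $s(v)=v+\ell_H(v)v_s$;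 the transvection root space of $H$ is the span of root vectors of transvections in $G$ about $H$, maximal if it equals $H$. $e_H$ = maximal order of a diagonalizable reflection about $H$ ($1$ if none), which under the hypotheses equals a common value $e$; $Q_{\det}=\prod_H\ell_H^{e_H-1}$. Basic derivations: a homogeneous $S^G$-basis of $(S\otimes V)^G$. Dual $1$-forms: $\omega_i=(1\otimes\Phi)(Q_{\det}\theta_1\wedge\dots\wedge\widehat{\theta_i}\wedge\dots\wedge\theta_n)$ where $\Phi(\beta)(v)=(v\wedge\beta)/(v_1\wedge\dots\wedge v_n)$ for $\beta\in\wedge^{n-1}V$. For $I=\{i_1<\dots<i_k\}$, $\omega_I^{\curlywedge}=\omega_{i_1}\wedge\dots\wedge\omega_{i_k}/Q^{e(k-1)}$ for $k\ge1$ (exact division), $\omega^{\curlywedge}_\varnothing=1\otimes1$. *)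

theory Defs
  imports
    "HOL-Analysis.Analysis"
    "HOL-Algebra.Multiplicative_Group"
    "HOL-Algebra.Generated_Groups"
    "HOL-Library.Poly_Mapping"
begin

text \<open>
  The space \<open>V\<close> is \<open>'a ^ 'n\<close> with its standard basis \<open>v\<^sub>i = axis i 1\<close>, and \<open>GL(V)\<close> consists of the
  invertible matrices, acting by \<open>g *v v\<close>. The linear order on the index type \<open>'n\<close> is the order
  \<open>1 < \<dots> < n\<close> of the basis. A vector of \<open>'a ^ 'n\<close> is also used as a covector, that is, as the
  coordinates of an element of \<open>V\<^sup>*\<close> in the dual basis.
\<close>

section \<open>Reflection groups\<close>

type_synonym ('a, 'n) sqmat = "'a ^ 'n ^ 'n"

text \<open>A linear form for each hyperplane\<close>
type_synonym ('a, 'n) hforms = "('a ^ 'n) set \<Rightarrow> 'a ^ 'n"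

definition GL :: "('a::field, 'n::finite) sqmat monoid" where
  "GL = \<lparr>carrier = {A. invertible A}, mult = (**), one = mat 1\<rparr>"

definition hyperplane :: "('a::field ^ 'n) set \<Rightarrow> bool" where
  "hyperplane H \<longleftrightarrow> vec.subspace H \<and> Suc (vec.dim H) = CARD('n)"

definition covec_eval :: "'a::field ^ 'n \<Rightarrow> 'a ^ 'n \<Rightarrow> 'a" where
  "covec_eval c v = (\<Sum>i\<in>UNIV. c $ i * v $ i)"

definition reflection_about :: "('a::field ^ 'n) set \<Rightarrow> 'a ^ 'n ^ 'n \<Rightarrow> bool" where
  "reflection_about H s \<longleftrightarrow>
     s \<in> carrier GL \<and> s \<noteq> mat 1 \<and> hyperplane H \<and> (\<forall>v\<in>H. s *v v = v)"

definition reflection :: "('a::field, 'n::finite) sqmat \<Rightarrow> bool" where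
  "reflection s \<longleftrightarrow> (\<exists>H. reflection_about H s)"

definition diagonalizable :: "('a::field, 'n::finite) sqmat \<Rightarrow> bool" where
  "diagonalizable A \<longleftrightarrow>
     (\<exists>(P :: ('a, 'n) sqmat) (D :: ('a, 'n) sqmat).
        invertible P \<and> (\<forall>i j. i \<noteq> j \<longrightarrow> D $ i $ j = 0) \<and> A = P ** D ** matrix_inv P)"

definition transvection_about :: "('a::field ^ 'n) set \<Rightarrow> 'a ^ 'n ^ 'n \<Rightarrow> bool" where
  "transvection_about H s \<longleftrightarrow> reflection_about H s \<and> \<not> diagonalizable s"

definition reflection_group :: "('a::field, 'n::finite) sqmat set \<Rightarrow> bool" where
  "reflection_group G \<longleftrightarrow>
     subgroup G GL \<and> finite G \<and> G = generate GL {s \<in> G. reflection s}"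

definition arrangement :: "('a::field, 'n::finite) sqmat set \<Rightarrow> ('a ^ 'n) set set" where
  "arrangement G = {H. \<exists>s\<in>G. reflection_about H s}"

text \<open>
  A choice \<open>ell\<close> of linear forms defining the reflecting hyperplanes. It is unique only up to nonzero
  scalars, so it is kept as a parameter of all that depends on it.
\<close>
definition defining_forms :: "('a::field, 'n::finite) sqmat set \<Rightarrow> ('a, 'n) hforms \<Rightarrow> bool" where
  "defining_forms G ell \<longleftrightarrow> (\<forall>H\<in>arrangement G. {v. covec_eval (ell H) v = 0} = H)"

definition transvection_root_space ::
    "('a::field, 'n::finite) sqmat set \<Rightarrow> ('a, 'n) hforms \<Rightarrow> ('a ^ 'n) set \<Rightarrow> ('a ^ 'n) set" where
  "transvection_root_space G ell H =
     vec.span {w. \<exists>s\<in>G. transvection_about H s \<and> (\<forall>v. s *v v = v + covec_eval (ell H) v *s w)}"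

definition maximal_transvection_root_spaces ::
    "('a::field, 'n::finite) sqmat set \<Rightarrow> ('a, 'n) hforms \<Rightarrow> bool" where
  "maximal_transvection_root_spaces G ell \<longleftrightarrow>
     (\<forall>H\<in>arrangement G. transvection_root_space G ell H = H)"

definition e_at :: "('a::field, 'n::finite) sqmat set \<Rightarrow> ('a ^ 'n) set \<Rightarrow> nat" where
  "e_at G H = Max (insert 1 (group.ord GL ` {s \<in> G. reflection_about H s \<and> diagonalizable s}))"

text \<open>
  The common value of the \<open>e_at G H\<close>. That there is one under the hypotheses of interest is not part
  of the definition. If \<open>arrangement G\<close> is empty, every number qualifies; the value is then
  irrelevant because it only occurs as an exponent of the empty product \<open>Q\<close>.
\<close>
definition common_e :: "('a::field, 'n::finite) sqmat set \<Rightarrow> nat" where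
  "common_e G = (SOME e. \<forall>H\<in>arrangement G. e_at G H = e)"


section \<open>The polynomial ring \<open>S\<close> and its group action\<close>

type_synonym ('a, 'n) mpoly = "('n \<Rightarrow>\<^sub>0 nat) \<Rightarrow>\<^sub>0 'a"

definition Const :: "'a::field \<Rightarrow> ('a, 'n) mpoly" where
  "Const c = Poly_Mapping.single 0 c"

definition Var :: "'n \<Rightarrow> ('a::field, 'n) mpoly" where
  "Var i = Poly_Mapping.single (Poly_Mapping.single i 1) 1"

definition linear_form :: "'a::field ^ 'n \<Rightarrow> ('a, 'n) mpoly" where
  "linear_form c = (\<Sum>i\<in>UNIV. Const (c $ i) * Var i)"

definition poly_subst ::
    "('n \<Rightarrow> ('a, 'n) mpoly) \<Rightarrow> ('a::field, 'n::finite) mpoly \<Rightarrow> ('a, 'n) mpoly" where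
  "poly_subst \<sigma> p =
     (\<Sum>m\<in>Poly_Mapping.keys p.
        Const (Poly_Mapping.lookup p m) * (\<Prod>i\<in>UNIV. \<sigma> i ^ Poly_Mapping.lookup m i))"

definition homogeneous_poly :: "nat \<Rightarrow> ('a::field, 'n::finite) mpoly \<Rightarrow> bool" where
  "homogeneous_poly d p \<longleftrightarrow>
     (\<forall>m\<in>Poly_Mapping.keys p. (\<Sum>i\<in>UNIV. Poly_Mapping.lookup m i) = d)"

text \<open>
  The action on \<open>V\<^sup>*\<close> is \<open>(g x)(v) = x(g\<^sup>-\<^sup>1 v)\<close>, so \<open>g x\<^sub>i = \<Sum>\<^sub>j (g\<^sup>-\<^sup>1)\<^sub>i\<^sub>j x\<^sub>j\<close>: the coordinates of
  \<open>g x\<^sub>i\<close> form the \<open>i\<close>-th row of \<open>g\<^sup>-\<^sup>1\<close>.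
\<close>
definition act_dual :: "('a::field, 'n::finite) sqmat \<Rightarrow> 'n \<Rightarrow> 'a ^ 'n" where
  "act_dual g i = matrix_inv g $ i"

definition act_poly :: "('a::field, 'n::finite) sqmat \<Rightarrow> ('a, 'n) mpoly \<Rightarrow> ('a, 'n) mpoly" where
  "act_poly g = poly_subst (\<lambda>i. linear_form (act_dual g i))"

definition invariant_polys :: "('a::field, 'n::finite) sqmat set \<Rightarrow> ('a, 'n) mpoly set" where
  "invariant_polys G = {f. \<forall>g\<in>G. act_poly g f = f}"

definition Q_poly ::
    "('a::field, 'n::finite) sqmat set \<Rightarrow> ('a, 'n) hforms \<Rightarrow> ('a, 'n) mpoly" where
  "Q_poly G ell = (\<Prod>H\<in>arrangement G. linear_form (ell H))"

definition Q_det ::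
    "('a::field, 'n::finite) sqmat set \<Rightarrow> ('a, 'n) hforms \<Rightarrow> ('a, 'n) mpoly" where
  "Q_det G ell = (\<Prod>H\<in>arrangement G. linear_form (ell H) ^ (e_at G H - 1))"


section \<open>Exterior algebras\<close>

text \<open>
  The exterior algebra over a commutative ring \<open>'r\<close> on generators \<open>y\<^sub>i\<close>, \<open>i :: 'n\<close>. An element is
  given by its coordinates in the basis \<open>y\<^sub>I = y\<^sub>i\<^sub>1 \<and> \<dots> \<and> y\<^sub>i\<^sub>k\<close>, \<open>I = {i\<^sub>1 < \<dots> < i\<^sub>k}\<close>. With
  \<open>y\<^sub>i = x\<^sub>i\<close> and \<open>'r = S\<close> this is \<open>S \<otimes> \<And>V\<^sup>*\<close>; with \<open>y\<^sub>i = v\<^sub>i\<close> it is \<open>S \<otimes> \<And>V\<close>.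
\<close>
type_synonym ('r, 'n) ext = "'r ^ ('n set)"

definition ext_sign :: "'n::{finite,linorder} set \<Rightarrow> 'n set \<Rightarrow> 'r::comm_ring_1" where
  "ext_sign I J = (- 1) ^ card {(i, j). i \<in> I \<and> j \<in> J \<and> j < i}"

definition wedge ::
    "('r::comm_ring_1, 'n::{finite,linorder}) ext \<Rightarrow> ('r, 'n) ext \<Rightarrow> ('r, 'n) ext"  (infixr \<open>\<and>\<^sub>e\<close> 70) where
  "a \<and>\<^sub>e b = (\<chi> K. \<Sum>I\<in>Pow K. ext_sign I (K - I) * a $ I * b $ (K - I))"

definition ext_one :: "('r::comm_ring_1, 'n::finite) ext" where
  "ext_one = axis {} 1"

definition ext_vec :: "'r::comm_ring_1 ^ 'n \<Rightarrow> ('r, 'n) ext" where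
  "ext_vec a = (\<Sum>i\<in>UNIV. a $ i *s axis {i} 1)"

text \<open>\<open>u\<^sub>i\<^sub>1 \<and> \<dots> \<and> u\<^sub>i\<^sub>k\<close> for \<open>I = {i\<^sub>1 < \<dots> < i\<^sub>k}\<close>\<close>
definition wedge_over ::
    "'n::{finite,linorder} set \<Rightarrow> ('n \<Rightarrow> ('r::comm_ring_1, 'n) ext) \<Rightarrow> ('r, 'n) ext" where
  "wedge_over I u = foldr wedge (map u (sorted_list_of_set I)) ext_one"


section \<open>Derivations, differential forms and differential derivations\<close>

text \<open>\<open>S \<otimes> V\<close>, in coordinates with respect to \<open>v\<^sub>j\<close>\<close>
type_synonym ('a, 'n) deriv = "('a, 'n) mpoly ^ 'n"

text \<open>\<open>S \<otimes> \<And>V\<^sup>*\<close>, in coordinates with respect to \<open>x\<^sub>I\<close>\<close>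
type_synonym ('a, 'n) dform = "(('a, 'n) mpoly, 'n) ext"

text \<open>\<open>S \<otimes> \<And>V\<^sup>* \<otimes> V\<close>, in coordinates with respect to \<open>x\<^sub>I \<otimes> v\<^sub>j\<close>\<close>
type_synonym ('a, 'n) dderiv = "('a, 'n) mpoly ^ ('n set \<times> 'n)"

definition act_deriv :: "('a::field, 'n::finite) sqmat \<Rightarrow> ('a, 'n) deriv \<Rightarrow> ('a, 'n) deriv" where
  "act_deriv g \<theta> = (\<chi> k. \<Sum>j\<in>UNIV. Const (g $ k $ j) * act_poly g (\<theta> $ j))"

text \<open>The factor for \<open>I\<close> is the \<open>K\<close>-coordinate of \<open>g x\<^sub>I = g x\<^sub>i\<^sub>1 \<and> \<dots> \<and> g x\<^sub>i\<^sub>k\<close> in \<open>\<And>V\<^sup>*\<close>.\<close>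
definition act_dderiv ::
    "('a::field, 'n::{finite,linorder}) sqmat \<Rightarrow> ('a, 'n) dderiv \<Rightarrow> ('a, 'n) dderiv" where
  "act_dderiv g \<eta> =
     vec_lambda (\<lambda>(K, k). \<Sum>I\<in>UNIV. \<Sum>j\<in>UNIV.
       Const (wedge_over I (\<lambda>i. ext_vec (act_dual g i)) $ K) * Const (g $ k $ j) *
       act_poly g (\<eta> $ (I, j)))"

definition invariant_derivs :: "('a::field, 'n::finite) sqmat set \<Rightarrow> ('a, 'n) deriv set" where
  "invariant_derivs G = {\<theta>. \<forall>g\<in>G. act_deriv g \<theta> = \<theta>}"

definition invariant_dderivs ::
    "('a::field, 'n::{finite,linorder}) sqmat set \<Rightarrow> ('a, 'n) dderiv set" where
  "invariant_dderivs G = {\<eta>. \<forall>g\<in>G. act_dderiv g \<eta> = \<eta>}"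

text \<open>The module structure of \<open>S \<otimes> \<And>V\<^sup>* \<otimes> V\<close> over \<open>S \<otimes> \<And>V\<^sup>*\<close>\<close>
definition dform_mult ::
    "('a::field, 'n::{finite,linorder}) dform \<Rightarrow> ('a, 'n) dderiv \<Rightarrow> ('a, 'n) dderiv"  (infixr \<open>\<bullet>\<^sub>d\<close> 70) where
  "\<omega> \<bullet>\<^sub>d \<eta> = vec_lambda (\<lambda>(K, j). (\<omega> \<and>\<^sub>e (\<chi> I. \<eta> $ (I, j))) $ K)"

definition embed_deriv :: "('a::field, 'n::finite) deriv \<Rightarrow> ('a, 'n) dderiv" where
  "embed_deriv \<theta> = vec_lambda (\<lambda>(I, j). if I = {} then \<theta> $ j else 0)"

definition d_euler :: "('a::field, 'n::finite) dderiv" where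
  "d_euler = (\<Sum>i\<in>UNIV. axis ({i}, i) 1)"


section \<open>Free modules and basic derivations\<close>

text \<open>
  The family \<open>(b k)\<^sub>k\<^sub>\<in>\<^sub>K\<close>, \<open>K\<close> finite, is a basis of the \<open>R\<close>-module \<open>M\<close>, for a subring \<open>R\<close> of \<open>'r\<close>
  and \<open>M \<subseteq> 'r ^ 'm\<close>.
\<close>
definition free_basis ::
    "'r::comm_ring_1 set \<Rightarrow> ('r ^ 'm) set \<Rightarrow> 'k set \<Rightarrow> ('k \<Rightarrow> 'r ^ 'm) \<Rightarrow> bool" where
  "free_basis R M K b \<longleftrightarrow> finite K \<and>
     M = {\<Sum>k\<in>K. c k *s b k | c. \<forall>k\<in>K. c k \<in> R} \<and>
     (\<forall>c. (\<forall>k\<in>K. c k \<in> R) \<longrightarrow> (\<Sum>k\<in>K. c k *s b k) = 0 \<longrightarrow> (\<forall>k\<in>K. c k = 0))"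

definition basic_derivations ::
    "('a::field, 'n::{finite,linorder}) sqmat set \<Rightarrow> ('n \<Rightarrow> ('a, 'n) deriv) \<Rightarrow> bool" where
  "basic_derivations G \<theta> \<longleftrightarrow>
     (\<forall>i. \<exists>d. \<forall>j. homogeneous_poly d (\<theta> i $ j)) \<and>
     free_basis (invariant_polys G) (invariant_derivs G) UNIV \<theta>"


section \<open>Dual forms\<close>

text \<open>
  The map \<open>1 \<otimes> \<Phi>\<close>: the \<open>x\<^sub>i\<close>-coordinate of \<open>\<Phi>(\<beta>)\<close> is \<open>\<Phi>(\<beta>)(v\<^sub>i) = (v\<^sub>i \<and> \<beta>) / (v\<^sub>1 \<and> \<dots> \<and> v\<^sub>n)\<close>. The
  argument is an element of \<open>S \<otimes> \<And>V\<close>, the value one of \<open>S \<otimes> \<And>V\<^sup>*\<close>.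
\<close>
definition Phi :: "('r::comm_ring_1, 'n::{finite,linorder}) ext \<Rightarrow> ('r, 'n) ext" where
  "Phi \<beta> = ext_vec (\<chi> i. (axis {i} 1 \<and>\<^sub>e \<beta>) $ UNIV)"

definition dual_form ::
    "('a::field, 'n::{finite,linorder}) sqmat set \<Rightarrow> ('a, 'n) hforms \<Rightarrow> ('n \<Rightarrow> ('a, 'n) deriv) \<Rightarrow>
     'n \<Rightarrow> ('a, 'n) dform" where
  "dual_form G ell \<theta> i = Phi (Q_det G ell *s wedge_over (UNIV - {i}) (\<lambda>j. ext_vec (\<theta> j)))"

text \<open>
  The division is the exact one in the torsion-free \<open>S\<close>-module \<open>S \<otimes> \<And>V\<^sup>*\<close>. That it is possible is not
  part of the definition.
\<close>
definition exact_quotient :: "'r::comm_ring_1 ^ 'm \<Rightarrow> 'r \<Rightarrow> 'r ^ 'm" where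
  "exact_quotient \<omega> q = (THE \<eta>. q *s \<eta> = \<omega>)"

definition curly_form ::
    "('a::field, 'n::{finite,linorder}) sqmat set \<Rightarrow> ('a, 'n) hforms \<Rightarrow> ('n \<Rightarrow> ('a, 'n) deriv) \<Rightarrow>
     'n set \<Rightarrow> ('a, 'n) dform" where
  "curly_form G ell \<theta> I =
     (if I = {} then ext_one
      else exact_quotient (wedge_over I (dual_form G ell \<theta>))
             (Q_poly G ell ^ (common_e G * (card I - 1))))"


section \<open>The family of differential derivations\<close>

text \<open>
  Index \<open>(I, Some j)\<close> stands for \<open>\<omega>\<^sub>I \<theta>\<^sub>j\<close> and \<open>(I, None)\<close> for \<open>\<omega>\<^sub>I d\<theta>\<^sub>E\<close>, where \<open>\<omega>\<^sub>I\<close> is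
  \<open>curly_form G ell \<theta> I\<close>.
\<close>
definition dderiv_family ::
    "('a::field, 'n::{finite,linorder}) sqmat set \<Rightarrow> ('a, 'n) hforms \<Rightarrow> ('n \<Rightarrow> ('a, 'n) deriv) \<Rightarrow>
     'n set \<times> 'n option \<Rightarrow> ('a, 'n) dderiv" where
  "dderiv_family G ell \<theta> = (\<lambda>(I, t).
     curly_form G ell \<theta> I \<bullet>\<^sub>d (case t of None \<Rightarrow> d_euler | Some j \<Rightarrow> embed_deriv (\<theta> j)))"

definition dderiv_index :: "'n::finite \<Rightarrow> ('n set \<times> 'n option) set" where
  "dderiv_index r =
     {(I, Some j) | I j. r \<in> I \<and> j \<noteq> r} \<union>
     ({(I, None) | I. r \<notin> I} \<union> {(I, Some j) | I j. r \<notin> I})"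

end

theory Submission
  imports Defs "HOL-Number_Theory.Cong"
begin

text \<open>
  Evaluating a differential derivation on the basic derivations turns it into coordinates \<open>c I j\<close>
  with respect to the dual basis of the \<open>\<theta> i\<close> over the field of fractions; it is invariant if and only
  if all \<open>c I j\<close> are invariant polynomials. In these coordinates \<open>\<omega>\<^sub>I\<close> is, for nonempty \<open>I\<close>, a
  scalar multiple of \<open>Q\<^sup>e\<close> times a basis vector, and \<open>d\<theta>\<^sub>E\<close> is the identity matrix. Hence the theorem
  amounts to the claim that \<open>Q\<^sup>e\<close> divides \<open>c I j\<close> whenever \<open>I\<close> has at least two elements, and that
  the matrix \<open>c {i} j\<close> is scalar modulo \<open>Q\<^sup>e\<close>.

  An invariant that is divisible by a linear form \<open>\<ell>\<^sub>H\<close> is divisible by \<open>\<ell>\<^sub>H\<^sup>e\<close>, so it suffices to work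
  modulo each \<open>\<ell>\<^sub>H\<close>. There, elimination in traces makes it possible to replace the \<open>\<theta> i\<close> by the
  Euler derivation and constant derivations along \<open>H\<close>. The new coordinates are invariant under the
  transvections, so that their directional derivatives along \<open>H\<close> vanish on \<open>H\<close>. On \<open>H\<close> the Euler derivation is a
  combination of the constant ones with the coordinate functions as coefficients, and differentiating
  the resulting relation twice gives the claim when \<open>2 \<noteq> 0\<close>.

  The same elimination gives \<open>det \<theta> = Q\<close> up to a scalar. The \<open>e\<^sub>H\<close> agree because all reflecting
  hyperplanes are conjugate: the transvections about \<open>H\<close> form a \<open>p\<close>-group whose only fixed point in
  the arrangement is \<open>H\<close>, so the size of an orbit modulo \<open>p\<close> tells whether \<open>H\<close> belongs to it.
\<close>

section \<open>Exterior algebra\<close>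

text \<open>The elimination in traces stands in for localization. For each \<open>H\<close>, the
  Euler derivation and the constants along \<open>H\<close> are invariant under the inertia group of
  the prime \<open>ell H\<close>, and their determinant is \<open>ell H\<close> times a unit. A
  multiplier not divisible by \<open>ell H\<close> carries them into the \<open>S\<close>-span of
  the \<open>\<theta> i\<close>. Divisibility by the prime \<open>ell H\<close> is insensitive to
  that multiplier, so no local ring has to be constructed.

  The exceptional index \<open>r\<close> comes from a triangular system. The member
  \<open>\<omega>_K \<theta>_j\<close> contributes to the coordinate \<open>c K j\<close> only, and
  \<open>\<omega>_K d\<theta>_E\<close> contributes to all \<open>c (insert j K) j\<close> with
  \<open>j \<notin> K\<close>. A coordinate \<open>c K r\<close> with \<open>r \<in> K\<close> is
  left to \<open>\<omega>_(K - {r}) d\<theta>_E\<close> alone. This determines the coefficients of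
  the members with \<open>d\<theta>_E\<close>, and then all others. The scalar part of the matrix
  \<open>c {i} j\<close> is taken up by \<open>d\<theta>_E\<close> itself, the only member with
  \<open>d\<theta>_E\<close> that carries no factor \<open>Q ^ e\<close>.\<close>

lemma axis_component: "axis i c $ j = (if j = i then c else 0)"
  by (simp add: axis_def)

text \<open>As a double product the sign is visibly multiplicative under disjoint unions in either
  argument, which is what associativity of the wedge rests on.\<close>

lemma ext_sign_prod:
  "ext_sign I J = (\<Prod>i\<in>I. \<Prod>j\<in>J. if j < i then - 1 else (1::'r::comm_ring_1))"
  for I J :: "'n::{finite,linorder} set"
proof -
  have *: "(\<Prod>j\<in>J. if j < i then - 1 else (1::'r)) = (- 1) ^ card {j\<in>J. j < i}" for i
    by (subst prod.inter_filter[symmetric]) auto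
  have "{(i, j). i \<in> I \<and> j \<in> J \<and> j < i} = (SIGMA i:I. {j\<in>J. j < i})" by auto
  then have "card {(i, j). i \<in> I \<and> j \<in> J \<and> j < i} = (\<Sum>i\<in>I. card {j\<in>J. j < i})"
    by simp
  then show ?thesis by (simp add: ext_sign_def * power_sum)
qed

lemma ext_sign_empty [simp]: "ext_sign {} J = 1" "ext_sign I {} = 1"
  by (simp_all add: ext_sign_prod)

lemma ext_sign_square [simp]: "ext_sign I J * ext_sign I J = 1"
  by (simp add: ext_sign_def flip: power_mult_distrib)

lemma ext_sign_square_left [simp]: "ext_sign I J * (ext_sign I J * a) = a"
  by (simp flip: mult.assoc)

lemma ext_sign_Un_left:
  "I \<inter> I' = {} \<Longrightarrow> ext_sign (I \<union> I') J = ext_sign I J * ext_sign I' J"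
  by (simp add: ext_sign_prod prod.union_disjoint)

lemma ext_sign_Un_right:
  "J \<inter> J' = {} \<Longrightarrow> ext_sign I (J \<union> J') = ext_sign I J * ext_sign I J'"
  by (simp add: ext_sign_prod prod.union_disjoint prod.distrib)

lemma ext_sign_insert_left:
  "i \<notin> I \<Longrightarrow> ext_sign (insert i I) J = ext_sign {i} J * ext_sign I J"
  using ext_sign_Un_left[of "{i}" I J] by simp

lemma ext_sign_insert_right:
  "j \<notin> J \<Longrightarrow> ext_sign I (insert j J) = ext_sign I {j} * ext_sign I J"
  using ext_sign_Un_right[of "{j}" J I] by simp

lemma ext_sign_singletons: "ext_sign {i} {j} = (if j < i then - 1 else 1)"
  by (simp add: ext_sign_prod)

lemma ext_sign_eq_1: "(\<And>i j. i \<in> I \<Longrightarrow> j \<in> J \<Longrightarrow> i \<le> j) \<Longrightarrow> ext_sign I J = 1"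
  unfolding ext_sign_prod by (intro prod.neutral ballI) (force simp: not_less dest: leD)

lemma wedge_nth: "(a \<and>\<^sub>e b) $ K = (\<Sum>I\<in>Pow K. ext_sign I (K - I) * a $ I * b $ (K - I))"
  by (simp add: wedge_def)

lemma wedge_add_left: "(a + b) \<and>\<^sub>e c = (a \<and>\<^sub>e c) + (b \<and>\<^sub>e c)"
  by (simp add: vec_eq_iff wedge_nth algebra_simps sum.distrib)

lemma wedge_add_right: "c \<and>\<^sub>e (a + b) = (c \<and>\<^sub>e a) + (c \<and>\<^sub>e b)"
  by (simp add: vec_eq_iff wedge_nth algebra_simps sum.distrib)

lemma wedge_smult_left: "(k *s a) \<and>\<^sub>e b = k *s (a \<and>\<^sub>e b)"
  by (simp add: vec_eq_iff wedge_nth algebra_simps sum_distrib_left)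

lemma wedge_smult_right: "a \<and>\<^sub>e (k *s b) = k *s (a \<and>\<^sub>e b)"
  by (simp add: vec_eq_iff wedge_nth algebra_simps sum_distrib_left)

lemma wedge_zero_left [simp]: "0 \<and>\<^sub>e b = 0"
  by (simp add: vec_eq_iff wedge_nth)

lemma wedge_zero_right [simp]: "b \<and>\<^sub>e 0 = 0"
  by (simp add: vec_eq_iff wedge_nth)

lemma wedge_minus_left: "(- a) \<and>\<^sub>e b = - (a \<and>\<^sub>e b)"
  by (simp add: vec_eq_iff wedge_nth sum_negf)

lemma wedge_minus_right: "a \<and>\<^sub>e (- b) = - (a \<and>\<^sub>e b)"
  by (simp add: vec_eq_iff wedge_nth sum_negf)

lemma wedge_sum_left: "(\<Sum>x\<in>X. f x) \<and>\<^sub>e b = (\<Sum>x\<in>X. f x \<and>\<^sub>e b)"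
  by (induction X rule: infinite_finite_induct) (simp_all add: wedge_add_left)

lemma wedge_sum_right: "b \<and>\<^sub>e (\<Sum>x\<in>X. f x) = (\<Sum>x\<in>X. b \<and>\<^sub>e f x)"
  by (induction X rule: infinite_finite_induct) (simp_all add: wedge_add_right)

lemma wedge_one_left [simp]: "ext_one \<and>\<^sub>e b = b"
proof -
  have "(\<Sum>I\<in>Pow K. ext_sign I (K - I) * ext_one $ I * b $ (K - I)) = b $ K" for K
    by (subst sum.remove[of _ "{}"]) (auto simp: ext_one_def axis_def intro!: sum.neutral)
  then show ?thesis by (simp add: vec_eq_iff wedge_nth)
qed

lemma wedge_one_right [simp]: "b \<and>\<^sub>e ext_one = b"
proof -
  have "(\<Sum>I\<in>Pow K. ext_sign I (K - I) * b $ I * ext_one $ (K - I)) = b $ K" for K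
    by (subst sum.remove[of _ K]) (auto simp: ext_one_def axis_def intro!: sum.neutral split: if_splits)
  then show ?thesis by (simp add: vec_eq_iff wedge_nth)
qed

text \<open>Both sides are sums over the ordered partitions of \<open>K\<close> into three blocks.
  The reindexing trades the union of the first two blocks for the second one; either way the total
  sign is the product of the three pairwise signs.\<close>

lemma wedge_assoc: "(a \<and>\<^sub>e b) \<and>\<^sub>e c = a \<and>\<^sub>e (b \<and>\<^sub>e c)"
proof -
  have "((a \<and>\<^sub>e b) \<and>\<^sub>e c) $ K = (a \<and>\<^sub>e (b \<and>\<^sub>e c)) $ K" for K
  proof -
    have "((a \<and>\<^sub>e b) \<and>\<^sub>e c) $ K =
        (\<Sum>M\<in>Pow K. \<Sum>I\<in>Pow M. ext_sign M (K - M) * (ext_sign I (M - I) * a $ I * b $ (M - I)) * c $ (K - M))"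
      by (simp add: wedge_nth sum_distrib_left sum_distrib_right mult.assoc)
    also have "\<dots> = (\<Sum>(M, I)\<in>(SIGMA M:Pow K. Pow M).
        ext_sign M (K - M) * (ext_sign I (M - I) * a $ I * b $ (M - I)) * c $ (K - M))"
      by (rule sum.Sigma) auto
    also have "\<dots> = (\<Sum>(I, J)\<in>(SIGMA I:Pow K. Pow (K - I)).
        ext_sign I (K - I) * a $ I * (ext_sign J (K - I - J) * b $ J * c $ (K - I - J)))"
    proof (rule sum.reindex_bij_witness[where j = "\<lambda>(M, I). (I, M - I)" and i = "\<lambda>(I, J). (I \<union> J, I)"])
      fix x assume x: "x \<in> (SIGMA M:Pow K. Pow M)"
      obtain M I where [simp]: "x = (M, I)" by (cases x)
      have MI: "M \<subseteq> K" "I \<subseteq> M" using x by auto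
      have 1: "K - I - (M - I) = K - M" using MI by auto
      have "ext_sign M (K - M) = ext_sign I (K - M) * (ext_sign (M - I) (K - M) :: 'a)"
        using ext_sign_Un_left[of I "M - I" "K - M"] MI by (simp add: Un_absorb1)
      moreover have "ext_sign I (K - I) = ext_sign I (M - I) * (ext_sign I (K - M) :: 'a)"
        using ext_sign_Un_right[of "M - I" "K - M" I] MI
        by (metis Diff_disjoint Diff_partition Un_Diff Diff_triv Int_commute Int_Diff inf_bot_right
            1 Diff_mono Diff_subset order_refl)
      ultimately show "(case (case x of (M, I) \<Rightarrow> (I, M - I)) of
          (I, J) \<Rightarrow> ext_sign I (K - I) * a $ I * (ext_sign J (K - I - J) * b $ J * c $ (K - I - J))) =
        (case x of (M, I) \<Rightarrow> ext_sign M (K - M) * (ext_sign I (M - I) * a $ I * b $ (M - I)) * c $ (K - M))"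
        by (simp add: 1 mult_ac)
    qed auto
    also have "\<dots> = (a \<and>\<^sub>e (b \<and>\<^sub>e c)) $ K"
      by (simp add: wedge_nth sum_distrib_left sum_distrib_right mult.assoc sum.Sigma)
    finally show ?thesis .
  qed
  then show ?thesis by (simp add: vec_eq_iff)
qed

lemma axis_wedge_axis:
  "axis I 1 \<and>\<^sub>e axis J 1 = (if I \<inter> J = {} then ext_sign I J *s axis (I \<union> J) 1 else 0)"
proof -
  have "(axis I 1 \<and>\<^sub>e axis J (1::'a)) $ K =
      (\<Sum>L\<in>Pow K. if L = I then (if K - I = J then ext_sign I J else 0) else 0)" for K
    unfolding wedge_nth by (intro sum.cong) (auto simp: axis_def)
  then have "(axis I 1 \<and>\<^sub>e axis J (1::'a)) $ K =
      (if I \<inter> J = {} \<and> K = I \<union> J then ext_sign I J else 0)" for K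
    by (simp add: sum.delta) blast
  then show ?thesis by (auto simp: vec_eq_iff axis_def)
qed

lemma sum_axis: "(\<Sum>I\<in>UNIV. a $ I *s axis I 1) = (a :: 'r::comm_ring_1 ^ 'm::finite)"
  by (simp add: vec_eq_iff axis_def if_distrib[of "(*) _"] cong: if_cong)

lemma ext_vec_nth: "ext_vec a $ K = (\<Sum>i\<in>UNIV. if K = {i} then a $ i else 0)"
  by (simp add: ext_vec_def axis_def if_distrib[of "(*) _"] cong: if_cong)

lemma ext_vec_nth_singleton [simp]: "ext_vec a $ {i} = a $ i"
  by (simp add: ext_vec_nth)

lemma ext_vec_nth_other: "card K \<noteq> 1 \<Longrightarrow> ext_vec a $ K = 0"
  unfolding ext_vec_nth by (intro sum.neutral) auto

lemma ext_vec_axis [simp]: "ext_vec (axis i 1) = axis {i} 1"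
proof -
  have "ext_vec (axis i 1) $ K = (axis {i} 1 :: ('a, 'b) ext) $ K" for K
  proof (cases "card K = 1")
    case True
    then obtain j where "K = {j}" by (rule card_1_singletonE)
    then show ?thesis by (simp add: axis_component)
  next
    case False
    then show ?thesis by (auto simp: axis_component ext_vec_nth_other)
  qed
  then show ?thesis by (simp add: vec_eq_iff)
qed

lemma ext_vec_add: "ext_vec (a + b) = ext_vec a + ext_vec b"
  by (simp add: ext_vec_def vec.scale_left_distrib sum.distrib algebra_simps vec_eq_iff)

lemma ext_vec_smult: "ext_vec (c *s a) = c *s ext_vec a"
  by (simp add: ext_vec_def vec_eq_iff sum_distrib_left mult.assoc)

lemma ext_vec_zero [simp]: "ext_vec 0 = 0"
  by (simp add: ext_vec_def vec_eq_iff)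

lemma ext_vec_sum: "ext_vec (\<Sum>x\<in>X. f x) = (\<Sum>x\<in>X. ext_vec (f x))"
  by (induction X rule: infinite_finite_induct) (simp_all add: ext_vec_add)

lemma ext_vec_wedge_nth:
  "(ext_vec a \<and>\<^sub>e b) $ K = (\<Sum>i\<in>K. ext_sign {i} (K - {i}) * a $ i * b $ (K - {i}))"
proof -
  have "(ext_vec a \<and>\<^sub>e b) $ K =
      (\<Sum>I\<in>(\<lambda>i. {i}) ` K. ext_sign I (K - I) * ext_vec a $ I * b $ (K - I))"
    unfolding wedge_nth
  proof (rule sum.mono_neutral_right)
    show "\<forall>I\<in>Pow K - (\<lambda>i. {i}) ` K. ext_sign I (K - I) * ext_vec a $ I * b $ (K - I) = 0"
    proof
      fix I assume I: "I \<in> Pow K - (\<lambda>i. {i}) ` K"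
      then have "card I \<noteq> 1" by (metis Diff_iff PowD card_1_singletonE image_eqI insert_subset)
      then show "ext_sign I (K - I) * ext_vec a $ I * b $ (K - I) = 0"
        by (simp add: ext_vec_nth_other)
    qed
  qed auto
  then show ?thesis by (simp add: sum.reindex)
qed

lemma ext_vec_wedge_pair:
  assumes "i < j"
  shows "(ext_vec a \<and>\<^sub>e ext_vec b) $ {i, j} = a $ i * b $ j - a $ j * b $ i"
proof -
  have "{i, j} - {i} = {j}" "{i, j} - {j} = {i}" "i \<noteq> j" using assms by auto
  then show ?thesis using assms by (simp add: ext_vec_wedge_nth ext_sign_singletons)
qed

lemma ext_vec_wedge_other:
  assumes "card K \<noteq> 2"
  shows "(ext_vec a \<and>\<^sub>e ext_vec b) $ K = 0"
  unfolding ext_vec_wedge_nth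
proof (intro sum.neutral ballI)
  fix i assume "i \<in> K"
  then have "card (K - {i}) \<noteq> 1" using assms by (simp add: card_Diff_singleton)
  then show "ext_sign {i} (K - {i}) * a $ i * ext_vec b $ (K - {i}) = 0"
    by (simp add: ext_vec_nth_other)
qed

lemma card_2_less:
  assumes "card (K :: 'n::linorder set) = 2"
  obtains i j where "K = {i, j}" "i < j"
  using assms by (metis card_2_iff insert_commute linorder_neqE)

lemma ext_vec_wedge_self [simp]: "ext_vec a \<and>\<^sub>e ext_vec a = 0"
proof -
  have "(ext_vec a \<and>\<^sub>e ext_vec a) $ K = 0" for K
    by (cases "card K = 2") (auto elim!: card_2_less simp: ext_vec_wedge_pair ext_vec_wedge_other)
  then show ?thesis by (simp add: vec_eq_iff)
qed

lemma ext_vec_anticommute: "ext_vec a \<and>\<^sub>e ext_vec b = - (ext_vec b \<and>\<^sub>e ext_vec a)"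
proof -
  have "(ext_vec a \<and>\<^sub>e ext_vec b) $ K = - (ext_vec b \<and>\<^sub>e ext_vec a) $ K" for K
    by (cases "card K = 2") (auto elim!: card_2_less simp: ext_vec_wedge_pair ext_vec_wedge_other)
  then show ?thesis by (simp add: vec_eq_iff)
qed

lemma ext_vec_wedge_self_left [simp]: "ext_vec a \<and>\<^sub>e ext_vec a \<and>\<^sub>e b = 0"
  by (simp flip: wedge_assoc)

lemma ext_vec_anticommute_left:
  "ext_vec a \<and>\<^sub>e ext_vec b \<and>\<^sub>e c = - (ext_vec b \<and>\<^sub>e ext_vec a \<and>\<^sub>e c)"
  by (metis wedge_assoc ext_vec_anticommute wedge_minus_left)

lemma wedge_over_empty [simp]: "wedge_over {} u = ext_one"
  by (simp add: wedge_over_def)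

lemma wedge_over_insert_min:
  assumes "\<And>j. j \<in> I \<Longrightarrow> i < j"
  shows "wedge_over (insert i I) u = u i \<and>\<^sub>e wedge_over I u"
proof -
  have "i \<notin> I" using assms by blast
  moreover have "insort i (sorted_list_of_set I) = i # sorted_list_of_set I"
    using assms by (cases "sorted_list_of_set I")
      (auto simp: less_imp_le dest!: arg_cong[where f = set])
  ultimately show ?thesis by (simp add: wedge_over_def sorted_list_of_set_insert)
qed

lemma wedge_over_singleton: "wedge_over {i} u = u i"
  using wedge_over_insert_min[of "{}" i u] by simp

text \<open>Elements are added below the existing ones, so that \<open>wedge_over_insert_min\<close>
  peels the new factor off on the left without a sign.\<close>

lemma min_insert_induct [case_names empty insert]:
  fixes I :: "'n::{finite,linorder} set"
  assumes "P {}" and "\<And>m I. (\<And>j. j \<in> I \<Longrightarrow> m < j) \<Longrightarrow> P I \<Longrightarrow> P (insert m I)"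
  shows "P I"
  using finite[of I] assms by (rule finite_linorder_min_induct) auto

lemma wedge_over_cong: "(\<And>i. i \<in> I \<Longrightarrow> u i = v i) \<Longrightarrow> wedge_over I u = wedge_over I v"
  by (induction I rule: min_insert_induct) (auto simp: wedge_over_insert_min)

text \<open>The new factor is moved to its sorted place: it changes the sign at each smaller factor
  that it passes, and gives 0 when it meets itself.\<close>

lemma ext_vec_wedge_wedge_over:
  "ext_vec (u i) \<and>\<^sub>e wedge_over I (\<lambda>i. ext_vec (u i)) =
    (if i \<in> I then 0 else ext_sign {i} I *s wedge_over (insert i I) (\<lambda>i. ext_vec (u i)))"
proof (induction I rule: min_insert_induct)
  case empty
  show ?case by (simp add: wedge_over_singleton)
next
  case (insert m I)
  have m: "m \<notin> I" using insert.hyps by blast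
  consider "i < m" | "i = m" | "m < i" by (metis linorder_neqE)
  then show ?case
  proof cases
    case 1
    then have *: "\<And>j. j \<in> insert m I \<Longrightarrow> i < j" using insert.hyps by fastforce
    then have "ext_sign {i} (insert m I) = (1 :: 'a)" by (intro ext_sign_eq_1) (auto intro: less_imp_le)
    moreover have "wedge_over (insert i (insert m I)) (\<lambda>i. ext_vec (u i)) =
        ext_vec (u i) \<and>\<^sub>e wedge_over (insert m I) (\<lambda>i. ext_vec (u i))"
      by (rule wedge_over_insert_min) (rule *)
    ultimately show ?thesis using *[of i] by auto
  next
    case 2
    then show ?thesis using insert.hyps by (simp add: wedge_over_insert_min)
  next
    case 3
    have "ext_vec (u i) \<and>\<^sub>e wedge_over (insert m I) (\<lambda>i. ext_vec (u i)) =
        - (ext_vec (u m) \<and>\<^sub>e ext_vec (u i) \<and>\<^sub>e wedge_over I (\<lambda>i. ext_vec (u i)))"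
      using insert.hyps by (simp add: wedge_over_insert_min ext_vec_anticommute_left[of "u i" "u m"])
    moreover have "wedge_over (insert i (insert m I)) (\<lambda>i. ext_vec (u i)) =
        ext_vec (u m) \<and>\<^sub>e wedge_over (insert i I) (\<lambda>i. ext_vec (u i))"
      using insert.hyps 3 by (subst insert_commute, subst wedge_over_insert_min) auto
    moreover have "ext_sign {i} (insert m I) = - (ext_sign {i} I :: 'a)"
      using 3 by (simp add: ext_sign_insert_right[OF m] ext_sign_singletons)
    ultimately show ?thesis using 3 insert.IH
      by (cases "i \<in> I") (simp_all add: wedge_smult_right vector_smult_lneg)
  qed
qed

lemma wedge_over_wedge_wedge_over:
  "wedge_over I (\<lambda>i. ext_vec (u i)) \<and>\<^sub>e wedge_over J (\<lambda>i. ext_vec (u i)) =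
    (if I \<inter> J = {} then ext_sign I J *s wedge_over (I \<union> J) (\<lambda>i. ext_vec (u i)) else 0)"
proof (induction I rule: min_insert_induct)
  case empty
  show ?case by (simp add: vec_eq_iff)
next
  case (insert m I)
  have m: "m \<notin> I" using insert.hyps by blast
  have 1: "wedge_over (insert m I) (\<lambda>i. ext_vec (u i)) \<and>\<^sub>e wedge_over J (\<lambda>i. ext_vec (u i)) =
      (if I \<inter> J = {} then ext_sign I J *s
        (if m \<in> I \<union> J then 0 else ext_sign {m} (I \<union> J) *s wedge_over (insert m (I \<union> J)) (\<lambda>i. ext_vec (u i))) else 0)"
    using insert by (simp add: wedge_over_insert_min wedge_assoc wedge_smult_right
        ext_vec_wedge_wedge_over[of u m "I \<union> J"])
  have "ext_sign {m} I = (1::'a)"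
    using insert.hyps by (intro ext_sign_eq_1) (auto intro: less_imp_le)
  then have "I \<inter> J = {} \<Longrightarrow> ext_sign {m} (I \<union> J) = (ext_sign {m} J :: 'a)"
    by (simp add: ext_sign_Un_right)
  then show ?case unfolding 1 using m
    by (cases "I \<inter> J = {}"; cases "m \<in> J")
      (simp_all add: ext_sign_insert_left[OF m] vector_smult_assoc mult.commute)
qed

lemma wedge_over_axis: "wedge_over I (\<lambda>i. axis {i} (1::'r::comm_ring_1)) = axis I 1"
proof (induction I rule: min_insert_induct)
  case empty
  show ?case by (simp add: ext_one_def)
next
  case (insert m I)
  have "ext_sign {m} I = (1::'r)" "m \<notin> I"
    using insert.hyps by (auto intro!: ext_sign_eq_1 intro: less_imp_le)
  then show ?case using insert by (simp add: wedge_over_insert_min axis_wedge_axis)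
qed

lemma wedge_over_smult:
  "wedge_over I (\<lambda>i. c i *s u i) = (\<Prod>i\<in>I. c i) *s wedge_over I u"
proof (induction I rule: min_insert_induct)
  case empty
  show ?case by (simp add: vec_eq_iff)
next
  case (insert m I)
  have "m \<notin> I" using insert.hyps by blast
  then show ?case using insert
    by (simp add: wedge_over_insert_min wedge_smult_left wedge_smult_right vector_smult_assoc mult.commute)
qed

lemma wedge_over_degree:
  "card K \<noteq> card I \<Longrightarrow> wedge_over I (\<lambda>i. ext_vec (u i)) $ K = 0"
proof (induction I arbitrary: K rule: min_insert_induct)
  case empty
  then show ?case by (auto simp: ext_one_def axis_component)
next
  case (insert m I)
  have "m \<notin> I" using insert.hyps by blast
  then have *: "card (K - {i}) \<noteq> card I" if "i \<in> K" for i
    using insert.prems that by (metis card_Suc_Diff1 card_insert_disjoint finite)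
  have "wedge_over (insert m I) (\<lambda>i. ext_vec (u i)) = ext_vec (u m) \<and>\<^sub>e wedge_over I (\<lambda>i. ext_vec (u i))"
    using insert.hyps by (rule wedge_over_insert_min)
  then show ?case unfolding ext_vec_wedge_nth
    by (simp only: ext_vec_wedge_nth, intro sum.neutral ballI) (simp only: insert.IH[OF *] mult_zero_right)
qed

subsection \<open>Induced algebra homomorphisms\<close>

text \<open>The algebra endomorphism of the exterior algebra induced by sending the generator with
  index \<open>i\<close> to \<open>u i\<close>. Its matrix entries are the minors of the matrix with
  rows \<open>u i\<close>.\<close>

definition ext_map ::
    "('n \<Rightarrow> 'r::comm_ring_1 ^ 'n::{finite,linorder}) \<Rightarrow> ('r, 'n) ext \<Rightarrow> ('r, 'n) ext" where
  "ext_map u a = (\<Sum>I\<in>UNIV. a $ I *s wedge_over I (\<lambda>i. ext_vec (u i)))"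

lemma ext_map_nth: "ext_map u a $ K = (\<Sum>I\<in>UNIV. a $ I * wedge_over I (\<lambda>i. ext_vec (u i)) $ K)"
  by (simp add: ext_map_def)

lemma ext_map_add: "ext_map u (a + b) = ext_map u a + ext_map u b"
  by (simp add: ext_map_nth vec_eq_iff algebra_simps sum.distrib)

lemma ext_map_smult: "ext_map u (c *s a) = c *s ext_map u a"
  by (simp add: ext_map_nth vec_eq_iff sum_distrib_left mult.assoc)

lemma ext_map_zero [simp]: "ext_map u 0 = 0"
  by (simp add: ext_map_nth vec_eq_iff)

lemma ext_map_sum: "ext_map u (\<Sum>x\<in>X. f x) = (\<Sum>x\<in>X. ext_map u (f x))"
  by (induction X rule: infinite_finite_induct) (simp_all add: ext_map_add)

lemma ext_map_axis [simp]: "ext_map u (axis I 1) = wedge_over I (\<lambda>i. ext_vec (u i))"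
  by (simp add: ext_map_nth vec_eq_iff axis_component if_distrib[of "\<lambda>x. x * _"] cong: if_cong)

lemma ext_map_one [simp]: "ext_map u ext_one = ext_one"
  by (metis ext_map_axis ext_one_def wedge_over_empty)

lemma ext_map_ext_vec: "ext_map u (ext_vec a) = ext_vec (\<Sum>i\<in>UNIV. a $ i *s u i)"
  by (subst ext_vec_def)
    (simp add: ext_map_sum ext_map_smult ext_vec_sum ext_vec_smult wedge_over_singleton)

lemma ext_map_wedge: "ext_map u (a \<and>\<^sub>e b) = ext_map u a \<and>\<^sub>e ext_map u b"
proof -
  have *: "ext_map u (axis I 1 \<and>\<^sub>e axis J 1) = ext_map u (axis I 1) \<and>\<^sub>e ext_map u (axis J 1)" for I J
    by (simp add: axis_wedge_axis ext_map_smult wedge_over_wedge_wedge_over)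
  have "ext_map u ((\<Sum>I\<in>UNIV. a $ I *s axis I 1) \<and>\<^sub>e (\<Sum>I\<in>UNIV. b $ I *s axis I 1)) =
      ext_map u (\<Sum>I\<in>UNIV. a $ I *s axis I 1) \<and>\<^sub>e ext_map u (\<Sum>I\<in>UNIV. b $ I *s axis I 1)"
    by (simp add: wedge_sum_left wedge_sum_right wedge_smult_left wedge_smult_right ext_map_sum
        ext_map_smult * del: ext_map_axis)
  then show ?thesis by (simp only: sum_axis)
qed

lemma ext_map_wedge_over: "ext_map u (wedge_over I v) = wedge_over I (\<lambda>i. ext_map u (v i))"
  by (induction I rule: min_insert_induct) (simp_all add: wedge_over_insert_min ext_map_wedge)

text \<open>Functoriality of the exterior algebra; read in coordinates it is the Cauchy-Binet
  formula.\<close>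

lemma ext_map_ext_map:
  "ext_map u (ext_map v a) = ext_map (\<lambda>i. \<Sum>j\<in>UNIV. v i $ j *s u j) a"
  by (simp add: ext_map_def[of v] ext_map_def[of "\<lambda>i. \<Sum>j\<in>UNIV. v i $ j *s u j"] ext_map_sum
      ext_map_smult ext_map_wedge_over ext_map_ext_vec)

lemma ext_map_diagonal:
  "ext_map (\<lambda>i. c i *s axis i 1) a = (\<chi> I. (\<Prod>i\<in>I. c i) * a $ I)"
proof -
  have "ext_map (\<lambda>i. c i *s axis i 1) a $ K =
      (\<Sum>I\<in>UNIV. if K = I then (\<Prod>i\<in>I. c i) * a $ I else 0)" for K
    unfolding ext_map_nth
    by (intro sum.cong) (auto simp: ext_vec_smult wedge_over_smult wedge_over_axis axis_component)
  then show ?thesis by (simp add: vec_eq_iff)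
qed

lemma ext_map_scalar: "ext_map (\<lambda>i. c *s axis i 1) a = (\<chi> I. c ^ card I * a $ I)"
  using ext_map_diagonal[of "\<lambda>_. c" a] by simp

lemma ext_map_degree:
  "ext_map u a $ K = (\<Sum>I | card I = card K. a $ I * wedge_over I (\<lambda>i. ext_vec (u i)) $ K)"
  unfolding ext_map_nth by (rule sum.mono_neutral_right) (auto simp: wedge_over_degree)

text \<open>The determinant of the matrix with rows \<open>u i\<close>. Taken on the top exterior
  power, its multiplicativity is the functoriality of \<open>ext_map\<close>, and expansion along a
  row is an instance of \<open>ext_vec_wedge_wedge_over\<close>.\<close>

definition ext_det :: "('n \<Rightarrow> 'r::comm_ring_1 ^ 'n::{finite,linorder}) \<Rightarrow> 'r" where
  "ext_det u = wedge_over UNIV (\<lambda>i. ext_vec (u i)) $ UNIV"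

lemma card_eq_CARD: "card (K :: 'n::finite set) = CARD('n) \<longleftrightarrow> K = UNIV"
  using card_eq_UNIV_imp_eq_UNIV[of K] by auto

lemma wedge_over_UNIV: "wedge_over UNIV (\<lambda>i. ext_vec (u i)) = ext_det u *s axis UNIV 1"
proof -
  have "wedge_over UNIV (\<lambda>i. ext_vec (u i)) $ K = (ext_det u *s axis UNIV 1) $ K" for K
    by (cases "K = UNIV") (auto simp: ext_det_def axis_component wedge_over_degree card_eq_CARD)
  then show ?thesis by (simp add: vec_eq_iff)
qed

lemma ext_det_mult: "ext_det (\<lambda>i. \<Sum>j\<in>UNIV. v i $ j *s u j) = ext_det v * ext_det u"
proof -
  have "ext_det (\<lambda>i. \<Sum>j\<in>UNIV. v i $ j *s u j) = ext_map u (ext_map v (axis UNIV 1)) $ UNIV"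
    by (simp add: ext_map_wedge_over ext_map_ext_vec ext_det_def)
  also have "\<dots> = ext_det v * ext_det u"
    by (simp add: wedge_over_UNIV ext_map_smult axis_component)
  finally show ?thesis .
qed

lemma ext_det_axis [simp]: "ext_det (\<lambda>i. axis i 1) = 1"
  by (simp add: ext_det_def wedge_over_axis axis_component)

lemma ext_det_smult: "ext_det (\<lambda>i. c i *s u i) = (\<Prod>i\<in>UNIV. c i) * ext_det u"
  by (simp add: ext_det_def ext_vec_smult wedge_over_smult)

lemma ext_det_row:
  "(ext_vec (u i) \<and>\<^sub>e wedge_over (UNIV - {i}) (\<lambda>i. ext_vec (u i))) $ UNIV =
    ext_sign {i} (UNIV - {i}) * ext_det u"
  by (simp add: ext_vec_wedge_wedge_over insert_absorb ext_det_def insert_UNIV)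

lemma ext_det_axis_except:
  "ext_det (\<lambda>i. if i = k then x else axis i 1) = x $ k"
proof -
  let ?u = "\<lambda>i. if i = k then x else axis i 1"
  have "wedge_over (UNIV - {k}) (\<lambda>i. ext_vec (?u i)) = wedge_over (UNIV - {k}) (\<lambda>i. axis {i} 1)"
    by (rule wedge_over_cong) auto
  then have "ext_sign {k} (UNIV - {k}) * ext_det ?u = (ext_vec x \<and>\<^sub>e axis (UNIV - {k}) 1) $ UNIV"
    using ext_det_row[of ?u k] by (simp add: wedge_over_axis)
  also have "\<dots> = ext_sign {k} (UNIV - {k}) * x $ k"
  proof -
    have "UNIV - {i} = UNIV - {k} \<longleftrightarrow> i = k" for i by blast
    then show ?thesis
      by (simp add: ext_vec_wedge_nth axis_component if_distrib[of "(*) _"] cong: if_cong)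
  qed
  finally have "ext_sign {k} (UNIV - {k}) * (ext_sign {k} (UNIV - {k}) * ext_det ?u) =
      ext_sign {k} (UNIV - {k}) * (ext_sign {k} (UNIV - {k}) * x $ k)"
    by (rule arg_cong)
  then show ?thesis by (simp only: ext_sign_square_left)
qed

section \<open>Polynomials\<close>

locale ring_homo =
  fixes h :: "'r::comm_ring_1 \<Rightarrow> 's::comm_ring_1"
  assumes add: "h (a + b) = h a + h b"
    and mult: "h (a * b) = h a * h b"
    and one [simp]: "h 1 = 1"
begin

lemma zero [simp]: "h 0 = 0"
  using add[of 0 0] by simp

lemma minus: "h (- a) = - h a"
  using add[of a "- a"] by (simp add: eq_neg_iff_add_eq_0 add.commute)

lemma diff: "h (a - b) = h a - h b"
  using add[of a "- b"] by (simp add: minus)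

lemma sum: "h (\<Sum>x\<in>X. f x) = (\<Sum>x\<in>X. h (f x))"
  by (induction X rule: infinite_finite_induct) (simp_all add: add)

lemma prod: "h (\<Prod>x\<in>X. f x) = (\<Prod>x\<in>X. h (f x))"
  by (induction X rule: infinite_finite_induct) (simp_all add: mult)

lemma power: "h (a ^ n) = h a ^ n"
  by (induction n) (simp_all add: mult)

end

lemma ring_homo_comp: "ring_homo f \<Longrightarrow> ring_homo g \<Longrightarrow> ring_homo (f \<circ> g)"
  by (simp add: ring_homo_def)

lemma ring_homo_id: "ring_homo (\<lambda>x. x)"
  by (simp add: ring_homo_def)

lemma Const_homo: "ring_homo (Const :: 'a::field \<Rightarrow> ('a, 'n) mpoly)"
  by (simp add: ring_homo_def Const_def single_add mult_single)

interpretation Const: ring_homo "Const :: 'a::field \<Rightarrow> ('a, 'n) mpoly"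
  by (rule Const_homo)

lemma Const_eq_iff [simp]: "Const a = Const b \<longleftrightarrow> a = b"
  unfolding Const_def by (metis lookup_single_eq)

lemma Const_eq_0_iff [simp]: "Const a = 0 \<longleftrightarrow> a = 0"
  by (metis Const.zero Const_eq_iff)

lemma Const_inverse: "a \<noteq> 0 \<Longrightarrow> Const (inverse a) * Const a = 1"
  by (simp flip: Const.mult)

lemma Const_inverse_left: "a \<noteq> 0 \<Longrightarrow> Const (inverse a) * (Const a * p) = p"
  by (simp add: Const_inverse flip: mult.assoc)

lemma Const_dvd_1: "a \<noteq> 0 \<Longrightarrow> Const a dvd 1"
  by (metis Const_inverse dvd_triv_right)

lemma Const_mult_dvd_iff: 
  assumes "a \<noteq> 0"
  shows "Const a * p dvd q \<longleftrightarrow> p dvd q"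
proof
  assume "p dvd q"
  then show "Const a * p dvd q" using mult_dvd_mono[OF Const_dvd_1[OF assms], of p q] by simp
qed (rule dvd_mult_right)

lemma dvd_Const_mult_iff: "a \<noteq> 0 \<Longrightarrow> p dvd Const a * q \<longleftrightarrow> p dvd q"
  by (metis Const_inverse_left dvd_mult)

lemma sum_single_keys:
  "(\<Sum>m\<in>Poly_Mapping.keys p. Poly_Mapping.single m (Poly_Mapping.lookup p m)) = p"
  by (rule poly_mapping_eqI)
    (auto simp: lookup_sum lookup_single when_def in_keys_iff)

lemma poly_subst_superset:
  assumes "finite A" "Poly_Mapping.keys p \<subseteq> A"
  shows "poly_subst \<sigma> p = (\<Sum>m\<in>A. Const (Poly_Mapping.lookup p m) * (\<Prod>i\<in>UNIV. \<sigma> i ^ Poly_Mapping.lookup m i))"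
  unfolding poly_subst_def using assms
  by (intro sum.mono_neutral_left) (auto simp: in_keys_iff)

lemma poly_subst_add: "poly_subst \<sigma> (p + q) = poly_subst \<sigma> p + poly_subst \<sigma> q"
proof -
  let ?A = "Poly_Mapping.keys p \<union> Poly_Mapping.keys q"
  have "Poly_Mapping.keys (p + q) \<subseteq> ?A" by (rule keys_add)
  then show ?thesis
    by (simp add: poly_subst_superset[of ?A] lookup_add Const.add algebra_simps sum.distrib)
qed

lemma poly_subst_zero [simp]: "poly_subst \<sigma> 0 = 0"
  by (simp add: poly_subst_def)

lemma poly_subst_sum: "poly_subst \<sigma> (\<Sum>x\<in>X. f x) = (\<Sum>x\<in>X. poly_subst \<sigma> (f x))"
  by (induction X rule: infinite_finite_induct) (simp_all add: poly_subst_add)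

lemma poly_subst_single:
  "poly_subst \<sigma> (Poly_Mapping.single m c) = Const c * (\<Prod>i\<in>UNIV. \<sigma> i ^ Poly_Mapping.lookup m i)"
  by (simp add: poly_subst_superset[of "{m}"])

lemma poly_subst_mult: "poly_subst \<sigma> (p * q) = poly_subst \<sigma> p * poly_subst \<sigma> q"
proof -
  have "poly_subst \<sigma> (Poly_Mapping.single m c * Poly_Mapping.single m' c') =
      poly_subst \<sigma> (Poly_Mapping.single m c) * poly_subst \<sigma> (Poly_Mapping.single m' c')" for m m' c c'
    by (simp add: mult_single poly_subst_single Const.mult lookup_add power_add prod.distrib)
  then have "poly_subst \<sigma> ((\<Sum>m\<in>Poly_Mapping.keys p. Poly_Mapping.single m (Poly_Mapping.lookup p m)) *
        (\<Sum>m\<in>Poly_Mapping.keys q. Poly_Mapping.single m (Poly_Mapping.lookup q m))) =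
      poly_subst \<sigma> (\<Sum>m\<in>Poly_Mapping.keys p. Poly_Mapping.single m (Poly_Mapping.lookup p m)) *
      poly_subst \<sigma> (\<Sum>m\<in>Poly_Mapping.keys q. Poly_Mapping.single m (Poly_Mapping.lookup q m))"
    by (simp add: sum_product poly_subst_sum)
  then show ?thesis by (simp only: sum_single_keys)
qed

lemma poly_subst_Const [simp]: "poly_subst \<sigma> (Const c) = Const c"
  by (simp add: Const_def[of c] poly_subst_single)

lemma poly_subst_Var [simp]: "poly_subst \<sigma> (Var i) = \<sigma> i"
proof -
  have "\<sigma> j ^ Poly_Mapping.lookup (Poly_Mapping.single i 1) j = (if j = i then \<sigma> i else 1)" for j
    by (simp add: lookup_single when_def)
  then show ?thesis by (simp add: Var_def poly_subst_single)
qed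

lemma poly_subst_homo: "ring_homo (poly_subst \<sigma>)"
  by (simp add: ring_homo_def poly_subst_add poly_subst_mult flip: Const.one)

lemma poly_subst_id: "poly_subst Var p = (p :: ('a::field, 'n::finite) mpoly)"
proof -
  have var: "Var i ^ k = (Poly_Mapping.single (Poly_Mapping.single i k) 1 :: ('a, 'n) mpoly)"
    for i :: "'n::finite" and k
    by (induction k) (simp_all add: Var_def mult_single flip: single_add)
  have prod: "(\<Prod>i\<in>X. Poly_Mapping.single (f i) 1) = (Poly_Mapping.single (\<Sum>i\<in>X. f i) 1 :: ('a, 'n) mpoly)"
    if "finite X" for f and X :: "'n::finite set"
    using that by induction (simp_all add: mult_single)
  have "(\<Sum>i\<in>UNIV. Poly_Mapping.single i (Poly_Mapping.lookup m i)) = m" for m :: "'n::finite \<Rightarrow>\<^sub>0 nat"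
    by (rule poly_mapping_eqI) (simp add: lookup_sum lookup_single when_def)
  then have "poly_subst Var (Poly_Mapping.single m c) = Poly_Mapping.single m c"
    for m :: "'n::finite \<Rightarrow>\<^sub>0 nat" and c :: 'a
    by (simp add: poly_subst_single var prod Const_def mult_single)
  then have "poly_subst Var (\<Sum>m\<in>Poly_Mapping.keys p. Poly_Mapping.single m (Poly_Mapping.lookup p m)) =
      (\<Sum>m\<in>Poly_Mapping.keys p. Poly_Mapping.single m (Poly_Mapping.lookup p m))"
    by (simp add: poly_subst_sum)
  then show ?thesis by (simp only: sum_single_keys)
qed

lemma mpoly_induct [case_names Const Var add mult]:
  fixes p :: "('a::field, 'n::finite) mpoly"
  assumes c: "\<And>c. P (Const c)" and v: "\<And>i. P (Var i)"
    and add: "\<And>p q. P p \<Longrightarrow> P q \<Longrightarrow> P (p + q)" and mult: "\<And>p q. P p \<Longrightarrow> P q \<Longrightarrow> P (p * q)"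
  shows "P p"
proof -
  have 0: "P 0" and 1: "P 1" using c[of 0] c[of 1] by simp_all
  have "P (Var i ^ k)" for i k by (induction k) (simp_all add: 1 v mult)
  then have "P (\<Prod>i\<in>X. Var i ^ f i)" for f X
    by (induction X rule: infinite_finite_induct) (simp_all add: 1 mult)
  then have "P (\<Sum>m\<in>X. Const (f m) * (\<Prod>i\<in>UNIV. Var i ^ g m i))" for f g and X :: "('n \<Rightarrow>\<^sub>0 nat) set"
    by (induction X rule: infinite_finite_induct) (simp_all add: 0 c mult add)
  then have "P (poly_subst Var p)" by (simp add: poly_subst_def)
  then show ?thesis by (simp add: poly_subst_id)
qed

text \<open>Agreement modulo \<open>L\<close> passes to products because \<open>f p * f q - g p * g
  q = (f p - g p) * f q + g p * (f q - g q)\<close>. This reduces congruences modulo a linear form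
  to a check on the variables.\<close>

lemma ring_homo_diff_dvd:
  fixes f g :: "('a::field, 'n::finite) mpoly \<Rightarrow> 's::comm_ring_1"
  assumes "ring_homo f" "ring_homo g" "\<And>c. L dvd f (Const c) - g (Const c)" "\<And>i. L dvd f (Var i) - g (Var i)"
  shows "L dvd f p - g p"
proof (induction p rule: mpoly_induct)
  case (add p q)
  have "f (p + q) - g (p + q) = (f p - g p) + (f q - g q)"
    using assms by (simp add: ring_homo.add)
  then show ?case using add by simp
next
  case (mult p q)
  have "f (p * q) - g (p * q) = (f p - g p) * f q + g p * (f q - g q)"
    using assms by (simp add: ring_homo.mult algebra_simps)
  then show ?case using mult by simp
qed (use assms in auto)

lemma ring_homo_eqI:
  fixes f g :: "('a::field, 'n::finite) mpoly \<Rightarrow> 's::comm_ring_1"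
  assumes "ring_homo f" "ring_homo g" "\<And>c. f (Const c) = g (Const c)" "\<And>i. f (Var i) = g (Var i)"
  shows "f p = g p"
  using ring_homo_diff_dvd[of f g 0 p] assms by simp

subsection \<open>Units\<close>

lemma lookup_mult_keys:
  "Poly_Mapping.lookup (p * q) k =
    (\<Sum>m\<in>Poly_Mapping.keys p. \<Sum>m'\<in>Poly_Mapping.keys q.
      if m + m' = k then Poly_Mapping.lookup p m * Poly_Mapping.lookup q m' else 0)"
proof -
  have "p * q = (\<Sum>m\<in>Poly_Mapping.keys p. \<Sum>m'\<in>Poly_Mapping.keys q.
      Poly_Mapping.single (m + m') (Poly_Mapping.lookup p m * Poly_Mapping.lookup q m'))"
    by (subst sum_single_keys[of p, symmetric], subst sum_single_keys[of q, symmetric])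
      (simp add: sum_product mult_single)
  then show ?thesis by (simp add: lookup_sum lookup_single when_def cong: if_cong)
qed

text \<open>Leading terms: in the order on exponents induced by that of \<open>'n\<close>, the
  maximal exponents \<open>U\<close> and \<open>V\<close> add without cancellation. So
  \<open>u * v = 1\<close> forces \<open>U = 0\<close>, and no exponent lies below 0.\<close>

lemma mpoly_unit_Const:
  fixes u v :: "('a::field, 'n::{finite,linorder}) mpoly"
  assumes "u * v = 1"
  obtains c where "u = Const c" "c \<noteq> 0"
proof -
  have ne: "Poly_Mapping.keys u \<noteq> {}" "Poly_Mapping.keys v \<noteq> {}" using assms by auto
  define U V where "U = Max (Poly_Mapping.keys u)" and "V = Max (Poly_Mapping.keys v)"
  have UV: "U \<in> Poly_Mapping.keys u" "V \<in> Poly_Mapping.keys v"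
    using ne by (simp_all add: U_def V_def)
  have *: "m + m' = U + V \<longleftrightarrow> m = U \<and> m' = V"
    if "m \<in> Poly_Mapping.keys u" "m' \<in> Poly_Mapping.keys v" for m m'
  proof -
    have le: "m \<le> U" "m' \<le> V" using that by (simp_all add: U_def V_def)
    show ?thesis
    proof
      assume eq: "m + m' = U + V"
      have "m = U"
      proof (rule ccontr)
        assume "m \<noteq> U"
        then have "m < U" using le by simp
        then have "m + m' < U + V" using le by (intro add_less_le_mono)
        then show False using eq by simp
      qed
      then show "m = U \<and> m' = V" using eq by simp
    qed simp
  qed
  have "Poly_Mapping.lookup (u * v) (U + V) =
      (\<Sum>m\<in>Poly_Mapping.keys u. \<Sum>m'\<in>Poly_Mapping.keys v.
        if m = U then if m' = V then Poly_Mapping.lookup u m * Poly_Mapping.lookup v m' else 0 else 0)"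
    unfolding lookup_mult_keys using * by (intro sum.cong refl) auto
  also have "\<dots> = Poly_Mapping.lookup u U * Poly_Mapping.lookup v V"
    using UV by (subst sum.swap) (simp add: sum.delta)
  also have "\<dots> \<noteq> 0" using UV by (simp add: in_keys_iff)
  finally have "U + V = 0" using assms by (simp add: lookup_one when_def split: if_splits)
  then have "Poly_Mapping.lookup U i + Poly_Mapping.lookup V i = 0" for i
    by (metis lookup_add lookup_zero)
  then have U: "U = 0" by (intro poly_mapping_eqI) simp
  have nonneg: "\<not> m < 0" for m :: "'n \<Rightarrow>\<^sub>0 nat"
    by (auto simp: less_poly_mapping.rep_eq less_fun_def)
  have "m = 0" if "m \<in> Poly_Mapping.keys u" for m
    using that nonneg[of m] U by (metis U_def Max_ge finite_keys order.not_eq_order_implies_strict)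
  then have "Poly_Mapping.lookup u m = Poly_Mapping.lookup (Const (Poly_Mapping.lookup u 0)) m" for m
    by (auto simp: Const_def lookup_single when_def in_keys_iff)
  then have u: "u = Const (Poly_Mapping.lookup u 0)" by (rule poly_mapping_eqI)
  have "u \<noteq> 0" using assms by auto
  then have "Poly_Mapping.lookup u 0 \<noteq> 0" using u by (metis Const.zero)
  with u show ?thesis by (rule that)
qed

subsection \<open>Linear forms\<close>

lemma linear_form_add: "linear_form (c + d) = linear_form c + linear_form d"
  by (simp add: linear_form_def Const.add algebra_simps sum.distrib)

lemma linear_form_smult: "linear_form (a *s c) = Const a * linear_form c"
  by (simp add: linear_form_def Const.mult sum_distrib_left mult.assoc)

lemma linear_form_zero [simp]: "linear_form 0 = 0"
  by (simp add: linear_form_def)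

lemma linear_form_diff: "linear_form (c - d) = linear_form c - linear_form d"
  by (simp add: linear_form_def Const.diff algebra_simps sum_subtractf)

lemma linear_form_axis: "linear_form (axis i 1) = (Var i :: ('a::field, 'n::finite) mpoly)"
proof -
  have "Const (axis i 1 $ j) * Var j = (if j = i then Var i else (0 :: ('a, 'n) mpoly))" for j
    by (simp add: axis_component)
  then show ?thesis by (simp add: linear_form_def)
qed

lemma lookup_linear_form:
  "Poly_Mapping.lookup (linear_form c) (Poly_Mapping.single i 1) = c $ i"
proof -
  have *: "Poly_Mapping.single j (Suc 0) = Poly_Mapping.single i (Suc 0) \<longleftrightarrow> j = i" for j
    by (metis lookup_single_eq lookup_single_not_eq nat.distinct(1))
  show ?thesis
    by (simp add: linear_form_def Const_def Var_def mult_single lookup_sum lookup_single when_def *)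
qed

lemma linear_form_eq_iff [simp]: "linear_form c = linear_form d \<longleftrightarrow> c = d"
  by (metis lookup_linear_form vec_eq_iff)

lemma linear_form_eq_0_iff [simp]: "linear_form c = 0 \<longleftrightarrow> c = 0"
  using linear_form_eq_iff[of c 0] by (simp del: linear_form_eq_iff)

lemma poly_subst_linear_form: "poly_subst \<sigma> (linear_form c) = (\<Sum>i\<in>UNIV. Const (c $ i) * \<sigma> i)"
proof -
  interpret ring_homo "poly_subst \<sigma>" by (rule poly_subst_homo)
  show ?thesis by (simp add: linear_form_def sum mult)
qed

text \<open>The retraction onto the polynomials on the hyperplane \<open>c = 0\<close>, parametrized by the
  coordinates other than \<open>n\<close>; it requires \<open>c $ n \<noteq> 0\<close>.\<close>
definition restrict_poly ::
    "'a::field ^ 'n::finite \<Rightarrow> 'n \<Rightarrow> ('a, 'n) mpoly \<Rightarrow> ('a, 'n) mpoly" where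
  "restrict_poly c n =
    poly_subst (\<lambda>i. Var i - (if i = n then Const (inverse (c $ n)) * linear_form c else 0))"

lemma restrict_poly_homo: "ring_homo (restrict_poly c n)"
  unfolding restrict_poly_def by (rule poly_subst_homo)

lemma restrict_poly_linear_form:
  "c $ n \<noteq> 0 \<Longrightarrow> restrict_poly c n (linear_form d) = linear_form (d - (d $ n * inverse (c $ n)) *s c)"
  by (simp add: restrict_poly_def poly_subst_linear_form right_diff_distrib sum_subtractf
      linear_form_diff linear_form_smult Const.mult mult.assoc if_distrib[of "(*) _"] cong: if_cong)
    (simp add: linear_form_def)

text \<open>A polynomial and its restriction always differ by a multiple of
  \<open>linear_form c\<close>, since this holds for the variables. The ideal is therefore the
  kernel of the retraction.\<close>

lemma linear_form_dvd_iff: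
  assumes "c $ n \<noteq> 0"
  shows "linear_form c dvd p \<longleftrightarrow> restrict_poly c n p = 0"
proof
  interpret ring_homo "restrict_poly c n" by (rule restrict_poly_homo)
  assume "linear_form c dvd p"
  then show "restrict_poly c n p = 0"
    using restrict_poly_linear_form[OF assms, of c] assms by (auto simp: dvd_def mult)
next
  assume *: "restrict_poly c n p = 0"
  have "linear_form c dvd p - restrict_poly c n p"
    by (rule ring_homo_diff_dvd[OF ring_homo_id restrict_poly_homo]) (simp_all add: restrict_poly_def)
  with * show "linear_form c dvd p" by simp
qed

text \<open>The ideal is the kernel of a homomorphism into a domain.\<close>

lemma linear_form_prime:
  fixes c :: "'a::field ^ 'n::{finite,linorder}"
  assumes "c \<noteq> 0" "linear_form c dvd p * q"
  shows "linear_form c dvd p \<or> linear_form c dvd q"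
proof -
  obtain n where n: "c $ n \<noteq> 0" using assms(1) by (auto simp: vec_eq_iff)
  interpret ring_homo "restrict_poly c n" by (rule restrict_poly_homo)
  show ?thesis using assms(2) by (simp add: linear_form_dvd_iff[OF n] mult)
qed

lemma linear_form_not_dvd_1:
  fixes c :: "'a::field ^ 'n::{finite,linorder}"
  assumes "c \<noteq> 0"
  shows "\<not> linear_form c dvd 1"
proof -
  obtain n where n: "c $ n \<noteq> 0" using assms(1) by (auto simp: vec_eq_iff)
  interpret ring_homo "restrict_poly c n" by (rule restrict_poly_homo)
  show ?thesis by (simp add: linear_form_dvd_iff[OF n])
qed

lemma linear_form_dvd_prod:
  fixes c :: "'a::field ^ 'n::{finite,linorder}"
  assumes "c \<noteq> 0" "linear_form c dvd (\<Prod>x\<in>X. f x)"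
  shows "\<exists>x\<in>X. linear_form c dvd f x"
  using assms(2)
  by (induction X rule: infinite_finite_induct)
    (auto simp: linear_form_not_dvd_1[OF assms(1)] dest: linear_form_prime[OF assms(1)])

lemma linear_form_dvd_power:
  fixes c :: "'a::field ^ 'n::{finite,linorder}"
  assumes "c \<noteq> 0" "linear_form c dvd p ^ k"
  shows "linear_form c dvd p"
  using assms(2)
  by (induction k) (auto simp: linear_form_not_dvd_1[OF assms(1)] dest: linear_form_prime[OF assms(1)])

lemma linear_form_dvd_linear_form:
  fixes c d :: "'a::field ^ 'n::{finite,linorder}"
  assumes "c \<noteq> 0" "linear_form c dvd linear_form d"
  obtains a where "d = a *s c"
proof -
  obtain n where n: "c $ n \<noteq> 0" using assms(1) by (auto simp: vec_eq_iff)
  have "d - (d $ n * inverse (c $ n)) *s c = 0"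
    using assms(2) restrict_poly_linear_form[OF n, of d] by (simp add: linear_form_dvd_iff[OF n])
  then show ?thesis using that by simp
qed

text \<open>Multipliers whose factorization is known: a divisor of such a product without linear
  factors must be a constant, because the linear factors can be cancelled one by one.\<close>

inductive_set linear_products :: "('a::field, 'n::finite) mpoly set" where
  one: "1 \<in> linear_products"
| step: "p \<in> linear_products \<Longrightarrow> c \<noteq> 0 \<Longrightarrow> linear_form c * p \<in> linear_products"

lemma linear_products_mult: "p \<in> linear_products \<Longrightarrow> q \<in> linear_products \<Longrightarrow> p * q \<in> linear_products"
  by (induction rule: linear_products.induct) (auto simp: mult.assoc intro: linear_products.intros)

lemma linear_products_power: "p \<in> linear_products \<Longrightarrow> p ^ k \<in> linear_products"
  by (induction k) (auto intro: linear_products.intros linear_products_mult)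

lemma linear_form_linear_products: "c \<noteq> 0 \<Longrightarrow> linear_form c \<in> linear_products"
  using linear_products.step[OF linear_products.one, of c] by simp

lemma dvd_linear_products:
  fixes u :: "('a::field, 'n::{finite,linorder}) mpoly"
  assumes "p \<in> linear_products" "u dvd p" "\<And>c. c \<noteq> 0 \<Longrightarrow> \<not> linear_form c dvd u"
  obtains a where "u = Const a" "a \<noteq> 0"
proof -
  have "u dvd 1" using assms(1,2)
  proof induction
    case one
    then show ?case .
  next
    case (step p c)
    from step.prems obtain v where v: "linear_form c * p = u * v" by (auto simp: dvd_def)
    then have "linear_form c dvd u * v" by (metis dvd_triv_left)
    then have "linear_form c dvd v"
      using linear_form_prime[OF \<open>c \<noteq> 0\<close>] assms(3)[OF \<open>c \<noteq> 0\<close>] by blast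
    then obtain w where "v = linear_form c * w" by (auto simp: dvd_def)
    then have "linear_form c * p = linear_form c * (u * w)" using v by (simp add: mult_ac)
    then have "p = u * w" using \<open>c \<noteq> 0\<close> by simp
    then show ?case using step.IH by simp
  qed
  then show ?thesis using that by (metis dvd_def mpoly_unit_Const)
qed

text \<open>By primality, a power of the form of \<open>y\<close> that divides a multiple of a power
  of the form of \<open>x\<close> divides the cofactor. So the powers can be split off one form
  after the other.\<close>

lemma prod_dvd_coprime_forms:
  fixes f :: "'x \<Rightarrow> 'a::field ^ 'n::{finite,linorder}"
  assumes "finite X" "\<And>x. x \<in> X \<Longrightarrow> f x \<noteq> 0"
    and "\<And>x y. x \<in> X \<Longrightarrow> y \<in> X \<Longrightarrow> x \<noteq> y \<Longrightarrow> \<not> linear_form (f x) dvd linear_form (f y)"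
    and "\<And>x. x \<in> X \<Longrightarrow> linear_form (f x) ^ k dvd p"
  shows "(\<Prod>x\<in>X. linear_form (f x)) ^ k dvd p"
  using assms
proof (induction X arbitrary: p)
  case (insert x X)
  have cancel: "linear_form (f y) ^ j dvd q" if "linear_form (f y) ^ j dvd linear_form (f x) * q" "y \<in> X" for y j q
    using that(1)
  proof (induction j arbitrary: q)
    case (Suc j)
    have y: "f y \<noteq> 0" "\<not> linear_form (f y) dvd linear_form (f x)"
      using insert.prems(1,2) insert.hyps(2) that(2) by auto
    have "linear_form (f y) dvd linear_form (f x) * q" using Suc.prems by (metis dvd_mult_left power_Suc)
    then have "linear_form (f y) dvd q" using linear_form_prime[OF y(1)] y(2) by blast
    then obtain r where r: "q = linear_form (f y) * r" by (auto simp: dvd_def)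
    have "linear_form (f y) * linear_form (f y) ^ j dvd linear_form (f y) * (linear_form (f x) * r)"
      using Suc.prems by (simp only: r power_Suc mult.left_commute)
    then have "linear_form (f y) ^ j dvd linear_form (f x) * r" using y(1) by simp
    from Suc.IH[OF this] show ?case by (simp add: r)
  qed simp
  have cancel': "linear_form (f y) ^ k dvd q" if "linear_form (f y) ^ k dvd linear_form (f x) ^ j * q" "y \<in> X" for y j q
    using that(1)
  proof (induction j arbitrary: q)
    case (Suc j)
    then have "linear_form (f y) ^ k dvd linear_form (f x) * (linear_form (f x) ^ j * q)"
      by (simp only: power_Suc mult.assoc)
    then have "linear_form (f y) ^ k dvd linear_form (f x) ^ j * q" by (rule cancel) (rule that(2))
    then show ?case by (rule Suc.IH)
  qed (simp only: power_0 mult_1)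
  obtain q where q: "p = linear_form (f x) ^ k * q" using insert.prems(3)[OF insertI1] by (rule dvdE)
  have "(\<Prod>y\<in>X. linear_form (f y)) ^ k dvd q"
  proof (rule insert.IH)
    fix y assume "y \<in> X"
    then show "linear_form (f y) ^ k dvd q"
      using insert.prems(3)[of y] cancel'[of y k q] q by simp
  qed (use insert.prems in auto)
  then show ?case using insert.hyps by (simp add: q power_mult_distrib)
qed simp

section \<open>The action on polynomials, derivations and differential derivations\<close>

definition vec_map :: "('r \<Rightarrow> 's) \<Rightarrow> 'r ^ 'm::finite \<Rightarrow> 's ^ 'm" where
  "vec_map h a = (\<chi> i. h (a $ i))"

lemma vec_map_nth [simp]: "vec_map h a $ i = h (a $ i)"
  by (simp add: vec_map_def)

context ring_homo
begin

lemma ext_sign [simp]: "h (ext_sign I J) = ext_sign I J"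
  by (simp add: ext_sign_def power minus)

lemma wedge: "vec_map h (a \<and>\<^sub>e b) = vec_map h a \<and>\<^sub>e vec_map h b"
  by (simp add: vec_eq_iff wedge_nth sum mult)

lemma ext_one [simp]: "vec_map h ext_one = ext_one"
  by (simp add: vec_eq_iff ext_one_def axis_component)

lemma ext_vec: "vec_map h (ext_vec a) = ext_vec (vec_map h a)"
  by (auto simp: vec_eq_iff ext_vec_nth sum intro!: comm_monoid_add_class.sum.cong)

lemma wedge_over: "vec_map h (wedge_over I u) = wedge_over I (\<lambda>i. vec_map h (u i))"
  by (induction I rule: min_insert_induct) (simp_all add: wedge_over_insert_min wedge)

lemma wedge_over_ext_vec:
  "h (wedge_over I (\<lambda>i. ext_vec (u i)) $ K) = wedge_over I (\<lambda>i. ext_vec (vec_map h (u i))) $ K"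
  by (metis (no_types, lifting) ext ext_vec vec_map_nth wedge_over)

lemma ext_map: "vec_map h (ext_map u a) = ext_map (\<lambda>i. vec_map h (u i)) (vec_map h a)"
  by (simp add: vec_eq_iff ext_map_nth sum mult wedge_over_ext_vec)

lemma ext_det: "h (ext_det u) = ext_det (\<lambda>i. vec_map h (u i))"
  by (simp add: ext_det_def wedge_over_ext_vec)

end

subsection \<open>Invertible matrices\<close>

lemma
  fixes A :: "'a::field ^ 'n ^ 'n"
  assumes "invertible A"
  shows matrix_inv_right: "A ** matrix_inv A = mat 1" and matrix_inv_left: "matrix_inv A ** A = mat 1"
  using assms unfolding invertible_def matrix_inv_def by (metis (mono_tags, lifting) someI_ex)+

lemma matrix_inv_unique:
  fixes A :: "'a::field ^ 'n ^ 'n"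
  assumes "A ** B = mat 1"
  shows "matrix_inv A = B"
proof -
  have "invertible A" using assms by (metis invertible_def matrix_left_right_inverse)
  then show ?thesis
    using assms by (metis matrix_inv_left matrix_mul_assoc matrix_mul_lid matrix_mul_rid)
qed

lemma matrix_inv_mult:
  fixes A B :: "'a::field ^ 'n ^ 'n"
  assumes "invertible A" "invertible B"
  shows "matrix_inv (A ** B) = matrix_inv B ** matrix_inv A"
proof (rule matrix_inv_unique)
  have "A ** B ** (matrix_inv B ** matrix_inv A) = A ** (B ** matrix_inv B) ** matrix_inv A"
    by (simp add: matrix_mul_assoc)
  then show "A ** B ** (matrix_inv B ** matrix_inv A) = mat 1"
    using assms by (simp add: matrix_inv_right)
qed

lemma GL_simps [simp]:
  "carrier GL = {A. invertible A}" "x \<otimes>\<^bsub>GL\<^esub> y = x ** y" "\<one>\<^bsub>GL\<^esub> = mat 1"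
  by (simp_all add: GL_def)

lemma group_GL: "group (GL :: ('a::field, 'n::finite) sqmat monoid)"
proof (rule groupI)
  fix x :: "('a, 'n) sqmat" assume "x \<in> carrier GL"
  then show "\<exists>y\<in>carrier GL. y \<otimes>\<^bsub>GL\<^esub> x = \<one>\<^bsub>GL\<^esub>" by (auto simp: invertible_def)
next
  show "\<one>\<^bsub>GL\<^esub> \<in> carrier (GL :: ('a, 'n) sqmat monoid)"
    by (auto simp: invertible_def intro: exI[of _ "mat 1"])
qed (simp_all add: invertible_mult matrix_mul_assoc)

interpretation GL: group "GL :: ('a::field, 'n::finite) sqmat monoid"
  by (rule group_GL)

lemma inv_GL: "invertible g \<Longrightarrow> inv\<^bsub>GL\<^esub> g = matrix_inv g"
  using matrix_inv_left[of g] matrix_inv_right[of g]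
  by (intro GL.inv_equality) (auto simp: invertible_def)

locale matrix_group =
  fixes G :: "('a::field, 'n::{finite,linorder}) sqmat set"
  assumes subgroup: "subgroup G GL"
begin

lemma invertible [simp]: "g \<in> G \<Longrightarrow> invertible g"
  using subgroup.subset[OF subgroup] by auto

lemma mult_closed [simp]: "g \<in> G \<Longrightarrow> h \<in> G \<Longrightarrow> g ** h \<in> G"
  using subgroup.m_closed[OF subgroup, of g h] by simp

lemma one_closed [simp]: "mat 1 \<in> G"
  using subgroup.one_closed[OF subgroup] by simp

lemma inv_closed [simp]: "g \<in> G \<Longrightarrow> matrix_inv g \<in> G"
  using subgroup.m_inv_closed[OF subgroup, of g] by (simp add: inv_GL)

lemma inv_mult: "g \<in> G \<Longrightarrow> matrix_inv g ** g = mat 1"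
  by (simp add: matrix_inv_left)

lemma mult_inv: "g \<in> G \<Longrightarrow> g ** matrix_inv g = mat 1"
  by (simp add: matrix_inv_right)

lemma inv_mult_left: "g \<in> G \<Longrightarrow> matrix_inv g ** (g ** h) = h"
  by (simp add: matrix_mul_assoc inv_mult)

lemma mult_inv_left: "g \<in> G \<Longrightarrow> g ** (matrix_inv g ** h) = h"
  by (simp add: matrix_mul_assoc mult_inv)

lemma inv_inv: "g \<in> G \<Longrightarrow> matrix_inv (matrix_inv g) = g"
  by (rule matrix_inv_unique) (rule inv_mult)

end

subsection \<open>Polynomials\<close>

lemma act_poly_homo: "ring_homo (act_poly g)"
  unfolding act_poly_def by (rule poly_subst_homo)

interpretation act: ring_homo "act_poly g"
  by (rule act_poly_homo)

lemma act_poly_Const [simp]: "act_poly g (Const c) = Const c"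
  by (simp add: act_poly_def)

lemma act_poly_Var: "act_poly g (Var i) = linear_form (matrix_inv g $ i)"
  by (simp add: act_poly_def act_dual_def)

lemma act_poly_linear_form:
  "act_poly g (linear_form c) = linear_form (\<chi> j. \<Sum>i\<in>UNIV. c $ i * matrix_inv g $ i $ j)"
proof -
  have "act_poly g (linear_form c) = (\<Sum>i\<in>UNIV. \<Sum>j\<in>UNIV. Const (c $ i * matrix_inv g $ i $ j) * Var j)"
    by (simp add: linear_form_def act.sum act.mult act_poly_Var sum_distrib_left Const.mult mult.assoc)
  also have "\<dots> = linear_form (\<chi> j. \<Sum>i\<in>UNIV. c $ i * matrix_inv g $ i $ j)"
    by (subst sum.swap) (simp add: linear_form_def Const.sum sum_distrib_right)
  finally show ?thesis .
qed

lemma act_poly_mult: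
  assumes "invertible g" "invertible h"
  shows "act_poly (g ** h) p = act_poly g (act_poly h p)"
proof -
  have "ring_homo (act_poly g \<circ> act_poly h)"
    by (intro ring_homo_comp act_poly_homo)
  then have "act_poly (g ** h) p = (act_poly g \<circ> act_poly h) p"
    by (rule ring_homo_eqI[OF act_poly_homo])
      (simp_all add: act_poly_Var act_poly_linear_form matrix_inv_mult assms,
        simp add: matrix_matrix_mult_def)
  then show ?thesis by simp
qed

lemma matrix_inv_mat_1 [simp]: "matrix_inv (mat 1) = (mat 1 :: 'a::field ^ 'n ^ 'n)"
  by (rule matrix_inv_unique) simp

lemma act_poly_mat_1 [simp]: "act_poly (mat 1) p = (p :: ('a::field, 'n::finite) mpoly)"
proof (rule ring_homo_eqI[OF act_poly_homo ring_homo_id])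
  have "(mat 1 :: 'a ^ 'n ^ 'n) $ i = axis i 1" for i
    by (auto simp: vec_eq_iff mat_def axis_component)
  then show "act_poly (mat 1) (Var i) = (Var i :: ('a, 'n) mpoly)" for i
    by (simp add: act_poly_Var linear_form_axis)
qed simp

lemma act_poly_inv: "invertible g \<Longrightarrow> act_poly (matrix_inv g) (act_poly g p) = p"
  by (metis act_poly_mat_1 act_poly_mult invertible_def matrix_inv_left matrix_inv_right)

lemma act_poly_inv': "invertible g \<Longrightarrow> act_poly g (act_poly (matrix_inv g) p) = p"
  by (metis act_poly_mat_1 act_poly_mult invertible_def matrix_inv_left matrix_inv_right)

lemma
  shows invariant_polys_zero [simp]: "0 \<in> invariant_polys G"
    and invariant_polys_one [simp]: "1 \<in> invariant_polys G"
    and invariant_polys_Const [simp]: "Const c \<in> invariant_polys G"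
    and invariant_polys_add: "p \<in> invariant_polys G \<Longrightarrow> q \<in> invariant_polys G \<Longrightarrow> p + q \<in> invariant_polys G"
    and invariant_polys_diff: "p \<in> invariant_polys G \<Longrightarrow> q \<in> invariant_polys G \<Longrightarrow> p - q \<in> invariant_polys G"
    and invariant_polys_mult: "p \<in> invariant_polys G \<Longrightarrow> q \<in> invariant_polys G \<Longrightarrow> p * q \<in> invariant_polys G"
    and invariant_polys_ext_sign [simp]: "ext_sign I J \<in> invariant_polys G"
  by (simp_all add: invariant_polys_def act.add act.diff act.mult act.minus)

lemma invariant_polys_cancel:
  fixes p :: "('a::field, 'n::{finite,linorder}) mpoly"
  assumes "p * q \<in> invariant_polys G" "p \<in> invariant_polys G" "p \<noteq> 0"
  shows "q \<in> invariant_polys G"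
  using assms by (auto simp: invariant_polys_def act.mult)

subsection \<open>Derivations\<close>

lemma act_deriv_nth: "act_deriv g \<theta> $ k = (\<Sum>j\<in>UNIV. Const (g $ k $ j) * act_poly g (\<theta> $ j))"
  by (simp add: act_deriv_def)

lemma act_deriv_add: "act_deriv g (\<theta> + \<eta>) = act_deriv g \<theta> + act_deriv g \<eta>"
  by (simp add: vec_eq_iff act_deriv_nth act.add algebra_simps sum.distrib)

lemma act_deriv_zero [simp]: "act_deriv g 0 = 0"
  by (simp add: vec_eq_iff act_deriv_nth)

lemma act_deriv_smult: "act_deriv g (p *s \<theta>) = act_poly g p *s act_deriv g \<theta>"
  by (simp add: vec_eq_iff act_deriv_nth act.mult sum_distrib_left mult_ac)

lemma act_deriv_sum: "act_deriv g (\<Sum>x\<in>X. f x) = (\<Sum>x\<in>X. act_deriv g (f x))"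
  by (induction X rule: infinite_finite_induct) (simp_all add: act_deriv_add)

lemma act_deriv_mult:
  assumes "invertible g" "invertible h"
  shows "act_deriv (g ** h) \<theta> = act_deriv g (act_deriv h \<theta>)"
proof -
  have "act_deriv (g ** h) \<theta> $ k = act_deriv g (act_deriv h \<theta>) $ k" for k
  proof -
    have gh: "(g ** h) $ k $ j = (\<Sum>n\<in>UNIV. g $ k $ n * h $ n $ j)" for j
      by (simp add: matrix_matrix_mult_def)
    show ?thesis unfolding act_deriv_nth act_poly_mult[OF assms] gh
    by (simp add: Const.sum Const.mult act.sum act.mult sum_distrib_left sum_distrib_right mult.assoc)
      (rule sum.swap)
  qed
  then show ?thesis by (simp add: vec_eq_iff)
qed

lemma act_deriv_mat_1 [simp]: "act_deriv (mat 1) \<theta> = \<theta>"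
  by (simp add: vec_eq_iff act_deriv_nth)
    (simp add: mat_def if_distrib[of Const] if_distrib[of "\<lambda>x. x * _"] cong: if_cong)

text \<open>Undoes the matrix part of \<open>act_deriv\<close>. For an invariant derivation it says
  that \<open>g\<close> transforms the coefficients by the constant matrix
  \<open>matrix_inv g\<close>.\<close>

lemma matrix_inv_act_deriv:
  assumes "invertible g"
  shows "(\<Sum>l\<in>UNIV. Const (matrix_inv g $ i $ l) * act_deriv g \<theta> $ l) = act_poly g (\<theta> $ i)"
proof -
  have "(\<Sum>l\<in>UNIV. Const (matrix_inv g $ i $ l) * act_deriv g \<theta> $ l) =
      (\<Sum>j\<in>UNIV. Const ((matrix_inv g ** g) $ i $ j) * act_poly g (\<theta> $ j))"
    unfolding act_deriv_nth
    by (simp add: matrix_matrix_mult_def Const.sum Const.mult sum_distrib_left sum_distrib_right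
        mult.assoc) (rule sum.swap)
  also have "\<dots> = (\<Sum>j\<in>UNIV. if i = j then act_poly g (\<theta> $ j) else 0)"
    by (intro sum.cong) (auto simp: matrix_inv_left[OF assms] mat_def)
  finally show ?thesis by simp
qed

definition euler :: "('a::field, 'n::finite) deriv" where
  "euler = (\<chi> i. Var i)"

text \<open>\<open>euler\<close> corresponds to the identity endomorphism of the space, which
  conjugation fixes.\<close>

lemma act_deriv_euler:
  assumes "invertible g"
  shows "act_deriv g euler = euler"
proof -
  have "(\<Sum>j\<in>UNIV. Const (g $ k $ j) * linear_form (matrix_inv g $ j)) =
      linear_form (\<Sum>j\<in>UNIV. g $ k $ j *s matrix_inv g $ j)" for k
  proof -
    have "linear_form (\<Sum>j\<in>X. g $ k $ j *s matrix_inv g $ j) =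
      (\<Sum>j\<in>X. Const (g $ k $ j) * linear_form (matrix_inv g $ j))" if "finite X" for X
      using that by induction (simp_all add: linear_form_add linear_form_smult)
    then show ?thesis by simp
  qed
  moreover have "(\<Sum>j\<in>UNIV. g $ k $ j *s matrix_inv g $ j) = axis k 1" for k
    using matrix_inv_right[OF assms]
    by (auto simp: vec_eq_iff matrix_matrix_mult_def mat_def axis_component)
  ultimately show ?thesis
    by (simp add: vec_eq_iff act_deriv_nth euler_def act_poly_Var linear_form_axis)
qed

lemma act_deriv_const: "act_deriv g (vec_map Const v) = vec_map Const (g *v v)"
  by (simp add: vec_eq_iff act_deriv_nth matrix_vector_mult_def Const.sum Const.mult)

subsection \<open>Pulling back along a family of derivations\<close>

text \<open>Fixing \<open>v_j\<close> leaves an element of the exterior algebra, so that operations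
  on the form factor can be expressed there. \<open>deriv_row\<close> below cuts the other way:
  fixing \<open>x_I\<close> leaves a derivation.\<close>

definition slice :: "('r ^ ('n::finite set \<times> 'n)) \<Rightarrow> 'n \<Rightarrow> ('r, 'n) ext" where
  "slice \<eta> j = (\<chi> I. \<eta> $ (I, j))"

lemma slice_nth [simp]: "slice \<eta> j $ I = \<eta> $ (I, j)"
  by (simp add: slice_def)

lemma slice_add: "slice (\<eta> + \<eta>') j = slice \<eta> j + slice \<eta>' j"
  by (simp add: vec_eq_iff)

lemma slice_smult: "slice (p *s \<eta>) j = p *s slice \<eta> j"
  by (simp add: vec_eq_iff)

text \<open>\<open>pullback \<theta> \<eta> $ (I, j)\<close> is the \<open>v\<^sub>j\<close>-component of \<open>\<eta>\<close> evaluated at the \<open>\<theta> i\<close>, \<open>i \<in> I\<close>.\<close>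
definition pullback ::
    "('n \<Rightarrow> ('a, 'n) deriv) \<Rightarrow> ('a::field, 'n::{finite,linorder}) dderiv \<Rightarrow> ('a, 'n) dderiv" where
  "pullback \<theta> \<eta> = vec_lambda (\<lambda>(I, j). ext_map (\<lambda>l. \<chi> i. \<theta> i $ l) (slice \<eta> j) $ I)"

lemma slice_pullback: "slice (pullback \<theta> \<eta>) j = ext_map (\<lambda>l. \<chi> i. \<theta> i $ l) (slice \<eta> j)"
  by (simp add: vec_eq_iff pullback_def)

lemma pullback_nth: "pullback \<theta> \<eta> $ (I, j) = ext_map (\<lambda>l. \<chi> i. \<theta> i $ l) (slice \<eta> j) $ I"
  by (simp add: pullback_def)

lemma pullback_add: "pullback \<theta> (\<eta> + \<eta>') = pullback \<theta> \<eta> + pullback \<theta> \<eta>'"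
  by (auto simp: vec_eq_iff pullback_nth slice_add ext_map_add)

lemma pullback_smult: "pullback \<theta> (p *s \<eta>) = p *s pullback \<theta> \<eta>"
  by (auto simp: vec_eq_iff pullback_nth slice_smult ext_map_smult)

lemma pullback_zero [simp]: "pullback \<theta> 0 = 0"
  using pullback_smult[of \<theta> 0 0] by simp

lemma pullback_sum: "pullback \<theta> (\<Sum>x\<in>X. f x) = (\<Sum>x\<in>X. pullback \<theta> (f x))"
  by (induction X rule: infinite_finite_induct) (simp_all add: pullback_add)

definition deriv_row :: "'r ^ ('n::finite set \<times> 'n) \<Rightarrow> 'n set \<Rightarrow> 'r ^ 'n" where
  "deriv_row \<eta> I = (\<chi> j. \<eta> $ (I, j))"

lemma deriv_row_nth [simp]: "deriv_row \<eta> I $ j = \<eta> $ (I, j)"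
  by (simp add: deriv_row_def)

lemma slice_act_dderiv:
  "slice (act_dderiv g \<eta>) k = (\<Sum>j\<in>UNIV. Const (g $ k $ j) *s
    ext_map (\<lambda>i. vec_map Const (act_dual g i)) (vec_map (act_poly g) (slice \<eta> j)))"
proof -
  have "slice (act_dderiv g \<eta>) k $ K = (\<Sum>I\<in>UNIV. \<Sum>j\<in>UNIV.
      Const (g $ k $ j) * (act_poly g (\<eta> $ (I, j)) *
        wedge_over I (\<lambda>i. ext_vec (vec_map Const (act_dual g i))) $ K))" for K
    by (simp add: act_dderiv_def Const.wedge_over_ext_vec mult_ac)
  also have "\<dots> K = (\<Sum>j\<in>UNIV. \<Sum>I\<in>UNIV. Const (g $ k $ j) * (act_poly g (\<eta> $ (I, j)) *
        wedge_over I (\<lambda>i. ext_vec (vec_map Const (act_dual g i))) $ K))" for K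
    by (rule sum.swap)
  finally show ?thesis by (simp add: vec_eq_iff ext_map_nth sum_distrib_left)
qed

text \<open>Evaluation on invariant derivations absorbs the action on the form factor. Invariance of
  a differential derivation thereby becomes invariance of ordinary derivations, one for each
  \<open>I\<close>.\<close>

lemma deriv_row_pullback_act:
  assumes g: "invertible g" and inv: "\<And>i. act_deriv g (\<theta> i) = \<theta> i"
  shows "deriv_row (pullback \<theta> (act_dderiv g \<eta>)) I = act_deriv g (deriv_row (pullback \<theta> \<eta>) I)"
proof -
  let ?w = "\<lambda>l. \<chi> i. \<theta> i $ l"
  have w: "(\<Sum>l\<in>UNIV. vec_map Const (act_dual g i) $ l *s ?w l) = vec_map (act_poly g) (?w i)" for i
    using matrix_inv_act_deriv[OF g, of i "\<theta> _"] by (simp add: vec_eq_iff act_dual_def inv)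
  have "slice (pullback \<theta> (act_dderiv g \<eta>)) k =
      (\<Sum>j\<in>UNIV. Const (g $ k $ j) *s vec_map (act_poly g) (slice (pullback \<theta> \<eta>) j))" for k
    by (simp only: slice_pullback slice_act_dderiv ext_map_sum ext_map_smult ext_map_ext_map w act.ext_map)
  then have "slice (pullback \<theta> (act_dderiv g \<eta>)) k $ I =
      (\<Sum>j\<in>UNIV. Const (g $ k $ j) *s vec_map (act_poly g) (slice (pullback \<theta> \<eta>) j)) $ I" for k
    by simp
  then show ?thesis by (simp add: vec_eq_iff act_deriv_nth)
qed

lemma slice_dform_mult: "slice (\<omega> \<bullet>\<^sub>d \<eta>) j = \<omega> \<and>\<^sub>e slice \<eta> j"
  by (simp add: vec_eq_iff dform_mult_def slice_def)

lemma slice_embed_deriv: "slice (embed_deriv \<theta>) j = \<theta> $ j *s ext_one"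
  by (simp add: vec_eq_iff embed_deriv_def ext_one_def axis_component)

lemma slice_d_euler: "slice d_euler j = (axis {j} 1 :: ('a::field, 'n::finite) dform)"
proof -
  have "(if (I, j) = ({i}, i) then 1 else 0 :: ('a, 'n) mpoly) =
      (if i = j then if I = {j} then 1 else 0 else 0)" for I i by auto
  then show ?thesis by (simp add: vec_eq_iff d_euler_def axis_component del: prod.inject)
qed

lemma slice_pullback_embed:
  "slice (pullback \<theta> (\<omega> \<bullet>\<^sub>d embed_deriv \<xi>)) j = \<xi> $ j *s ext_map (\<lambda>l. \<chi> i. \<theta> i $ l) \<omega>"
  by (simp add: slice_pullback slice_dform_mult slice_embed_deriv ext_map_wedge ext_map_smult
      wedge_smult_right)

text \<open>Evaluated on \<open>\<theta> i\<close>, the form \<open>d_euler\<close> returns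
  \<open>\<theta> i\<close> itself.\<close>

lemma slice_pullback_d_euler:
  "slice (pullback \<theta> (\<omega> \<bullet>\<^sub>d d_euler)) j =
    (\<Sum>i\<in>UNIV. \<theta> i $ j *s (ext_map (\<lambda>l. \<chi> i. \<theta> i $ l) \<omega> \<and>\<^sub>e axis {i} 1))"
proof -
  have "ext_map (\<lambda>l. \<chi> i. \<theta> i $ l) (axis {j} 1) = ext_vec (\<chi> i. \<theta> i $ j)"
  proof -
    have "axis j 1 $ i * \<theta> k $ i = (if i = j then \<theta> k $ i else 0)" for i k
      by (simp add: axis_component)
    then have "(\<Sum>i\<in>UNIV. axis j 1 $ i *s (\<chi> k. \<theta> k $ i)) = (\<chi> i. \<theta> i $ j)"
      by (simp add: vec_eq_iff)
    then show ?thesis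
      using ext_map_ext_vec[of "\<lambda>l. \<chi> i. \<theta> i $ l" "axis j 1"] by (simp del: ext_map_axis)
  qed
  then show ?thesis
    by (simp add: slice_pullback slice_dform_mult slice_d_euler ext_map_wedge ext_vec_def
        wedge_sum_right wedge_smult_right del: ext_map_axis)
qed

section \<open>Traces of derivations\<close>

lemma invariant_derivsD: "\<theta> \<in> invariant_derivs G \<Longrightarrow> g \<in> G \<Longrightarrow> act_deriv g \<theta> = \<theta>"
  by (simp add: invariant_derivs_def)

lemma invariant_polysD: "p \<in> invariant_polys G \<Longrightarrow> g \<in> G \<Longrightarrow> act_poly g p = p"
  by (simp add: invariant_polys_def)

lemma invariant_derivs_smult:
  "p \<in> invariant_polys G \<Longrightarrow> \<theta> \<in> invariant_derivs G \<Longrightarrow> p *s \<theta> \<in> invariant_derivs G"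
  by (simp add: invariant_derivs_def invariant_polys_def act_deriv_smult)

context matrix_group
begin

text \<open>The relative trace from \<open>I\<close> to \<open>G\<close>. On an
  \<open>I\<close>-invariant derivation the action of \<open>g\<close> depends only on the left
  coset of \<open>g\<close>, and left multiplication permutes the cosets. \<open>R\<close> has one
  element in each coset, and \<open>r\<close> represents \<open>I\<close> itself.\<close>

lemma coset_representatives:
  assumes fin: "finite G" and I: "subgroup I GL" "I \<subseteq> G"
  obtains R r where "R \<subseteq> G" "r \<in> R" "r \<in> I" "R \<inter> I = {r}"
    "\<And>\<zeta>. \<zeta> \<in> invariant_derivs I \<Longrightarrow> (\<Sum>g\<in>R. act_deriv g \<zeta>) \<in> invariant_derivs G"
proof -
  interpret I: matrix_group I by (rule matrix_group.intro) (rule I)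
  define coset :: "('a, 'n) sqmat \<Rightarrow> ('a, 'n) sqmat set" where "coset g = (\<lambda>i. g ** i) ` I" for g
  define rep :: "('a, 'n) sqmat \<Rightarrow> ('a, 'n) sqmat" where "rep g = (SOME x. x \<in> coset g)" for g
  have rep: "rep g \<in> coset g" for g
    unfolding rep_def coset_def by (rule someI[of _ "g ** mat 1"]) (rule imageI, simp)
  have rep_cong: "coset g = coset h \<Longrightarrow> rep g = rep h" for g h by (simp add: rep_def)
  have coset_mult: "coset (g ** i) = coset g" if "i \<in> I" for g i
  proof -
    have "g ** j \<in> coset (g ** i)" if "j \<in> I" for j
    proof -
      have "g ** j = g ** i ** (matrix_inv i ** j)"
        using \<open>i \<in> I\<close> by (simp add: I.mult_inv_left flip: matrix_mul_assoc)
      moreover have "matrix_inv i ** j \<in> I" using that \<open>i \<in> I\<close> by simp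
      ultimately show ?thesis unfolding coset_def by (rule image_eqI)
    qed
    then show ?thesis using that by (auto simp: coset_def simp flip: matrix_mul_assoc)
  qed
  have rep_G: "rep g \<in> G" if "g \<in> G" for g
    using rep[of g] that I(2) by (auto simp: coset_def)
  have coset_rep: "coset (rep g) = coset g" for g
    using rep[of g] coset_mult by (auto simp: coset_def[of g])
  define R where "R = rep ` G"
  have R_sub: "R \<subseteq> G" using rep_G by (auto simp: R_def)
  have rep_R: "rep g = g" if "g \<in> R" for g
    using that rep_cong[OF coset_rep] by (auto simp: R_def)
  have coset_1: "coset (mat 1) = I" by (simp add: coset_def)
  have r_I: "rep (mat 1) \<in> I" using rep[of "mat 1"] coset_1 by simp
  have r_unique: "g = rep (mat 1)" if "g \<in> R" "g \<in> I" for g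
    using rep_R[OF that(1)] rep_cong[OF coset_mult[OF that(2), of "mat 1"]] by simp
  have r_R: "rep (mat 1) \<in> R" by (simp add: R_def)
  have tr: "(\<Sum>g\<in>R. act_deriv g \<zeta>) \<in> invariant_derivs G" if \<zeta>: "\<zeta> \<in> invariant_derivs I" for \<zeta>
  proof -
    have act_rep: "act_deriv (rep g) \<zeta> = act_deriv g \<zeta>" if "g \<in> G" for g
    proof -
      obtain i where i: "rep g = g ** i" "i \<in> I" using rep[of g] by (auto simp: coset_def)
      then show ?thesis using \<zeta> that by (simp add: act_deriv_mult invariant_derivsD)
    qed
    have "act_deriv h (\<Sum>g\<in>R. act_deriv g \<zeta>) = (\<Sum>g\<in>R. act_deriv g \<zeta>)" if h: "h \<in> G" for h
    proof -
      have inj: "inj_on (\<lambda>g. rep (h ** g)) R"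
      proof (rule inj_onI)
        fix g g' assume g: "g \<in> R" "g' \<in> R" "rep (h ** g) = rep (h ** g')"
        then have "h ** g' \<in> coset (h ** g)"
          by (metis I.one_closed coset_def coset_rep image_eqI matrix_mul_rid)
        then obtain i where "h ** g' = h ** g ** i" "i \<in> I" by (auto simp: coset_def)
        then have "g' = g ** i" using h
          by (metis inv_mult_left matrix_mul_assoc)
        then have "coset g' = coset g" using coset_mult \<open>i \<in> I\<close> by simp
        from rep_cong[OF this] show "g = g'" using g rep_R by simp
      qed
      have "(\<lambda>g. rep (h ** g)) ` R \<subseteq> R" using h R_sub by (auto simp: R_def)
      then have img: "(\<lambda>g. rep (h ** g)) ` R = R"
        using inj fin by (intro endo_inj_surj) (simp_all add: R_def)
      have "act_deriv h (\<Sum>g\<in>R. act_deriv g \<zeta>) = (\<Sum>g\<in>R. act_deriv (rep (h ** g)) \<zeta>)"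
        unfolding act_deriv_sum using R_sub h
        by (intro sum.cong refl) (auto simp: act_rep act_deriv_mult subset_eq)
      also have "\<dots> = (\<Sum>g\<in>R. act_deriv g \<zeta>)"
        using sum.reindex[OF inj, of "\<lambda>g. act_deriv g \<zeta>"] by (simp add: img o_def)
      finally show ?thesis .
    qed
    then show ?thesis by (simp add: invariant_derivs_def)
  qed
  have "R \<inter> I = {rep (mat 1)}" using r_I r_R r_unique by blast
  with R_sub r_R r_I show ?thesis using tr by (rule that)
qed

text \<open>The argument is that of Dedekind's theorem on the independence of characters: in the traces of
  the \<open>a *s \<eta>\<close> all terms but the first are eliminated one after the other, at the expense of a
  multiplier \<open>a - act_poly h a\<close> for each.\<close>
lemma trace_elimination:
  assumes fin: "finite G" and I: "subgroup I GL" "I \<subseteq> G"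
    and good: "P 1" "\<And>p q. P p \<Longrightarrow> P q \<Longrightarrow> P (p * q)"
    and sep: "\<And>h. h \<in> G - I \<Longrightarrow> \<exists>a\<in>invariant_polys I. P (a - act_poly h a)"
    and N: "invariant_derivs G \<subseteq> N" "\<And>\<xi> \<eta>. \<xi> \<in> N \<Longrightarrow> \<eta> \<in> N \<Longrightarrow> \<xi> + \<eta> \<in> N"
      "\<And>p \<xi>. \<xi> \<in> N \<Longrightarrow> p *s \<xi> \<in> N"
  obtains m where "P m" "\<And>\<eta>. \<eta> \<in> invariant_derivs I \<Longrightarrow> m *s \<eta> \<in> N"
proof -
  obtain R r where R: "R \<subseteq> G" "r \<in> R" "r \<in> I" "R \<inter> I = {r}"
    and tr: "\<And>\<zeta>. \<zeta> \<in> invariant_derivs I \<Longrightarrow> (\<Sum>g\<in>R. act_deriv g \<zeta>) \<in> invariant_derivs G"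
    using coset_representatives[OF fin I] by metis
  have finR: "finite R" using R(1) fin by (rule finite_subset)
  \<comment> \<open>The terms in \<open>X\<close> are those already eliminated. Keeping the claim
    for all \<open>a\<close> allows the next step to use it for \<open>b * a\<close> as
    well.\<close>
  have "\<exists>k. (\<forall>x\<in>X. k x = 0) \<and> P (k r) \<and> (\<forall>\<eta>\<in>invariant_derivs I. \<forall>a\<in>invariant_polys I.
      (\<Sum>g\<in>R. (k g * act_poly g a) *s act_deriv g \<eta>) \<in> N)" if "finite X" "X \<subseteq> R - {r}" for X
    using that
  proof induction
    case empty
    have "(\<Sum>g\<in>R. (1 * act_poly g a) *s act_deriv g \<eta>) \<in> N"
      if "\<eta> \<in> invariant_derivs I" "a \<in> invariant_polys I" for a \<eta>
      using tr[OF invariant_derivs_smult[OF that(2,1)]] N(1) by (auto simp: act_deriv_smult)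
    then show ?case using good(1) by (intro exI[of _ "\<lambda>_. 1"]) auto
  next
    case (insert h X)
    then obtain k where k: "\<forall>x\<in>X. k x = 0" "P (k r)"
      "\<forall>\<eta>\<in>invariant_derivs I. \<forall>a\<in>invariant_polys I.
        (\<Sum>g\<in>R. (k g * act_poly g a) *s act_deriv g \<eta>) \<in> N" by auto
    have "h \<in> G - I" using insert.prems R by auto
    then obtain b where b: "b \<in> invariant_polys I" "P (b - act_poly h b)" using sep by blast
    \<comment> \<open>These are the coefficients of the instance for \<open>b * a\<close> minus
      \<open>act_poly h b\<close> times the instance for \<open>a\<close>. The one at
      \<open>h\<close> becomes 0; the one at \<open>r\<close> acquires the factor
      \<open>b - act_poly h b\<close>, because \<open>r\<close> lies in \<open>I\<close> and fixes
      \<open>b\<close>.\<close>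
    define k' where "k' g = k g * (act_poly g b - act_poly h b)" for g
    have "(\<Sum>g\<in>R. (k' g * act_poly g a) *s act_deriv g \<eta>) \<in> N"
      if "\<eta> \<in> invariant_derivs I" "a \<in> invariant_polys I" for a \<eta>
    proof -
      have "(\<Sum>g\<in>R. (k' g * act_poly g a) *s act_deriv g \<eta>) =
          (\<Sum>g\<in>R. (k g * act_poly g (b * a)) *s act_deriv g \<eta>) +
          (- act_poly h b) *s (\<Sum>g\<in>R. (k g * act_poly g a) *s act_deriv g \<eta>)"
        by (simp add: k'_def vec_eq_iff act.mult sum_distrib_left algebra_simps sum_subtractf
            sum_negf)
      then show ?thesis using N(2,3) k(3) that b(1) by (simp add: invariant_polys_mult)
    qed
    moreover have "act_poly r b = b" using b(1) R(3) by (rule invariant_polysD)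
    ultimately show ?case using k(1,2) b(2) good(2) by (intro exI[of _ k']) (auto simp: k'_def)
  qed
  from this[of "R - {r}"] finR obtain k where k: "\<forall>x\<in>R - {r}. k x = 0" "P (k r)"
    "\<forall>\<eta>\<in>invariant_derivs I. \<forall>a\<in>invariant_polys I.
      (\<Sum>g\<in>R. (k g * act_poly g a) *s act_deriv g \<eta>) \<in> N" by auto
  have "k r *s \<eta> \<in> N" if \<eta>: "\<eta> \<in> invariant_derivs I" for \<eta>
  proof -
    have "(\<Sum>g\<in>R. (k g * act_poly g 1) *s act_deriv g \<eta>) =
        (\<Sum>g\<in>R. if g = r then k r *s \<eta> else 0)"
      using R(3) \<eta> by (intro sum.cong) (auto simp: k(1) invariant_derivsD)
    then show ?thesis using k(3) \<eta> invariant_polys_one finR R(2) by fastforce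
  qed
  with k(2) show ?thesis by (rule that)
qed

text \<open>The inertia group of the prime ideal generated by \<open>linear_form c\<close>. Only
  elements outside of it can be eliminated with multipliers that are not divisible by
  \<open>linear_form c\<close>.\<close>

definition inertia :: "'a ^ 'n::{finite,linorder} \<Rightarrow> ('a, 'n) sqmat set" where
  "inertia c = {g \<in> G. \<forall>p. linear_form c dvd act_poly g p - p}"

lemma inertia_subset: "inertia c \<subseteq> G"
  by (auto simp: inertia_def)

lemma subgroup_inertia: "subgroup (inertia c) GL"
proof (rule GL.subgroupI)
  show "inertia c \<subseteq> carrier GL" by (auto simp: inertia_def)
  have "mat 1 \<in> inertia c" by (simp add: inertia_def)
  then show "inertia c \<noteq> {}" by blast
next
  fix g assume g: "g \<in> inertia c"
  have "linear_form c dvd act_poly (matrix_inv g) p - p" for p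
  proof -
    have "linear_form c dvd act_poly g (act_poly (matrix_inv g) p) - act_poly (matrix_inv g) p"
      using g by (simp add: inertia_def)
    moreover have "act_poly g (act_poly (matrix_inv g) p) = p"
      using g by (simp add: inertia_def act_poly_inv')
    ultimately show ?thesis by (metis dvd_minus_iff minus_diff_eq)
  qed
  then show "inv\<^bsub>GL\<^esub> g \<in> inertia c" using g by (simp add: inertia_def inv_GL)
next
  fix g h assume gh: "g \<in> inertia c" "h \<in> inertia c"
  have "linear_form c dvd act_poly g (act_poly h p) - act_poly h p + (act_poly h p - p)" for p
    using gh unfolding inertia_def by (intro dvd_add) auto
  then show "g \<otimes>\<^bsub>GL\<^esub> h \<in> inertia c" using gh by (simp add: inertia_def act_poly_mult)
qed

text \<open>The coefficients of \<open>\<Prod>i\<in>I. (X - act_poly i b)\<close> are \<open>I\<close>-invariant.\<close>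
lemma separate_inertia:
  assumes fin: "finite G" and c: "c \<noteq> 0" and h: "h \<in> G - inertia c"
  shows "\<exists>a\<in>invariant_polys (inertia c). \<not> linear_form c dvd a - act_poly h a"
proof (rule ccontr)
  let ?I = "inertia c" and ?L = "linear_form c"
  interpret I: matrix_group ?I by (rule matrix_group.intro) (rule subgroup_inertia)
  assume "\<not> (\<exists>a\<in>invariant_polys ?I. \<not> ?L dvd a - act_poly h a)"
  then have *: "?L dvd a - act_poly h a" if "a \<in> invariant_polys ?I" for a using that by blast
  have finI: "finite ?I" using fin inertia_subset by (rule rev_finite_subset)
  have "?L dvd act_poly h b - b" for b
  proof -
    define e where "e k = (\<Sum>B | B \<subseteq> ?I \<and> card B = k. \<Prod>i\<in>B. - act_poly i b)" for k
    have expand: "(\<Prod>i\<in>?I. x - act_poly i b) = (\<Sum>k\<le>card ?I. e k * x ^ (card ?I - k))" for x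
    proof -
      have "(\<Prod>i\<in>?I. x - act_poly i b) =
          (\<Sum>B\<in>Pow ?I. (\<Prod>i\<in>B. - act_poly i b) * x ^ card (?I - B))"
        using prod_add[OF finI, of "\<lambda>i. - act_poly i b" "\<lambda>_. x"] by simp
      also have "\<dots> = (\<Sum>k\<le>card ?I. \<Sum>B | B \<in> Pow ?I \<and> card B = k.
          (\<Prod>i\<in>B. - act_poly i b) * x ^ card (?I - B))"
        using finI by (intro sum.group[symmetric]) (auto intro: card_mono)
      also have "\<dots> = (\<Sum>k\<le>card ?I. e k * x ^ (card ?I - k))"
        unfolding e_def sum_distrib_right using finI
        by (intro sum.cong refl) (auto simp: card_Diff_subset finite_subset)
      finally show ?thesis .
    qed
    have e_inv: "e k \<in> invariant_polys ?I" for k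
      unfolding invariant_polys_def
    proof (intro CollectI ballI)
      fix g assume g: "g \<in> ?I"
      have inj: "inj_on (\<lambda>x. g ** x) A" for A
        using g by (intro inj_onI) (metis I.inv_mult_left)
      have inj': "inj_on (\<lambda>x. matrix_inv g ** x) A" for A
        using g by (intro inj_onI) (metis I.mult_inv_left)
      have "act_poly g (e k) = (\<Sum>B | B \<subseteq> ?I \<and> card B = k. \<Prod>i\<in>B. - act_poly (g ** i) b)"
        unfolding e_def act.sum act.prod act.minus using g
        by (intro sum.cong prod.cong refl) (auto simp: act_poly_mult subset_eq)
      also have "\<dots> = e k" unfolding e_def
      proof (rule sum.reindex_bij_witness[of _ "\<lambda>B. (\<lambda>x. matrix_inv g ** x) ` B" "\<lambda>B. (\<lambda>x. g ** x) ` B"])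
        fix B assume B: "B \<in> {B. B \<subseteq> ?I \<and> card B = k}"
        show "(\<lambda>x. matrix_inv g ** x) ` (\<lambda>x. g ** x) ` B = B"
          using g by (simp add: image_image I.inv_mult_left)
        show "(\<lambda>x. g ** x) ` B \<in> {B. B \<subseteq> ?I \<and> card B = k}"
          using B g by (auto simp: card_image[OF inj])
        show "(\<lambda>x. g ** x) ` (\<lambda>x. matrix_inv g ** x) ` B = B"
          using g by (simp add: image_image I.mult_inv_left)
        show "(\<lambda>x. matrix_inv g ** x) ` B \<in> {B. B \<subseteq> ?I \<and> card B = k}"
          using B g by (auto simp: card_image[OF inj'])
        show "(\<Prod>i\<in>(\<lambda>x. g ** x) ` B. - act_poly i b) = (\<Prod>i\<in>B. - act_poly (g ** i) b)"
          by (simp add: prod.reindex[OF inj])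
      qed
      finally show "act_poly g (e k) = e k" .
    qed
    \<comment> \<open>The factor of the identity vanishes. Applying \<open>h\<close> and replacing
      each \<open>act_poly h (e k)\<close> by \<open>e k\<close> modulo \<open>?L\<close> shows that
      \<open>act_poly h b\<close> is a root modulo \<open>?L\<close> too. So it is congruent to some
      \<open>act_poly i b\<close>, and hence to \<open>b\<close>; since \<open>b\<close> is
      arbitrary, \<open>h\<close> would lie in the inertia group.\<close>
    have "(\<Prod>i\<in>?I. b - act_poly i b) = 0"
      using finI by (intro prod_zero bexI[of _ "mat 1"]) auto
    then have "(\<Sum>k\<le>card ?I. act_poly h (e k) * act_poly h b ^ (card ?I - k)) = 0"
      using arg_cong[OF expand[of b], of "act_poly h"] by (simp add: act.sum act.mult act.power)
    moreover have "?L dvd (\<Sum>k\<le>card ?I. (e k - act_poly h (e k)) * act_poly h b ^ (card ?I - k))"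
      by (intro dvd_sum dvd_mult2 * e_inv)
    ultimately have "?L dvd (\<Prod>i\<in>?I. act_poly h b - act_poly i b)"
      unfolding expand by (simp add: left_diff_distrib sum_subtractf)
    then obtain i where i: "i \<in> ?I" "?L dvd act_poly h b - act_poly i b"
      using linear_form_dvd_prod[OF c] by blast
    have "?L dvd act_poly i b - b" using i(1) by (simp add: inertia_def)
    from dvd_add[OF i(2) this] show ?thesis by simp
  qed
  then show False using h by (simp add: inertia_def)
qed

text \<open>In terms of the localization at the prime \<open>linear_form c\<close>: passing from
  \<open>G\<close> to the inertia group does not enlarge the \<open>S\<close>-module generated by
  the invariant derivations.\<close>

lemma inertia_multiplier:
  assumes fin: "finite G" and c: "c \<noteq> 0"
    and N: "invariant_derivs G \<subseteq> N" "\<And>\<xi> \<eta>. \<xi> \<in> N \<Longrightarrow> \<eta> \<in> N \<Longrightarrow> \<xi> + \<eta> \<in> N"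
      "\<And>p \<xi>. \<xi> \<in> N \<Longrightarrow> p *s \<xi> \<in> N"
  obtains m where "\<not> linear_form c dvd m" "\<And>\<eta>. \<eta> \<in> invariant_derivs (inertia c) \<Longrightarrow> m *s \<eta> \<in> N"
proof (rule trace_elimination[OF fin subgroup_inertia inertia_subset, of "\<lambda>p. \<not> linear_form c dvd p" c N])
  show "\<not> linear_form c dvd 1" by (rule linear_form_not_dvd_1[OF c])
  show "\<not> linear_form c dvd p * q" if "\<not> linear_form c dvd p" "\<not> linear_form c dvd q" for p q
    using linear_form_prime[OF c] that by blast
  show "\<exists>a\<in>invariant_polys (inertia c). \<not> linear_form c dvd a - act_poly h a" if "h \<in> G - inertia c" for h
    by (rule separate_inertia[OF fin c that])
qed (use N that in auto)

text \<open>Elimination down to the trivial group. A nontrivial \<open>h\<close> moves some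
  variable, and \<open>Var i - act_poly h (Var i)\<close> is then itself a nonzero linear
  form.\<close>

lemma linear_products_multiplier:
  assumes fin: "finite G"
    and N: "invariant_derivs G \<subseteq> N" "\<And>\<xi> \<eta>. \<xi> \<in> N \<Longrightarrow> \<eta> \<in> N \<Longrightarrow> \<xi> + \<eta> \<in> N"
      "\<And>p \<xi>. \<xi> \<in> N \<Longrightarrow> p *s \<xi> \<in> N"
  obtains m where "m \<in> linear_products" "\<And>\<eta>. m *s \<eta> \<in> N"
proof -
  have one: "subgroup {mat 1} (GL :: ('a, 'n) sqmat monoid)"
    using GL.triv_subgroup by simp
  show ?thesis
  proof (rule trace_elimination[OF fin one, of "\<lambda>p. p \<in> linear_products" N])
    fix h assume h: "h \<in> G - {mat 1}"
    have "matrix_inv h \<noteq> mat 1" using h inv_inv[of h] by auto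
    then obtain i where i: "matrix_inv h $ i \<noteq> (mat 1 :: ('a, 'n) sqmat) $ i" by (auto simp: vec_eq_iff)
    moreover have "(mat 1 :: ('a, 'n) sqmat) $ i = axis i 1"
      by (auto simp: vec_eq_iff mat_def axis_component)
    ultimately have "linear_form (axis i 1 - matrix_inv h $ i) \<in> linear_products"
      by (intro linear_form_linear_products) simp
    then have "Var i - act_poly h (Var i) \<in> linear_products"
      by (simp add: linear_form_diff linear_form_axis act_poly_Var)
    then show "\<exists>a\<in>invariant_polys {mat 1}. a - act_poly h a \<in> linear_products"
      by (intro bexI[of _ "Var i"]) (simp_all add: invariant_polys_def)
  qed (use N that in \<open>auto intro: linear_products.one linear_products_mult simp: invariant_derivs_def\<close>)
qed

end

section \<open>Reflections\<close>

lemma covec_eval_add: "covec_eval c (v + w) = covec_eval c v + covec_eval c w"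
  by (simp add: covec_eval_def algebra_simps sum.distrib)

lemma covec_eval_smult: "covec_eval c (a *s v) = a * covec_eval c v"
  by (simp add: covec_eval_def sum_distrib_left mult_ac)

lemma covec_eval_smult_left: "covec_eval (a *s c) v = a * covec_eval c v"
  by (simp add: covec_eval_def sum_distrib_left mult_ac)

lemma covec_eval_zero [simp]: "covec_eval c 0 = 0" "covec_eval 0 v = 0"
  by (simp_all add: covec_eval_def)

lemma covec_eval_diff: "covec_eval c (v - w) = covec_eval c v - covec_eval c w"
  by (simp add: covec_eval_def algebra_simps sum_subtractf)

lemma covec_eval_minus: "covec_eval c (- v) = - covec_eval c v"
  by (simp add: covec_eval_def sum_negf)

lemma covec_eval_axis [simp]: "covec_eval c (axis i 1) = c $ i"
proof -
  have "c $ j * axis i 1 $ j = (if j = i then c $ i else 0)" for j by (simp add: axis_component)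
  then show ?thesis by (simp add: covec_eval_def)
qed

lemma covec_eval_eqD: "(\<And>v. covec_eval c v = covec_eval d v) \<Longrightarrow> c = d"
  by (metis covec_eval_axis vec_eq_iff)

lemma act_poly_linear_form_eq:
  assumes "\<And>v. covec_eval d v = covec_eval c (matrix_inv g *v v)"
  shows "act_poly g (linear_form c) = linear_form d"
proof -
  have "covec_eval c (matrix_inv g *v v) = covec_eval (\<chi> j. \<Sum>i\<in>UNIV. c $ i * matrix_inv g $ i $ j) v" for v
    by (simp add: covec_eval_def matrix_vector_mult_def sum_distrib_left sum_distrib_right mult.assoc)
      (rule sum.swap)
  then have "d = (\<chi> j. \<Sum>i\<in>UNIV. c $ i * matrix_inv g $ i $ j)"
    using assms by (intro covec_eval_eqD) simp
  then show ?thesis by (simp add: act_poly_linear_form)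
qed

lemma subspace_kernel: "vec.subspace {v. covec_eval c v = 0}"
  by (rule vec.subspaceI) (simp_all add: covec_eval_add covec_eval_smult)

lemma hyperplane_kernel:
  assumes "c \<noteq> 0"
  shows "hyperplane {v. covec_eval c v = 0}"
proof -
  let ?K = "{v. covec_eval c v = 0}"
  obtain n where n: "c $ n \<noteq> 0" using assms by (auto simp: vec_eq_iff)
  have "v \<in> vec.span (insert (axis n 1) ?K)" for v
  proof -
    have "v - (covec_eval c v / c $ n) *s axis n 1 \<in> ?K"
      using n by (simp add: covec_eval_diff covec_eval_smult)
    then have "v - (covec_eval c v / c $ n) *s axis n 1 + (covec_eval c v / c $ n) *s axis n 1
        \<in> vec.span (insert (axis n 1) ?K)"
      by (intro vec.span_add vec.span_scale vec.span_base) auto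
    then show ?thesis by simp
  qed
  then have "vec.span (insert (axis n 1) ?K) = UNIV" by blast
  then have "vec.dim (insert (axis n 1) ?K) = CARD('b)" by (metis vec.dim_span vec_dim_card)
  moreover have "vec.span ?K = ?K" by (rule iffD2[OF vec.span_eq_iff subspace_kernel])
  moreover have "axis n 1 \<notin> ?K" using n by simp
  ultimately have "Suc (vec.dim ?K) = CARD('b)" by (metis vec.dim_insert Suc_eq_plus1)
  then show ?thesis unfolding hyperplane_def using subspace_kernel by blast
qed

lemma hyperplane_not_UNIV: "\<not> hyperplane (UNIV :: ('a::field ^ 'n) set)"
  unfolding hyperplane_def vec_dim_card by simp

lemma hyperplane_subset_eq:
  assumes "hyperplane H" "hyperplane H'" "H \<subseteq> H'"
  shows "H = H'"
  using assms unfolding hyperplane_def by (intro vec.subspace_dim_equal) auto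

text \<open>The map that adds \<open>covec_eval c v *s w\<close> to \<open>v\<close>. For fixed
  \<open>c\<close> this covers the reflections about the kernel of \<open>c\<close> together with
  the identity, at \<open>w = 0\<close>. The number \<open>1 + covec_eval c w\<close>, which recurs
  below, is the eigenvalue at \<open>w\<close>.\<close>

definition reflection_matrix :: "'a::field ^ 'n \<Rightarrow> 'a ^ 'n \<Rightarrow> 'a ^ 'n ^ 'n" where
  "reflection_matrix c w = (\<chi> i j. (if i = j then 1 else 0) + w $ i * c $ j)"

lemma reflection_matrix_mult_vec: "reflection_matrix c w *v v = v + covec_eval c v *s w"
proof -
  have "((if i = j then 1 else 0) + w $ i * c $ j) * v $ j =
      (if i = j then v $ j else 0) + c $ j * v $ j * w $ i" for i j
    by (simp add: algebra_simps)
  then show ?thesis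
    by (simp add: vec_eq_iff reflection_matrix_def matrix_vector_mult_def covec_eval_def sum.distrib
        sum_distrib_right)
qed

lemma reflection_matrixI: "(\<And>v. s *v v = v + covec_eval c v *s w) \<Longrightarrow> s = reflection_matrix c w"
  by (simp add: matrix_eq reflection_matrix_mult_vec)

lemma reflection_matrix_mult:
  "reflection_matrix c w ** reflection_matrix c w' = reflection_matrix c (w + w' + covec_eval c w' *s w)"
  by (rule reflection_matrixI)
    (simp add: reflection_matrix_mult_vec covec_eval_add covec_eval_smult vec_eq_iff algebra_simps
      flip: matrix_vector_mul_assoc)

lemma reflection_matrix_zero [simp]: "reflection_matrix c 0 = mat 1"
  by (simp add: reflection_matrix_def mat_def)

lemma reflection_matrix_eq_1_iff:
  assumes "c \<noteq> 0"
  shows "reflection_matrix c w = mat 1 \<longleftrightarrow> w = 0"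
proof
  obtain n where n: "c $ n \<noteq> 0" using assms by (auto simp: vec_eq_iff)
  assume "reflection_matrix c w = mat 1"
  then have "reflection_matrix c w *v axis n 1 = axis n 1" by simp
  then show "w = 0" using n by (simp add: reflection_matrix_mult_vec)
qed simp

lemma invertible_reflection_matrix:
  assumes "invertible (reflection_matrix c w)"
  shows "1 + covec_eval c w \<noteq> 0"
proof
  assume *: "1 + covec_eval c w = 0"
  have "reflection_matrix c w *v w = (1 + covec_eval c w) *s w"
    by (simp add: reflection_matrix_mult_vec vec_eq_iff algebra_simps)
  then have "matrix_inv (reflection_matrix c w) *v (reflection_matrix c w *v w) = 0"
    using * by (simp add: matrix_vector_mult_0_right)
  then have "w = 0" using assms by (simp add: matrix_vector_mul_assoc matrix_inv_left)
  then show False using * by simp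
qed

lemma matrix_inv_reflection_matrix:
  assumes "1 + covec_eval c w \<noteq> 0"
  shows "matrix_inv (reflection_matrix c w) = reflection_matrix c ((- inverse (1 + covec_eval c w)) *s w)"
proof (rule matrix_inv_unique)
  have "w + (- inverse (1 + covec_eval c w)) *s w + covec_eval c ((- inverse (1 + covec_eval c w)) *s w) *s w =
      (1 - inverse (1 + covec_eval c w) * (1 + covec_eval c w)) *s w"
    by (simp add: vec_eq_iff covec_eval_smult covec_eval_minus algebra_simps)
  also have "\<dots> = 0" using assms by simp
  finally show "reflection_matrix c w ** reflection_matrix c ((- inverse (1 + covec_eval c w)) *s w) = mat 1"
    by (simp add: reflection_matrix_mult)
qed

lemma act_poly_reflection_Var:
  assumes "1 + covec_eval c w \<noteq> 0"
  shows "act_poly (reflection_matrix c w) (Var i) =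
    Var i - Const (w $ i * inverse (1 + covec_eval c w)) * linear_form c"
proof -
  have "matrix_inv (reflection_matrix c w) $ i = axis i 1 - (w $ i * inverse (1 + covec_eval c w)) *s c"
    unfolding matrix_inv_reflection_matrix[OF assms]
    by (auto simp: vec_eq_iff reflection_matrix_def axis_component)
  then show ?thesis by (simp add: act_poly_Var linear_form_diff linear_form_smult linear_form_axis)
qed

lemma act_poly_reflection_linear_form:
  assumes "1 + covec_eval c w \<noteq> 0"
  shows "act_poly (reflection_matrix c w) (linear_form c) =
    Const (inverse (1 + covec_eval c w)) * linear_form c"
proof -
  have "x + x * (- inverse (1 + covec_eval c w) * covec_eval c w) = inverse (1 + covec_eval c w) * x" for x
    using assms by (simp add: divide_simps) (simp add: algebra_simps)
  then have "act_poly (reflection_matrix c w) (linear_form c) =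
      linear_form (inverse (1 + covec_eval c w) *s c)"
    by (intro act_poly_linear_form_eq)
      (simp only: matrix_inv_reflection_matrix[OF assms] reflection_matrix_mult_vec covec_eval_add
        covec_eval_smult covec_eval_smult_left)
  then show ?thesis by (simp add: linear_form_smult)
qed

lemma reflection_matrix_pow:
  "reflection_matrix c w [^]\<^bsub>GL\<^esub> (k :: nat) =
    reflection_matrix c ((\<Sum>i<k. (1 + covec_eval c w) ^ i) *s w)"
proof (induction k)
  case (Suc k)
  let ?S = "\<Sum>i<k. (1 + covec_eval c w) ^ i"
  have "(\<Sum>i<Suc k. (1 + covec_eval c w) ^ i) = 1 + (1 + covec_eval c w) * ?S"
    by (simp add: sum.lessThan_Suc_shift sum_distrib_left del: sum.lessThan_Suc)
  then show ?case using Suc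
    by (simp add: reflection_matrix_mult) (simp add: vec_eq_iff algebra_simps)
qed simp

text \<open>The power multiplies \<open>w\<close> by a geometric sum, which vanishes together with
  \<open>(1 + covec_eval c w) ^ k - 1\<close> as the ratio is not 1. So the reflection has the order
  of its eigenvalue.\<close>

lemma reflection_matrix_pow_eq_1_iff:
  assumes "c \<noteq> 0" "covec_eval c w \<noteq> 0"
  shows "reflection_matrix c w [^]\<^bsub>GL\<^esub> (k :: nat) = mat 1 \<longleftrightarrow> (1 + covec_eval c w) ^ k = 1"
proof -
  have "w \<noteq> 0" using assms(2) by auto
  then have "reflection_matrix c w [^]\<^bsub>GL\<^esub> k = mat 1 \<longleftrightarrow> (\<Sum>i<k. (1 + covec_eval c w) ^ i) = 0"
    using assms(1) by (simp add: reflection_matrix_pow reflection_matrix_eq_1_iff)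
  also have "\<dots> \<longleftrightarrow> (1 + covec_eval c w) ^ k - 1 = 0"
    using power_diff_1_eq[of "1 + covec_eval c w" k] assms(2) by simp
  finally show ?thesis by simp
qed

lemma ord_reflection_matrix:
  assumes "c \<noteq> 0" "covec_eval c w \<noteq> 0" "invertible (reflection_matrix c w)"
  shows "(1 + covec_eval c w) ^ k = 1 \<longleftrightarrow> group.ord GL (reflection_matrix c w) dvd k"
  using reflection_matrix_pow_eq_1_iff[OF assms(1,2)] GL.pow_eq_id[of "reflection_matrix c w" k] assms(3)
  by simp

lemma diagonalizable_reflection_matrix:
  fixes c w :: "'a::field ^ 'n"
  assumes c: "c \<noteq> 0" and w: "covec_eval c w \<noteq> 0"
  shows "diagonalizable (reflection_matrix c w)"
proof -
  obtain n where n: "c $ n \<noteq> 0" using c by (auto simp: vec_eq_iff)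
  \<comment> \<open>Column \<open>n\<close> is the eigenvector \<open>w\<close>; column
    \<open>j\<close> is the vector \<open>axis j 1 - (c $ j / c $ n) *s axis n 1\<close> of the
    kernel of \<open>c\<close>.\<close>
  define P :: "'a ^ 'n ^ 'n" where
    "P = (\<chi> i j. if j = n then w $ i else (if i = j then 1 else 0) - (if i = n then c $ j / c $ n else 0))"
  define D :: "'a ^ 'n ^ 'n" where
    "D = (\<chi> i j. if i = j then if i = n then 1 + covec_eval c w else 1 else 0)"
  define S where "S v = (\<Sum>j\<in>UNIV - {n}. c $ j * v $ j)" for v :: "'a ^ 'n"
  have S: "covec_eval c v = c $ n * v $ n + S v" for v
    by (simp add: covec_eval_def sum.remove[of UNIV n] S_def)
  have Pv: "(P *v v) $ i = v $ n * w $ i + (if i = n then - S v / c $ n else v $ i)" for v i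
  proof -
    have "(P *v v) $ i = v $ n * w $ i + (\<Sum>j\<in>UNIV - {n}. P $ i $ j * v $ j)"
      unfolding matrix_vector_mult_def by (simp add: sum.remove[of UNIV n] P_def)
    also have "(\<Sum>j\<in>UNIV - {n}. P $ i $ j * v $ j) =
        (if i = n then - S v / c $ n else v $ i)"
    proof (cases "i = n")
      case True
      then have "(\<Sum>j\<in>UNIV - {n}. P $ i $ j * v $ j) = (\<Sum>j\<in>UNIV - {n}. - (c $ j * v $ j) / c $ n)"
        by (intro sum.cong) (auto simp: P_def)
      then show ?thesis using True by (simp add: S_def sum_negf flip: sum_divide_distrib)
    next
      case False
      then have "(\<Sum>j\<in>UNIV - {n}. P $ i $ j * v $ j) = (\<Sum>j\<in>UNIV - {n}. if j = i then v $ i else 0)"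
        by (intro sum.cong) (auto simp: P_def)
      then show ?thesis using False by (simp add: sum.delta)
    qed
    finally show ?thesis .
  qed
  have eval: "covec_eval c (P *v v) = v $ n * covec_eval c w" for v
  proof -
    have "S (P *v v) = (\<Sum>i\<in>UNIV - {n}. c $ i * (v $ n * w $ i + v $ i))"
      unfolding S_def by (intro sum.cong) (auto simp: Pv)
    also have "\<dots> = v $ n * S w + S v"
      by (simp add: S_def algebra_simps sum.distrib sum_distrib_left)
    finally have "covec_eval c (P *v v) = c $ n * (v $ n * w $ n - S v / c $ n) + (v $ n * S w + S v)"
      by (simp add: S Pv)
    also have "\<dots> = v $ n * covec_eval c w" using n by (simp add: S algebra_simps)
    finally show ?thesis .
  qed
  have "inj ((*v) P)"
  proof (rule injI)
    fix u v assume "P *v u = P *v v"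
    then have 0: "P *v (u - v) = 0" by (simp add: matrix_vector_mult_diff_distrib)
    then have "(u - v) $ n * covec_eval c w = 0" using eval[of "u - v"] by simp
    then have un: "(u - v) $ n = 0" using w by simp
    have "(u - v) $ i = 0" for i
      using Pv[of "u - v" i] 0 un by (cases "i = n") simp_all
    then show "u = v" by (simp add: vec_eq_iff)
  qed
  then have P: "invertible P"
    using matrix_left_invertible_injective matrix_left_right_inverse unfolding invertible_def by metis
  have Dv: "(D *v v) $ i = (if i = n then (1 + covec_eval c w) * v $ n else v $ i)" for v i
    by (simp add: D_def matrix_vector_mult_def if_distrib[of "\<lambda>x. x * _"] cong: if_cong)
  have "reflection_matrix c w ** P = P ** D"
  proof -
    have "S (D *v v) = S v" for v unfolding S_def by (intro sum.cong) (auto simp: Dv)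
    then have "reflection_matrix c w *v (P *v v) = P *v (D *v v)" for v
      by (simp add: vec_eq_iff reflection_matrix_mult_vec eval Pv Dv algebra_simps)
    then show ?thesis by (simp add: matrix_eq flip: matrix_vector_mul_assoc)
  qed
  then have "reflection_matrix c w = P ** D ** matrix_inv P"
    by (metis P matrix_inv_right matrix_mul_assoc matrix_mul_rid)
  moreover have "\<forall>i j. i \<noteq> j \<longrightarrow> D $ i $ j = 0" by (simp add: D_def)
  ultimately show ?thesis unfolding diagonalizable_def using P by blast
qed

text \<open>Such a matrix satisfies \<open>(s - 1)^2 = 0\<close>, and the only diagonal matrix with
  this property is the identity.\<close>

lemma diagonalizable_reflection_matrixD:
  fixes c w :: "'a::field ^ 'n"
  assumes d: "diagonalizable (reflection_matrix c w)" and w: "covec_eval c w = 0"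
  shows "reflection_matrix c w = mat 1"
proof -
  let ?s = "reflection_matrix c w"
  obtain P D :: "'a ^ 'n ^ 'n" where P: "invertible P" and D: "\<And>i j. i \<noteq> j \<Longrightarrow> D $ i $ j = 0"
    and s: "?s = P ** D ** matrix_inv P"
    using d unfolding diagonalizable_def by blast
  have PD: "?s *v (P *v v) = P *v (D *v v)" for v
  proof -
    have "?s ** P = P ** D ** (matrix_inv P ** P)" by (simp add: s matrix_mul_assoc)
    then show ?thesis by (simp add: matrix_inv_left[OF P] matrix_vector_mul_assoc)
  qed
  have Dv: "(D *v v) $ i = D $ i $ i * v $ i" for v i
    unfolding matrix_vector_mult_def using D by (simp add: sum.remove[of UNIV i])
  have sq: "?s *v (?s *v v) + v = ?s *v v + ?s *v v" for v
    by (simp add: reflection_matrix_mult_vec covec_eval_add covec_eval_smult w)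
  have "D *v (D *v v) + v = D *v v + D *v v" for v
  proof -
    have "P *v (D *v (D *v v) + v) = P *v (D *v v + D *v v)"
      using sq[of "P *v v"] by (simp only: PD matrix_vector_right_distrib)
    then have "matrix_inv P *v (P *v (D *v (D *v v) + v)) = matrix_inv P *v (P *v (D *v v + D *v v))"
      by (rule arg_cong)
    then show ?thesis by (simp only: matrix_vector_mul_assoc matrix_inv_left[OF P] matrix_vector_mul_lid)
  qed
  then have "(D *v (D *v axis i 1) + axis i 1) $ i = (D *v axis i 1 + D *v axis i 1) $ i" for i by simp
  then have "(D $ i $ i - 1) * (D $ i $ i - 1) = 0" for i
    by (simp add: Dv axis_component algebra_simps)
  then have "D = mat 1" using D by (auto simp: vec_eq_iff mat_def)
  then show ?thesis by (simp add: s matrix_inv_right[OF P])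
qed

section \<open>The common order of the diagonalizable reflections\<close>

text \<open>If the order of \<open>y\<close> had a larger \<open>p\<close>-part \<open>p ^ a\<close>
  than the \<open>p\<close>-part \<open>p ^ b\<close> of \<open>e\<close>, then a power of
  \<open>y\<close> of order \<open>p ^ a\<close> times a power of \<open>x\<close> of order
  \<open>e div p ^ b\<close> would be an element of \<open>X\<close> whose order exceeds
  \<open>e\<close>.\<close>

lemma max_order_is_exponent:
  fixes X :: "'a::field set"
  assumes one: "1 \<in> X" and mult: "\<And>x y. x \<in> X \<Longrightarrow> y \<in> X \<Longrightarrow> x * y \<in> X"
    and ord: "\<And>x. x \<in> X \<Longrightarrow> \<exists>f. 0 < f \<and> f \<le> e \<and> (\<forall>k. x ^ k = 1 \<longleftrightarrow> f dvd k)"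
    and x: "x \<in> X" "\<And>k. x ^ k = 1 \<longleftrightarrow> e dvd k" and y: "y \<in> X"
  shows "y ^ e = 1"
proof -
  obtain f where f: "0 < f" "\<And>k. y ^ k = 1 \<longleftrightarrow> f dvd k" using ord[OF y] by blast
  have e: "0 < e" using ord[OF y] by force
  have "f dvd e"
  proof (rule multiplicity_le_imp_dvd)
    fix p :: nat assume p: "prime p"
    define a b where "a = multiplicity p f" and "b = multiplicity p e"
    obtain f' where f': "f = p ^ a * f'" using multiplicity_dvd[of p f] by (auto simp: a_def dvd_def)
    obtain e' where e': "e = p ^ b * e'" "\<not> p dvd e'"
      unfolding b_def by (rule multiplicity_decompose'[of e p]) (use e p in auto)
    have pos: "0 < f'" "0 < e'" "0 < p ^ a" "0 < p ^ b" using f e f' e' p by (auto simp: prime_gt_0_nat)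
    define u v where "u = y ^ f'" and "v = x ^ (p ^ b)"
    have u: "u ^ k = 1 \<longleftrightarrow> p ^ a dvd k" for k
      using f(2)[of "f' * k"] pos by (simp add: u_def f' power_mult[symmetric] mult.commute)
    have v: "v ^ k = 1 \<longleftrightarrow> e' dvd k" for k
      using x(2)[of "p ^ b * k"] prime_gt_0_nat[OF p] by (simp add: v_def e'(1) flip: power_mult)
    have "u * v \<in> X"
    proof -
      have "z ^ k \<in> X" if "z \<in> X" for z k using that by (induction k) (auto intro: one mult)
      then show ?thesis using x(1) y by (auto simp: u_def v_def intro: mult)
    qed
    then obtain g where g: "g \<le> e" "\<And>k. (u * v) ^ k = 1 \<longleftrightarrow> g dvd k" "0 < g" using ord by blast
    have uv: "u ^ g * v ^ g = 1" using g(2)[of g] by (simp add: power_mult_distrib)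
    have cop: "coprime (p ^ a) e'" using p e'(2) by (simp add: prime_imp_coprime)
    have "u ^ (g * e') = 1"
    proof -
      have "(u ^ g * v ^ g) ^ e' = 1" using uv by simp
      then show ?thesis using v[of "g * e'"] by (simp add: power_mult_distrib flip: power_mult)
    qed
    then have "p ^ a dvd g" using u cop coprime_dvd_mult_left_iff by blast
    moreover have "v ^ (g * p ^ a) = 1"
    proof -
      have "(u ^ g * v ^ g) ^ (p ^ a) = 1" using uv by simp
      then show ?thesis using u[of "g * p ^ a"] by (simp add: power_mult_distrib flip: power_mult)
    qed
    then have "e' dvd g" using v cop coprime_dvd_mult_left_iff coprime_commute by blast
    ultimately have "p ^ a * e' dvd g" using cop by (rule divides_mult)
    then have "p ^ a * e' \<le> g" using g(3) by (rule dvd_imp_le)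
    also have "g \<le> p ^ b * e'" using g(1) unfolding e'(1) .
    finally have "p ^ a \<le> p ^ b" using pos(2) by (simp only: mult_le_cancel2)
    then show "multiplicity p f \<le> multiplicity p e"
      unfolding a_def b_def by (simp only: power_increasing_iff[OF prime_gt_1_nat[OF p]])
  qed (use f in simp)
  then show ?thesis using f(2) by simp
qed

text \<open>The points that are not fixed fall into orbits of exactly \<open>p\<close>
  elements.\<close>

lemma card_fixed_points_mod_prime:
  assumes X: "finite X" "f ` X \<subseteq> X" and p: "prime p" and f: "\<And>x. x \<in> X \<Longrightarrow> (f ^^ p) x = x"
  shows "[card {x \<in> X. f x = x} = card X] (mod p)"
proof -
  let ?Y = "{x \<in> X. f x \<noteq> x}"
  define orb where "orb x = (\<lambda>k. (f ^^ k) x) ` {..<p}" for x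
  have p0: "0 < p" using p by (rule prime_gt_0_nat)
  have in_X: "(f ^^ k) x \<in> X" if "x \<in> X" for x k using that X(2) by (induction k) auto
  have mult: "(f ^^ (p * k)) x = x" if "x \<in> X" for x k
    using that by (induction k) (simp_all add: f funpow_add)
  have modp: "(f ^^ (k mod p)) x = (f ^^ k) x" if "x \<in> X" for x k
  proof -
    have "(f ^^ k) x = (f ^^ (k mod p)) ((f ^^ (p * (k div p))) x)"
      by (metis comp_apply funpow_add mod_mult_div_eq)
    then show ?thesis using mult[OF that] by simp
  qed
  have orb_eq: "orb x = range (\<lambda>k. (f ^^ k) x)" if "x \<in> X" for x
    using modp[OF that] p0 by (auto simp: orb_def image_iff) (metis lessThan_iff mod_less_divisor)
  \<comment> \<open>By Bezout, \<open>d * m\<close> is 1 modulo \<open>p\<close> for some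
    \<open>m\<close>, so at \<open>x\<close> the map \<open>f\<close> is an iterate of
    \<open>f ^^ d\<close>.\<close>
  have period: "f x = x" if "x \<in> X" "(f ^^ d) x = x" "0 < d" "d < p" for x d
  proof -
    have "coprime d p" using that p
      by (metis coprime_commute nat_dvd_not_less prime_imp_coprime)
    then obtain m where m: "[d * m = 1] (mod p)" using cong_solve_coprime_nat by fastforce
    have "(f ^^ (d * k)) x = x" for k
      using that(2) by (induction k) (simp_all add: funpow_add)
    then have "(f ^^ ((d * m) mod p)) x = x" using modp[OF that(1)] by simp
    then have "(f ^^ (1 mod p)) x = x" using m by (simp add: cong_def)
    then show ?thesis using prime_gt_1_nat[OF p] by simp
  qed
  have inv: "\<exists>k. (f ^^ k) ((f ^^ l) x) = x" if "x \<in> X" for x l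
  proof -
    have "(f ^^ (p * l - l)) ((f ^^ l) x) = (f ^^ (p * l)) x"
    proof -
      have "p * l - l + l = p * l" using p0 by (cases p) simp_all
      then show ?thesis by (metis comp_apply funpow_add)
    qed
    then show ?thesis using mult[OF that] by metis
  qed
  have orb_same: "orb y = orb x" if x: "x \<in> X" and y: "y \<in> orb x" for x y
  proof -
    obtain l where l: "y = (f ^^ l) x" using y by (auto simp: orb_def)
    then have y: "y \<in> X" using in_X x by simp
    obtain k where k: "(f ^^ k) y = x" using inv[OF x] l by blast
    have "(f ^^ i) y \<in> range (\<lambda>k. (f ^^ k) x)" for i
      unfolding l by (metis comp_apply funpow_add rangeI)
    moreover have "(f ^^ i) x \<in> range (\<lambda>k. (f ^^ k) y)" for i
      by (metis comp_apply funpow_add k rangeI)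
    ultimately show ?thesis unfolding orb_eq[OF x] orb_eq[OF y] by blast
  qed
  have orb_Y: "orb x \<subseteq> ?Y" if "x \<in> ?Y" for x
  proof
    fix y assume y: "y \<in> orb x"
    then obtain l where l: "y = (f ^^ l) x" by (auto simp: orb_def)
    have x: "x \<in> X" "f x \<noteq> x" using that by auto
    have "f y \<noteq> y"
    proof
      assume fy: "f y = y"
      then have "(f ^^ k) y = y" for k by (induction k) simp_all
      then have "y = x" using inv[OF x(1)] l by metis
      then show False using fy x(2) by simp
    qed
    then show "y \<in> ?Y" using in_X x(1) l by simp
  qed
  have self: "x \<in> orb x" for x using p0 by (force simp: orb_def)
  have "card (orb x) = p" if x: "x \<in> ?Y" for x
  proof -
    have "inj_on (\<lambda>k. (f ^^ k) x) {..<p}"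
    proof (rule linorder_inj_onI)
      fix k l assume kl: "k < l" "k \<in> {..<p}" "l \<in> {..<p}"
      show "(f ^^ k) x \<noteq> (f ^^ l) x"
      proof
        assume eq: "(f ^^ k) x = (f ^^ l) x"
        let ?y = "(f ^^ k) x"
        have "(f ^^ (l - k)) ?y = ?y"
        proof -
          have "l - k + k = l" using kl(1) by simp
          then show ?thesis using eq by (metis comp_apply funpow_add)
        qed
        moreover have "?y \<in> orb x" using kl unfolding orb_def by (intro imageI) simp
        then have "?y \<in> ?Y" using orb_Y[OF x] by blast
        moreover have "l - k < p" "0 < l - k" using kl by auto
        ultimately show False using period[of ?y "l - k"] by blast
      qed
    qed (simp add: linear)
    then show ?thesis by (simp add: orb_def card_image)
  qed
  then have card: "\<forall>C\<in>orb ` ?Y. p dvd card C" by simp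
  have disj: "orb x \<inter> orb y = {}" if "x \<in> ?Y" "y \<in> ?Y" "orb x \<noteq> orb y" for x y
  proof (rule ccontr)
    assume "orb x \<inter> orb y \<noteq> {}"
    then obtain z where "z \<in> orb x" "z \<in> orb y" by blast
    then have "orb z = orb x" "orb z = orb y" using orb_same that by blast+
    then show False using that(3) by simp
  qed
  have "finite (\<Union>(orb ` ?Y))"
    using orb_Y by (intro finite_subset[OF _ X(1)]) blast
  then have "p dvd card (\<Union>(orb ` ?Y))"
    using card disj by (intro dvd_partition) blast+
  moreover have "\<Union>(orb ` ?Y) = ?Y" using orb_Y self by blast
  moreover have "card X = card {x \<in> X. f x = x} + card ?Y"
  proof -
    have "X = {x \<in> X. f x = x} \<union> ?Y" by auto
    then show ?thesis using X(1) card_Un_disjoint[of "{x \<in> X. f x = x}" ?Y] by fastforce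
  qed
  ultimately show ?thesis by (auto simp: cong_def elim!: dvdE)
qed

definition covec_pull :: "'a::field ^ 'n \<Rightarrow> 'a ^ 'n ^ 'n \<Rightarrow> 'a ^ 'n" where
  "covec_pull c A = (\<chi> j. \<Sum>i\<in>UNIV. c $ i * A $ i $ j)"

lemma covec_eval_pull: "covec_eval (covec_pull c A) v = covec_eval c (A *v v)"
  by (simp add: covec_pull_def covec_eval_def matrix_vector_mult_def sum_distrib_left
      sum_distrib_right mult.assoc) (rule sum.swap)

section \<open>The group, its reflecting hyperplanes and its inertia groups\<close>

locale transvection_group = matrix_group G
  for G :: "('a::field, 'n::{finite,linorder}) sqmat set" +
  fixes ell :: "('a, 'n) hforms"
  assumes fin: "finite G" and gen: "G = generate GL {s \<in> G. reflection s}"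
    and forms: "defining_forms G ell"
    and maximal: "maximal_transvection_root_spaces G ell"
begin

lemma arrangement_hyperplane: "H \<in> arrangement G \<Longrightarrow> hyperplane H"
  by (auto simp: arrangement_def reflection_about_def)

lemma kernel_ell: "H \<in> arrangement G \<Longrightarrow> {v. covec_eval (ell H) v = 0} = H"
  using forms by (simp add: defining_forms_def)

lemma ell_eval_iff: "H \<in> arrangement G \<Longrightarrow> covec_eval (ell H) v = 0 \<longleftrightarrow> v \<in> H"
  using kernel_ell by blast

lemma ell_nonzero: "H \<in> arrangement G \<Longrightarrow> ell H \<noteq> 0"
  using kernel_ell[of H] arrangement_hyperplane[of H] hyperplane_not_UNIV by auto

text \<open>Subtracting \<open>(covec_eval c v / c $ n) *s axis n 1\<close> from \<open>v\<close>
  gives a fixed vector, so \<open>s\<close> is determined by its value at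
  \<open>axis n 1\<close>.\<close>

lemma reflection_aboutE:
  assumes "reflection_about {v. covec_eval c v = 0} s" "c \<noteq> 0"
  obtains w where "s = reflection_matrix c w"
proof -
  obtain n where n: "c $ n \<noteq> 0" using assms(2) by (auto simp: vec_eq_iff)
  have "s *v v = v + covec_eval c v *s (inverse (c $ n) *s (s *v axis n 1 - axis n 1))" for v
  proof -
    have "s *v (v - (covec_eval c v / c $ n) *s axis n 1) = v - (covec_eval c v / c $ n) *s axis n 1"
      using assms(1) n by (simp add: reflection_about_def covec_eval_diff covec_eval_smult)
    then show ?thesis
      by (simp add: matrix_vector_mult_diff_distrib vector_scalar_commute[symmetric] vec_eq_iff
          field_simps)
  qed
  then show ?thesis by (rule that[OF reflection_matrixI])
qed

lemma reflection_about_reflection_matrix: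
  assumes "reflection_matrix c w \<in> G" "c \<noteq> 0" "w \<noteq> 0"
  shows "reflection_about {v. covec_eval c v = 0} (reflection_matrix c w)"
  using assms unfolding reflection_about_def
  by (auto simp: hyperplane_kernel reflection_matrix_eq_1_iff reflection_matrix_mult_vec)

lemma reflection_matrix_eval: "reflection_matrix c w \<in> G \<Longrightarrow> 1 + covec_eval c w \<noteq> 0"
  using invertible invertible_reflection_matrix by blast

lemma reflection_matrix_in_inertia:
  assumes "reflection_matrix c w \<in> G"
  shows "reflection_matrix c w \<in> inertia c"
proof -
  have "linear_form c dvd act_poly (reflection_matrix c w) p - p" for p
    by (rule ring_homo_diff_dvd[OF act_poly_homo ring_homo_id])
      (simp_all add: act_poly_reflection_Var[OF reflection_matrix_eval[OF assms]])
  then show ?thesis using assms by (simp add: inertia_def)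
qed

text \<open>Divisibility on the variables says that every row of \<open>matrix_inv g - mat 1\<close>
  is a multiple of \<open>c\<close>.\<close>

lemma inertiaE:
  assumes "g \<in> inertia c" "c \<noteq> 0"
  obtains w where "g = reflection_matrix c w"
proof -
  have g: "g \<in> G" using assms(1) by (simp add: inertia_def)
  have "\<exists>a. matrix_inv g $ i - axis i 1 = a *s c" for i
  proof -
    have "linear_form c dvd act_poly g (Var i) - Var i" using assms(1) by (simp add: inertia_def)
    then have "linear_form c dvd linear_form (matrix_inv g $ i - axis i 1)"
      by (simp add: act_poly_Var linear_form_diff linear_form_axis)
    then show ?thesis using linear_form_dvd_linear_form[OF assms(2)] by metis
  qed
  then obtain a where a: "\<And>i. matrix_inv g $ i - axis i 1 = a i *s c" by metis
  have "matrix_inv g = reflection_matrix c (\<chi> i. a i)"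
  proof -
    have "matrix_inv g $ i = axis i 1 + a i *s c" for i using a[of i] by (simp add: algebra_simps)
    then show ?thesis by (auto simp: vec_eq_iff reflection_matrix_def axis_component)
  qed
  then have "g = reflection_matrix c ((- inverse (1 + covec_eval c (\<chi> i. a i))) *s (\<chi> i. a i))"
    using reflection_matrix_eval[of c "\<chi> i. a i"] g
    by (metis inv_closed inv_inv matrix_inv_reflection_matrix)
  then show ?thesis by (rule that)
qed

lemma inertia_trivial:
  assumes "c \<noteq> 0" "{v. covec_eval c v = 0} \<notin> arrangement G"
  shows "inertia c = {mat 1}"
proof -
  have "g = mat 1" if g: "g \<in> inertia c" for g
  proof -
    obtain w where w: "g = reflection_matrix c w" using inertiaE[OF g assms(1)] .
    have gG: "g \<in> G" using g by (simp add: inertia_def)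
    have "w = 0"
    proof (rule ccontr)
      assume "w \<noteq> 0"
      then have "reflection_about {v. covec_eval c v = 0} g"
        using reflection_about_reflection_matrix assms(1) gG w by blast
      then show False using assms(2) gG by (auto simp: arrangement_def)
    qed
    then show ?thesis by (simp add: w)
  qed
  moreover have "mat 1 \<in> inertia c" by (simp add: inertia_def)
  ultimately show ?thesis by blast
qed

lemma pow_card:
  assumes "g \<in> G"
  shows "g [^]\<^bsub>GL\<^esub> card G = mat 1" "0 < card G"
proof -
  interpret H: group "GL\<lparr>carrier := G\<rparr>" by (rule subgroup.subgroup_is_group[OF subgroup group_GL])
  have "g [^]\<^bsub>GL\<lparr>carrier := G\<rparr>\<^esub> order (GL\<lparr>carrier := G\<rparr>) = \<one>\<^bsub>GL\<lparr>carrier := G\<rparr>\<^esub>"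
    using assms by (intro H.pow_order_eq_1) simp
  then show "g [^]\<^bsub>GL\<^esub> card G = mat 1"
    using GL.nat_pow_consistent[of g "card G" G] by (simp add: order_def)
  show "0 < card G" using assms fin by (auto simp: card_gt_0_iff)
qed

section \<open>Orders of the diagonalizable reflections about one hyperplane\<close>

definition reflection_orders :: "('a ^ 'n::{finite,linorder}) set \<Rightarrow> nat set" where
  "reflection_orders H = insert 1 (group.ord GL ` {s \<in> G. reflection_about H s \<and> diagonalizable s})"

lemma e_at_def': "e_at G H = Max (reflection_orders H)"
  by (simp add: e_at_def reflection_orders_def)

lemma finite_reflection_orders: "finite (reflection_orders H)"
  using fin by (simp add: reflection_orders_def)

lemma e_at_pos: "0 < e_at G H"
proof -
  have "1 \<le> e_at G H" unfolding e_at_def'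
    by (rule Max_ge[OF finite_reflection_orders]) (simp add: reflection_orders_def)
  then show ?thesis by simp
qed

lemma e_at_witness:
  assumes H: "H \<in> arrangement G"
  obtains w where "reflection_matrix (ell H) w \<in> G"
    "\<And>k. (1 + covec_eval (ell H) w) ^ k = 1 \<longleftrightarrow> e_at G H dvd k"
proof -
  have "e_at G H \<in> reflection_orders H" unfolding e_at_def'
    by (rule Max_in[OF finite_reflection_orders]) (simp add: reflection_orders_def)
  then consider "e_at G H = 1"
    | s where "s \<in> G" "reflection_about H s" "diagonalizable s" "e_at G H = group.ord GL s"
    by (auto simp: reflection_orders_def)
  then show ?thesis
  proof cases
    case 1
    \<comment> \<open>The default value 1 is witnessed by the identity.\<close>
    then show ?thesis by (intro that[of 0]) simp_all
  next
    case 2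
    obtain w where w: "s = reflection_matrix (ell H) w"
      using reflection_aboutE[of "ell H" s] 2(2) kernel_ell[OF H] ell_nonzero[OF H] by metis
    have "s \<noteq> mat 1" using 2(2) by (simp add: reflection_about_def)
    then have "covec_eval (ell H) w \<noteq> 0"
      using diagonalizable_reflection_matrixD 2(3) w by blast
    then show ?thesis using ord_reflection_matrix[OF ell_nonzero[OF H]] 2(1,4) w invertible
      by (intro that[of w]) simp_all
  qed
qed

text \<open>The eigenvalues \<open>1 + covec_eval (ell H) w\<close> form a multiplicatively closed
  subset of the field, and those other than 1 have the orders of diagonalizable reflections. In such
  a set the maximal order is an exponent.\<close>

lemma e_at_exponent:
  assumes H: "H \<in> arrangement G" and w: "reflection_matrix (ell H) w \<in> G"
  shows "(1 + covec_eval (ell H) w) ^ e_at G H = 1"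
proof -
  let ?c = "ell H"
  define X where "X = {1 + covec_eval ?c w |w. reflection_matrix ?c w \<in> G}"
  obtain w0 where w0: "reflection_matrix ?c w0 \<in> G"
    "\<And>k. (1 + covec_eval ?c w0) ^ k = 1 \<longleftrightarrow> e_at G H dvd k"
    using e_at_witness[OF H] by blast
  have one: "1 \<in> X" unfolding X_def by (auto intro!: exI[of _ 0])
  have mult: "x * y \<in> X" if xy: "x \<in> X" "y \<in> X" for x y
  proof -
    obtain u v where u: "x = 1 + covec_eval ?c u" "reflection_matrix ?c u \<in> G"
      and v: "y = 1 + covec_eval ?c v" "reflection_matrix ?c v \<in> G"
      using xy unfolding X_def by blast
    have "reflection_matrix ?c (u + v + covec_eval ?c v *s u) \<in> G"
      using mult_closed[OF u(2) v(2)] by (simp add: reflection_matrix_mult)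
    moreover have "x * y = 1 + covec_eval ?c (u + v + covec_eval ?c v *s u)"
      by (simp add: u v covec_eval_add covec_eval_smult algebra_simps)
    ultimately show ?thesis unfolding X_def by blast
  qed
  have ord: "\<exists>f. 0 < f \<and> f \<le> e_at G H \<and> (\<forall>k. x ^ k = 1 \<longleftrightarrow> f dvd k)" if x: "x \<in> X" for x
  proof (cases "x = 1")
    case True
    then show ?thesis using e_at_pos[of H] by (intro exI[of _ 1]) auto
  next
    case False
    obtain u where u: "x = 1 + covec_eval ?c u" "reflection_matrix ?c u \<in> G"
      using x unfolding X_def by blast
    let ?s = "reflection_matrix ?c u"
    have u0: "covec_eval ?c u \<noteq> 0" using False u by simp
    then have "u \<noteq> 0" by auto
    from reflection_about_reflection_matrix[OF u(2) ell_nonzero[OF H] this]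
    have "reflection_about H ?s" by (simp only: kernel_ell[OF H])
    then have "group.ord GL ?s \<in> reflection_orders H"
      using u(2) diagonalizable_reflection_matrix[OF ell_nonzero[OF H] u0]
      by (auto simp: reflection_orders_def)
    then have "group.ord GL ?s \<le> e_at G H" unfolding e_at_def'
      by (rule Max_ge[OF finite_reflection_orders])
    moreover have iff: "x ^ k = 1 \<longleftrightarrow> group.ord GL ?s dvd k" for k
      unfolding u(1) by (rule ord_reflection_matrix[OF ell_nonzero[OF H] u0 invertible[OF u(2)]])
    moreover have "group.ord GL ?s dvd card G"
      using pow_card(1)[OF u(2)] GL.pow_eq_id[of ?s "card G"] invertible[OF u(2)] by simp
    then have "0 < group.ord GL ?s" using pow_card(2)[OF u(2)] by (metis dvd_0_left_iff gr0I not_gr0)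
    ultimately show ?thesis by blast
  qed
  have "1 + covec_eval ?c w0 \<in> X" "1 + covec_eval ?c w \<in> X" using w0(1) w unfolding X_def by blast+
  from max_order_is_exponent[OF one mult ord this(1) w0(2) this(2)] show ?thesis .
qed

subsection \<open>All reflecting hyperplanes are conjugate\<close>

abbreviation move ::
    "('a, 'n) sqmat \<Rightarrow> ('a ^ 'n::{finite,linorder}) set \<Rightarrow> ('a ^ 'n::{finite,linorder}) set" where
  "move g H \<equiv> (\<lambda>v. g *v v) ` H"

lemma move_move: "move g (move h H) = move (g ** h) H"
  by (simp add: image_image matrix_vector_mul_assoc)

lemma move_inv: "g \<in> G \<Longrightarrow> move (matrix_inv g) (move g H) = H"
  by (simp add: move_move inv_mult)

lemma conjugate_eq_1_iff:
  assumes g: "g \<in> G"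
  shows "g ** x ** matrix_inv g = mat 1 \<longleftrightarrow> x = mat 1"
proof
  assume "g ** x ** matrix_inv g = mat 1"
  then have "matrix_inv g ** (g ** x ** matrix_inv g) ** g = matrix_inv g ** mat 1 ** g" by simp
  moreover have "matrix_inv g ** (g ** x ** matrix_inv g) ** g =
      (matrix_inv g ** g) ** x ** (matrix_inv g ** g)"
    by (simp only: matrix_mul_assoc)
  ultimately show "x = mat 1" using g by (simp add: inv_mult)
qed (use g in \<open>simp add: mult_inv\<close>)

lemma reflection_about_conjugate:
  assumes g: "g \<in> G" and s: "reflection_about H s" "s \<in> G"
  shows "reflection_about (move g H) (g ** s ** matrix_inv g)"
proof -
  have H: "H \<in> arrangement G" using s by (auto simp: arrangement_def)
  have eq: "move g H = {v. covec_eval (covec_pull (ell H) (matrix_inv g)) v = 0}"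
  proof -
    have "v \<in> move g H \<longleftrightarrow> matrix_inv g *v v \<in> H" for v
    proof
      assume "matrix_inv g *v v \<in> H"
      then have "g *v (matrix_inv g *v v) \<in> move g H" by (rule imageI)
      then show "v \<in> move g H" using g by (simp add: matrix_vector_mul_assoc mult_inv)
    qed (use g in \<open>auto simp: matrix_vector_mul_assoc inv_mult\<close>)
    then show ?thesis using ell_eval_iff[OF H] by (auto simp: covec_eval_pull)
  qed
  have "covec_pull (ell H) (matrix_inv g) \<noteq> 0"
  proof
    assume "covec_pull (ell H) (matrix_inv g) = 0"
    then have "covec_eval (ell H) (matrix_inv g *v (g *v v)) = 0" for v
      by (metis covec_eval_pull covec_eval_zero(2))
    then have "covec_eval (ell H) v = 0" for v using g by (simp add: matrix_vector_mul_assoc inv_mult)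
    then have "H = UNIV" using ell_eval_iff[OF H] by blast
    then show False using arrangement_hyperplane[OF H] hyperplane_not_UNIV by blast
  qed
  then have "hyperplane (move g H)" unfolding eq by (rule hyperplane_kernel)
  moreover have "g ** s ** matrix_inv g \<noteq> mat 1"
    using s by (simp add: conjugate_eq_1_iff[OF g] reflection_about_def)
  moreover have "(g ** s ** matrix_inv g) *v (g *v v) = g *v v" if "v \<in> H" for v
  proof -
    have "(g ** s ** matrix_inv g) *v (g *v v) = g *v (s *v ((matrix_inv g ** g) *v v))"
      by (simp only: matrix_vector_mul_assoc matrix_mul_assoc)
    then show ?thesis using that s g by (simp add: inv_mult reflection_about_def)
  qed
  ultimately show ?thesis using g s(2) by (auto simp: reflection_about_def invertible_mult)
qed

lemma move_arrangement:
  assumes g: "g \<in> G" and H: "H \<in> arrangement G"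
  shows "move g H \<in> arrangement G"
proof -
  obtain s where s: "s \<in> G" "reflection_about H s" using H by (auto simp: arrangement_def)
  have "g ** s ** matrix_inv g \<in> G" using g s(1) by simp
  then show ?thesis
    unfolding arrangement_def using reflection_about_conjugate[OF g s(2,1)] by blast
qed

lemma reflection_orders_move:
  assumes g: "g \<in> G"
  shows "reflection_orders H \<subseteq> reflection_orders (move g H)"
proof -
  have "group.ord GL s \<in> reflection_orders (move g H)"
    if s: "s \<in> G" "reflection_about H s" "diagonalizable s" for s
  proof -
    let ?t = "g ** s ** matrix_inv g"
    have pow: "?t [^]\<^bsub>GL\<^esub> (k::nat) = g ** (s [^]\<^bsub>GL\<^esub> k) ** matrix_inv g" for k
    proof (induction k)
      case 0
      show ?case using g by (simp add: mult_inv)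
    next
      case (Suc k)
      have "?t [^]\<^bsub>GL\<^esub> Suc k = g ** (s [^]\<^bsub>GL\<^esub> k) ** (matrix_inv g ** g) ** s ** matrix_inv g"
        by (simp only: nat_pow_Suc GL_simps Suc matrix_mul_assoc)
      also have "\<dots> = g ** (s [^]\<^bsub>GL\<^esub> k ** s) ** matrix_inv g"
        by (simp only: inv_mult[OF g] matrix_mul_rid matrix_mul_assoc)
      finally show ?case by simp
    qed
    have ord: "group.ord GL ?t = group.ord GL s"
      unfolding GL.ord_def pow GL_simps conjugate_eq_1_iff[OF g] ..
    obtain P D :: "('a, 'n) sqmat" where P: "invertible P" "\<forall>i j. i \<noteq> j \<longrightarrow> D $ i $ j = 0" "s = P ** D ** matrix_inv P"
      using s(3) unfolding diagonalizable_def by blast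
    have "?t = (g ** P) ** D ** matrix_inv (g ** P)"
      using g P by (simp add: matrix_inv_mult matrix_mul_assoc)
    then have "diagonalizable ?t"
      unfolding diagonalizable_def using P(1,2) g invertible_mult[OF invertible[OF g] P(1)] by blast
    then show ?thesis
      using s g reflection_about_conjugate[OF g s(2,1)] ord[symmetric]
      by (auto simp: reflection_orders_def)
  qed
  then show ?thesis by (auto simp: reflection_orders_def)
qed

lemma e_at_move:
  assumes "g \<in> G"
  shows "e_at G (move g H) = e_at G H"
proof -
  have "reflection_orders (move g H) = reflection_orders H"
    using reflection_orders_move[OF assms, of H] assms
      reflection_orders_move[OF inv_closed[OF assms], of "move g H"] by (simp add: move_inv)
  then show ?thesis by (simp add: e_at_def')
qed

text \<open>The condition \<open>covec_eval (ell H) w = 0\<close> takes the place of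
  non-diagonalizability, and 0 is included. On these vectors the product of the matrices is the sum
  of the root vectors, so the matrices commute.\<close>

definition transvection_vectors ::
    "('a ^ 'n::{finite,linorder}) set \<Rightarrow> ('a ^ 'n::{finite,linorder}) set" where
  "transvection_vectors H = {w. covec_eval (ell H) w = 0 \<and> reflection_matrix (ell H) w \<in> G}"

text \<open>Maximality acts twice: it provides enough root vectors, and it places each of them in
  \<open>H\<close>, which gives \<open>covec_eval (ell H) w = 0\<close>.\<close>

lemma span_transvection_vectors:
  assumes H: "H \<in> arrangement G"
  shows "vec.span (transvection_vectors H) = H"
proof
  let ?R = "{w. \<exists>s\<in>G. transvection_about H s \<and> (\<forall>v. s *v v = v + covec_eval (ell H) v *s w)}"
  have R: "vec.span ?R = H"
    using maximal H by (simp add: maximal_transvection_root_spaces_def transvection_root_space_def)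
  have "?R \<subseteq> transvection_vectors H"
  proof
    fix w assume w: "w \<in> ?R"
    then obtain s where s: "s \<in> G" "\<And>v. s *v v = v + covec_eval (ell H) v *s w" by blast
    have "w \<in> H" using vec.span_base[OF w] R by simp
    moreover have "s = reflection_matrix (ell H) w" by (rule reflection_matrixI) (rule s)
    ultimately show "w \<in> transvection_vectors H"
      using s(1) ell_eval_iff[OF H] by (simp add: transvection_vectors_def)
  qed
  from vec.span_mono[OF this] show "H \<subseteq> vec.span (transvection_vectors H)" by (simp add: R)
  have "transvection_vectors H \<subseteq> H"
    using ell_eval_iff[OF H] by (auto simp: transvection_vectors_def)
  then show "vec.span (transvection_vectors H) \<subseteq> H"
    using arrangement_hyperplane[OF H] unfolding hyperplane_def by (intro vec.span_minimal) auto
qed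

text \<open>A vector \<open>v\<close> of \<open>H'\<close> outside \<open>H\<close> is moved by a
  nonzero multiple of \<open>w\<close>, which must lie in \<open>H'\<close>. So \<open>H'\<close>
  contains the span of the root vectors, which is \<open>H\<close>.\<close>

lemma fixed_hyperplane:
  assumes H: "H \<in> arrangement G" and H': "H' \<in> arrangement G"
    and fixed: "\<And>w. w \<in> transvection_vectors H \<Longrightarrow> move (reflection_matrix (ell H) w) H' = H'"
  shows "H' = H"
proof (rule ccontr)
  assume ne: "H' \<noteq> H"
  then have "\<not> H' \<subseteq> H"
    using hyperplane_subset_eq arrangement_hyperplane H H' by blast
  then obtain v where v: "v \<in> H'" "v \<notin> H" by blast
  have sub: "vec.subspace H'" using arrangement_hyperplane[OF H'] by (simp add: hyperplane_def)
  have "w \<in> H'" if w: "w \<in> transvection_vectors H" for w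
  proof -
    have "v + covec_eval (ell H) v *s w \<in> H'"
      using fixed[OF w] v(1) by (metis imageI reflection_matrix_mult_vec)
    then have "(v + covec_eval (ell H) v *s w) - v \<in> H'" using v(1) sub by (intro vec.subspace_diff)
    then have "covec_eval (ell H) v *s w \<in> H'" by simp
    then have "inverse (covec_eval (ell H) v) *s (covec_eval (ell H) v *s w) \<in> H'"
      by (rule vec.subspace_scale[OF sub])
    moreover have "inverse (covec_eval (ell H) v) *s (covec_eval (ell H) v *s w) = w"
      using v(2) ell_eval_iff[OF H] by (simp add: vector_smult_assoc)
    ultimately show ?thesis by (simp only:)
  qed
  then have "vec.span (transvection_vectors H) \<subseteq> H'" using sub by (intro vec.span_minimal) auto
  then have "H \<subseteq> H'" by (simp add: span_transvection_vectors[OF H])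
  then show False using ne hyperplane_subset_eq arrangement_hyperplane H H' by blast
qed

text \<open>A hyperplane is recovered from any reflection about it as the fixed space.\<close>

lemma finite_arrangement: "finite (arrangement G)"
proof -
  have "arrangement G \<subseteq> (\<lambda>s. {v. s *v v = v}) ` G"
  proof
    fix H assume "H \<in> arrangement G"
    then obtain s where s: "s \<in> G" "reflection_about H s" by (auto simp: arrangement_def)
    have "vec.subspace {v. s *v v = v}"
      by (rule vec.subspaceI) (simp_all add: matrix_vector_right_distrib vector_scalar_commute)
    moreover have "{v. s *v v = v} \<noteq> UNIV"
    proof
      assume "{v. s *v v = v} = UNIV"
      then have "s *v v = v" for v by blast
      then have "s = mat 1" by (simp add: matrix_eq)
      then show False using s by (simp add: reflection_about_def)
    qed
    moreover have "H \<subseteq> {v. s *v v = v}" "hyperplane H" using s by (auto simp: reflection_about_def)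
    ultimately have "H = {v. s *v v = v}"
    proof -
      assume *: "vec.subspace {v. s *v v = v}" "{v. s *v v = v} \<noteq> UNIV" "H \<subseteq> {v. s *v v = v}" "hyperplane H"
      have "vec.span {v. s *v v = v} = {v. s *v v = v}" by (rule iffD2[OF vec.span_eq_iff *(1)])
      then have "vec.dim {v. s *v v = v} < vec.dim (UNIV :: ('a ^ 'n::{finite,linorder}) set)"
        using *(2) by (intro vec.dim_psubset) (simp only: vec.span_UNIV psubset_eq subset_UNIV, simp)
      then have "vec.dim {v. s *v v = v} < CARD('n)" by (simp only: vec_dim_card)
      then show ?thesis using *(1,3,4) unfolding hyperplane_def by (intro vec.subspace_dim_equal) auto
    qed
    then show "H \<in> (\<lambda>s. {v. s *v v = v}) ` G" using s by blast
  qed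
  then show ?thesis using fin by (rule finite_surj[rotated])
qed

text \<open>The transvections about \<open>H\<close> commute, and their powers with exponent
  \<open>CHAR('a)\<close> are the identity. They are taken into account one at a time: each acts on
  the common fixed points of the previous ones and changes their number by a multiple of the
  characteristic. In the end only \<open>H\<close> can remain.\<close>

lemma card_orbit_mod:
  assumes H: "H \<in> arrangement G" and X: "X \<subseteq> arrangement G" "\<And>g. g \<in> G \<Longrightarrow> move g ` X \<subseteq> X"
    and p: "prime CHAR('a)"
  shows "[card X = card (X \<inter> {H})] (mod CHAR('a))"
proof -
  let ?s = "reflection_matrix (ell H)" and ?W = "transvection_vectors H"
  let ?fix = "\<lambda>F. {H' \<in> X. \<forall>w\<in>F. move (?s w) H' = H'}"
  have finX: "finite X" using X(1) finite_arrangement by (rule finite_subset)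
  have W: "?s w \<in> G" "covec_eval (ell H) w = 0" if "w \<in> ?W" for w
    using that by (auto simp: transvection_vectors_def)
  have comm: "?s w ** ?s w' = ?s w' ** ?s w" if "w \<in> ?W" "w' \<in> ?W" for w w'
    using W(2) that by (simp add: reflection_matrix_mult add.commute)
  have finW: "finite ?W"
  proof (rule inj_on_finite[OF _ _ fin])
    show "?s ` ?W \<subseteq> G" using W by blast
    show "inj_on ?s ?W"
    proof (rule inj_onI)
      fix w w' assume *: "w \<in> ?W" "w' \<in> ?W" "?s w = ?s w'"
      have "?s w ** ?s (- w') = mat 1" unfolding *(3)
        using W(2)[OF *(2)] by (simp add: reflection_matrix_mult covec_eval_minus)
      then have "?s (w - w') = mat 1"
        using W(2)[OF *(2)] by (simp add: reflection_matrix_mult covec_eval_minus)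
      then show "w = w'" by (simp add: reflection_matrix_eq_1_iff[OF ell_nonzero[OF H]])
    qed
  qed
  have "[card (?fix F) = card X] (mod CHAR('a))" if "finite F" "F \<subseteq> ?W" for F
    using that
  proof induction
    case (insert w F)
    have w: "w \<in> ?W" using insert.prems by simp
    have pow: "(move (?s w) ^^ k) H' = move (?s (of_nat k *s w)) H'" for k H'
      using W(2)[OF w]
      by (induction k) (simp_all add: move_move reflection_matrix_mult covec_eval_smult
          vector_sadd_rdistrib)
    have "[card {H' \<in> ?fix F. move (?s w) H' = H'} = card (?fix F)] (mod CHAR('a))"
    proof (rule card_fixed_points_mod_prime[OF _ _ p])
      show "move (?s w) ` ?fix F \<subseteq> ?fix F"
      proof (intro image_subsetI CollectI conjI ballI)
        fix H' w' assume H': "H' \<in> ?fix F" and w': "w' \<in> F"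
        have "move (?s w') (move (?s w) H') = move (?s w) (move (?s w') H')"
          using comm[of w w'] w w' insert.prems by (auto simp: move_move)
        then show "move (?s w') (move (?s w) H') = move (?s w) H'" using H' w' by simp
      next
        fix H' assume "H' \<in> ?fix F"
        then show "move (?s w) H' \<in> X" using X(2)[OF W(1)[OF w]] by blast
      qed
      show "(move (?s w) ^^ CHAR('a)) H' = H'" for H' by (simp add: pow)
    qed (use finX in simp)
    moreover have "{H' \<in> ?fix F. move (?s w) H' = H'} = ?fix (insert w F)" by auto
    ultimately show ?case using insert by (metis (no_types, lifting) cong_trans insert_subset)
  qed simp
  from this[OF finW] have "[card (?fix ?W) = card X] (mod CHAR('a))" by simp
  moreover have "?fix ?W = X \<inter> {H}"
  proof -
    have "?s w *v v = v" if "v \<in> H" for w v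
      using that ell_eval_iff[OF H] by (simp add: reflection_matrix_mult_vec)
    then have "move (?s w) H = H" for w by simp
    then show ?thesis using fixed_hyperplane[OF H] X(1) by blast
  qed
  ultimately show ?thesis by (simp add: cong_sym)
qed

lemma arrangement_transitive:
  assumes H: "H \<in> arrangement G" and H': "H' \<in> arrangement G"
  obtains g where "g \<in> G" "move g H' = H"
proof -
  have "\<exists>g\<in>G. move g H' = H"
  proof (cases "transvection_vectors H \<subseteq> {0}")
    \<comment> \<open>Then \<open>H\<close> is the zero space, so the whole space is a line and has
      no other hyperplane.\<close>
    case True
    then have "H \<subseteq> {0}" using span_transvection_vectors[OF H] vec.span_mono[OF True] by simp
    moreover have "0 \<in> H'" using arrangement_hyperplane[OF H'] vec.subspace_0 by (auto simp: hyperplane_def)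
    ultimately have "H \<subseteq> H'" by blast
    then have "H' = H" using hyperplane_subset_eq arrangement_hyperplane H H' by blast
    then show ?thesis by (intro bexI[of _ "mat 1"]) auto
  next
    case False
    then obtain w where w: "w \<noteq> 0" "covec_eval (ell H) w = 0" "reflection_matrix (ell H) w \<in> G"
      by (auto simp: transvection_vectors_def)
    \<comment> \<open>A nontrivial transvection of finite order forces positive
      characteristic.\<close>
    have "of_nat (card G) *s w = 0"
      using pow_card(1)[OF w(3)] w(2)
      by (simp add: reflection_matrix_pow reflection_matrix_eq_1_iff[OF ell_nonzero[OF H]])
    then have "of_nat (card G) = (0 :: 'a)" using w(1) by simp
    then have "CHAR('a) > 0" using pow_card(2)[OF w(3)] by (auto simp: CHAR_pos_iff)
    then have p: "prime CHAR('a)" by (rule prime_CHAR_semidom)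
    define X where "X = (\<lambda>g. move g H') ` G"
    have X: "X \<subseteq> arrangement G" using move_arrangement H' by (auto simp: X_def)
    have stable: "move g ` X \<subseteq> X" if "g \<in> G" for g
      using that by (auto simp: X_def move_move)
    have "H' \<in> X" unfolding X_def by (rule image_eqI[of _ _ "mat 1"]) simp_all
    \<comment> \<open>The orbit of \<open>H'\<close> is counted twice modulo the characteristic. The
      transvections about \<open>H'\<close> give 1, so those about \<open>H\<close> must find
      \<open>H\<close> in the orbit.\<close>
    then have "[card X = 1] (mod CHAR('a))" using card_orbit_mod[OF H' X stable p] by simp
    moreover have "[card X = card (X \<inter> {H})] (mod CHAR('a))" by (rule card_orbit_mod[OF H X stable p])
    ultimately have "[card (X \<inter> {H}) = 1] (mod CHAR('a))" by (metis cong_sym cong_trans)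
    then have "card (X \<inter> {H}) \<noteq> 0"
      using prime_gt_1_nat[OF p] by (intro notI) (simp add: cong_def)
    then have "X \<inter> {H} \<noteq> {}" by auto
    then show ?thesis by (auto simp: X_def)
  qed
  then show ?thesis using that by blast
qed

lemma common_e:
  assumes "H \<in> arrangement G"
  shows "e_at G H = common_e G"
proof -
  have "\<forall>H'\<in>arrangement G. e_at G H' = e_at G H"
    using arrangement_transitive[OF assms] e_at_move by metis
  then have "\<forall>H'\<in>arrangement G. e_at G H' = common_e G" unfolding common_e_def by (rule someI)
  then show ?thesis using assms by blast
qed

end

section \<open>The determinant of the basic derivations\<close>

text \<open>The value of the derivation \<open>f\<close> on the linear form
  \<open>c\<close>.\<close>

definition deriv_form :: "'a::field ^ 'n \<Rightarrow> ('a, 'n::finite) deriv \<Rightarrow> ('a, 'n) mpoly" where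
  "deriv_form c f = (\<Sum>i\<in>UNIV. Const (c $ i) * f $ i)"

text \<open>The projection of \<open>axis i 1\<close> to the kernel of \<open>c\<close> along
  \<open>axis n 1\<close>, for \<open>c $ n \<noteq> 0\<close>; it is 0 at
  \<open>i = n\<close>.\<close>

definition kernel_vec :: "'a::field ^ 'n \<Rightarrow> 'n \<Rightarrow> 'n \<Rightarrow> 'a ^ 'n" where
  "kernel_vec c n i = axis i 1 - (c $ i * inverse (c $ n)) *s axis n 1"

text \<open>A frame of the derivations that preserve the ideal of the linear form \<open>c\<close>; here \<open>c $ n \<noteq> 0\<close>.\<close>
definition log_frame :: "'a::field ^ 'n \<Rightarrow> 'n \<Rightarrow> 'n \<Rightarrow> ('a, 'n::finite) deriv" where
  "log_frame c n i = (if i = n then euler else vec_map Const (kernel_vec c n i))"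

lemma kernel_vec_eval: "c $ n \<noteq> 0 \<Longrightarrow> covec_eval c (kernel_vec c n i) = 0"
  by (simp add: kernel_vec_def covec_eval_diff covec_eval_smult)

lemma kernel_vec_nth: "k \<noteq> n \<Longrightarrow> kernel_vec c n i $ k = (if k = i then 1 else 0)"
  by (simp add: kernel_vec_def axis_component)

lemma kernel_vec_nth_same: "i \<noteq> n \<Longrightarrow> kernel_vec c n i $ n = - c $ i * inverse (c $ n)"
  by (simp add: kernel_vec_def axis_component)

lemma sum_remove_UNIV: "(\<Sum>i\<in>UNIV. f i) = f n + (\<Sum>i\<in>UNIV - {n}. f i)" for n :: "'n::finite"
  by (rule sum.remove) auto

lemma sum_log_frame:
  fixes d :: "'n::finite \<Rightarrow> ('a::field, 'n) mpoly"
  shows "k \<noteq> n \<Longrightarrow> (\<Sum>j\<in>UNIV. d j *s log_frame c n j) $ k = d k + Var k * d n"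
    and "(\<Sum>j\<in>UNIV. d j *s log_frame c n j) $ n =
      Var n * d n - Const (inverse (c $ n)) * (\<Sum>j\<in>UNIV - {n}. Const (c $ j) * d j)"
proof -
  assume k: "k \<noteq> n"
  have "(\<Sum>j\<in>UNIV - {n}. d j * log_frame c n j $ k) = (\<Sum>j\<in>UNIV - {n}. if j = k then d k else 0)"
    using k by (intro sum.cong) (auto simp: log_frame_def kernel_vec_nth)
  then show "(\<Sum>j\<in>UNIV. d j *s log_frame c n j) $ k = d k + Var k * d n"
    using k by (simp add: sum_remove_UNIV[of _ n] log_frame_def[of c n n] euler_def sum.delta mult.commute)
next
  have "(\<Sum>j\<in>UNIV - {n}. d j * log_frame c n j $ n) =
      (\<Sum>j\<in>UNIV - {n}. - (Const (inverse (c $ n)) * (Const (c $ j) * d j)))"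
    by (intro sum.cong) (auto simp: log_frame_def kernel_vec_nth_same Const.minus Const.mult mult_ac)
  then show "(\<Sum>j\<in>UNIV. d j *s log_frame c n j) $ n =
      Var n * d n - Const (inverse (c $ n)) * (\<Sum>j\<in>UNIV - {n}. Const (c $ j) * d j)"
    by (simp add: sum_remove_UNIV[of _ n] log_frame_def[of c n n] euler_def sum_distrib_left sum_negf
        mult.commute)
qed

text \<open>The expansion of \<open>euler\<close> in \<open>axis n 1\<close> and the kernel vectors,
  read at coordinate \<open>l\<close>. The coefficient of \<open>axis n 1\<close> is a multiple of
  \<open>linear_form c\<close>.\<close>

lemma euler_kernel_vec:
  fixes c :: "'a::field ^ 'n::finite"
  assumes n: "c $ n \<noteq> 0"
  shows "(if l = n then Const (inverse (c $ n)) * linear_form c else 0) +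
    (\<Sum>k\<in>UNIV - {n}. Var k * Const (kernel_vec c n k $ l)) = Var l"
proof (cases "l = n")
  case False
  have "(\<Sum>k\<in>UNIV - {n}. Var k * Const (kernel_vec c n k $ l)) =
      (\<Sum>k\<in>UNIV - {n}. if k = l then Var l else (0 :: ('a, 'n) mpoly))"
    using False by (intro sum.cong) (auto simp: kernel_vec_nth)
  then show ?thesis using False by (simp add: sum.delta)
next
  case True
  have "(\<Sum>k\<in>UNIV - {n}. Var k * Const (kernel_vec c n k $ l)) =
      - (Const (inverse (c $ n)) * (\<Sum>k\<in>UNIV - {n}. Const (c $ k) * Var k))"
    unfolding True sum_distrib_left sum_negf[symmetric]
    by (intro sum.cong) (auto simp: kernel_vec_nth_same Const.mult Const.minus mult_ac)
  moreover have "linear_form c = Const (c $ n) * Var n + (\<Sum>k\<in>UNIV - {n}. Const (c $ k) * Var k)"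
    by (simp add: linear_form_def sum_remove_UNIV[of _ n])
  ultimately show ?thesis using n True by (simp add: distrib_left Const_inverse_left)
qed

text \<open>The constant members annihilate \<open>linear_form c\<close> and \<open>euler\<close>
  reproduces it, so the coefficient of \<open>euler\<close> has to be \<open>g\<close>. The
  coordinates other than \<open>n\<close> determine the remaining coefficients, and the hypothesis
  settles coordinate \<open>n\<close>.\<close>

lemma log_frame_decompose:
  fixes f :: "('a::field, 'n::{finite,linorder}) deriv"
  assumes n: "c $ n \<noteq> 0" and g: "deriv_form c f = linear_form c * g"
  shows "f = (\<Sum>j\<in>UNIV. (if j = n then g else f $ j - Var j * g) *s log_frame c n j)"
proof -
  let ?d = "\<lambda>j. if j = n then g else f $ j - Var j * g"
  have "f $ k = (\<Sum>j\<in>UNIV. ?d j *s log_frame c n j) $ k" for k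
  proof (cases "k = n")
    case False
    show ?thesis unfolding sum_log_frame(1)[OF False, of ?d c] using False by simp
  next
    case True
    have 1: "Const (c $ n) * f $ n + (\<Sum>j\<in>UNIV - {n}. Const (c $ j) * f $ j) =
        (Const (c $ n) * Var n + (\<Sum>j\<in>UNIV - {n}. Const (c $ j) * Var j)) * g"
      using g by (simp add: deriv_form_def linear_form_def sum_remove_UNIV[of _ n])
    have "(\<Sum>j\<in>UNIV - {n}. Const (c $ j) * ?d j) =
        (\<Sum>j\<in>UNIV - {n}. Const (c $ j) * f $ j) - (\<Sum>j\<in>UNIV - {n}. Const (c $ j) * Var j) * g"
      unfolding sum_distrib_right sum_subtractf[symmetric]
      by (intro sum.cong) (auto simp: algebra_simps)
    also have "\<dots> = Const (c $ n) * (Var n * g - f $ n)"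
      using 1 by (simp add: algebra_simps)
    finally have "Var n * g - Const (inverse (c $ n)) * (\<Sum>j\<in>UNIV - {n}. Const (c $ j) * ?d j) = f $ n"
      using n by (simp add: Const_inverse_left)
    then show ?thesis unfolding True sum_log_frame(2)[of ?d c n] by simp
  qed
  then show ?thesis by (intro iffD2[OF vec_eq_iff] allI)
qed

lemma ext_det_log_frame:
  fixes c :: "'a::field ^ 'n::{finite,linorder}"
  assumes n: "c $ n \<noteq> 0"
  obtains u where "ext_det (log_frame c n) = linear_form c * u" "u dvd 1"
proof -
  \<comment> \<open>\<open>\<gamma>\<close> has \<open>axis n 1\<close> in place of
    \<open>euler\<close>; it is a constant basis, with inverse matrix \<open>R\<close>.
    \<open>P\<close> expresses the frame in \<open>\<gamma>\<close> and differs from the identity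
    only in row \<open>n\<close>, whose diagonal entry is \<open>linear_form c\<close> up to a
    constant.\<close>
  define \<gamma> :: "'n \<Rightarrow> ('a, 'n) deriv" where
    "\<gamma> i = (if i = n then axis n 1 else vec_map Const (kernel_vec c n i))" for i
  define x :: "('a, 'n) deriv" where
    "x = (\<chi> k. if k = n then Const (inverse (c $ n)) * linear_form c else Var k)"
  define P :: "'n \<Rightarrow> ('a, 'n) deriv" where "P i = (if i = n then x else axis i 1)" for i
  define R :: "'n \<Rightarrow> ('a, 'n) deriv" where
    "R i = (if i = n then axis n 1 else axis i 1 + Const (c $ i * inverse (c $ n)) *s axis n 1)" for i
  have axis_sum: "(\<Sum>j\<in>UNIV. axis i 1 $ j *s f j) = f i" for i and f :: "'n \<Rightarrow> ('a, 'n) deriv"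
  proof -
    have "axis i 1 $ j *s f j = (if j = i then f i else 0)" for j by (simp add: axis_component)
    then show ?thesis by simp
  qed
  have "(\<Sum>j\<in>UNIV. R i $ j *s \<gamma> j) = axis i 1" for i
  proof (cases "i = n")
    case False
    have "(\<Sum>j\<in>UNIV. R i $ j *s \<gamma> j) =
        (\<Sum>j\<in>UNIV. axis i 1 $ j *s \<gamma> j) + Const (c $ i * inverse (c $ n)) *s (\<Sum>j\<in>UNIV. axis n 1 $ j *s \<gamma> j)"
      using False
      by (simp add: R_def sum.distrib vector_sadd_rdistrib vec.scale_sum_right vec_eq_iff sum_distrib_left mult.assoc distrib_right)
    also have "\<dots> = axis i 1"
      using False unfolding axis_sum
      by (auto simp: \<gamma>_def vec_eq_iff kernel_vec_def axis_component Const.diff Const.mult)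
    finally show ?thesis .
  qed (simp add: R_def axis_sum \<gamma>_def)
  then have "ext_det R * ext_det \<gamma> = 1" using ext_det_mult[of R \<gamma>] by simp
  then have unit: "ext_det \<gamma> dvd 1" by (metis dvd_triv_right)
  have "(\<Sum>j\<in>UNIV. P i $ j *s \<gamma> j) = log_frame c n i" for i
  proof (cases "i = n")
    case False
    then show ?thesis by (simp add: P_def axis_sum \<gamma>_def log_frame_def)
  next
    case True
    have "(\<Sum>j\<in>UNIV. x $ j *s \<gamma> j) $ k = Var k" for k
    proof -
      have "(\<Sum>j\<in>UNIV. x $ j *s \<gamma> j) $ k =
          Const (inverse (c $ n)) * linear_form c * axis n 1 $ k +
          (\<Sum>j\<in>UNIV - {n}. Var j * Const (kernel_vec c n j $ k))"
        by (simp add: sum_remove_UNIV[of _ n] x_def \<gamma>_def)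
      also have "\<dots> = Var k" using euler_kernel_vec[OF n, of k] by (auto simp: axis_component)
      finally show ?thesis .
    qed
    then show ?thesis using True by (simp add: P_def log_frame_def vec_eq_iff euler_def del: sum_component)
  qed
  then have "ext_det (log_frame c n) = ext_det P * ext_det \<gamma>"
    using ext_det_mult[of P \<gamma>] by simp
  also have "ext_det P = x $ n" unfolding P_def by (rule ext_det_axis_except)
  finally have "ext_det (log_frame c n) = linear_form c * (Const (inverse (c $ n)) * ext_det \<gamma>)"
    by (simp add: x_def mult_ac)
  moreover have "Const (inverse (c $ n)) * ext_det \<gamma> dvd 1"
    using unit n by (simp add: Const_mult_dvd_iff)
  ultimately show ?thesis by (rule that)
qed

section \<open>Derivations invariant under an inertia group\<close>

context transvection_group
begin

lemma log_frame_invariant: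
  assumes "c $ n \<noteq> 0"
  shows "log_frame c n i \<in> invariant_derivs (inertia c)"
proof -
  have "act_deriv g (log_frame c n i) = log_frame c n i" if g: "g \<in> inertia c" for g
  proof -
    have "c \<noteq> 0" using assms by auto
    then obtain w where w: "g = reflection_matrix c w" using inertiaE[OF g] by blast
    have "g \<in> G" using g inertia_subset by blast
    then show ?thesis
      by (simp add: log_frame_def act_deriv_euler act_deriv_const w reflection_matrix_mult_vec
          kernel_vec_eval assms)
  qed
  then show ?thesis by (simp add: invariant_derivs_def)
qed

lemma act_deriv_reflection_nth:
  assumes "act_deriv (reflection_matrix c w) f = f"
  shows "f $ k = act_poly (reflection_matrix c w) (f $ k) +
    Const (w $ k) * act_poly (reflection_matrix c w) (deriv_form c f)"
proof -
  let ?s = "reflection_matrix c w"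
  have s_nth: "?s $ k $ j = (if k = j then 1 else 0) + w $ k * c $ j" for j
    by (simp add: reflection_matrix_def)
  have "f $ k = act_deriv ?s f $ k" by (simp only: assms)
  also have "\<dots> = (\<Sum>j\<in>UNIV. Const (?s $ k $ j) * act_poly ?s (f $ j))"
    by (rule act_deriv_nth)
  also have "\<dots> = (\<Sum>j\<in>UNIV. (if k = j then act_poly ?s (f $ j) else 0) +
      Const (w $ k) * (Const (c $ j) * act_poly ?s (f $ j)))"
    unfolding s_nth by (intro sum.cong refl) (simp add: Const.add Const.mult algebra_simps)
  also have "\<dots> = act_poly ?s (f $ k) + Const (w $ k) * act_poly ?s (deriv_form c f)"
    by (simp add: sum.distrib deriv_form_def act.sum act.mult sum_distrib_left)
  finally show ?thesis .
qed

lemma inertia_dvd: "g \<in> inertia c \<Longrightarrow> linear_form c dvd act_poly g p - p"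
  by (simp add: inertia_def)

lemma inertia_dvd': "g \<in> inertia c \<Longrightarrow> linear_form c dvd p - act_poly g p"
  using inertia_dvd by (metis dvd_minus_iff minus_diff_eq)

lemma arrangement_reflection:
  assumes H: "H \<in> arrangement G"
  obtains w where "w \<noteq> 0" "reflection_matrix (ell H) w \<in> G"
proof -
  obtain s where s: "s \<in> G" "reflection_about H s" using H by (auto simp: arrangement_def)
  obtain w where w: "s = reflection_matrix (ell H) w"
    using reflection_aboutE[of "ell H" s] s(2) kernel_ell[OF H] ell_nonzero[OF H] by metis
  have "w \<noteq> 0" using s(2) by (auto simp: reflection_about_def w)
  then show ?thesis using s(1) unfolding w by (rule that)
qed

text \<open>Invariance under a reflection with root vector \<open>w\<close> equates \<open>w\<close>
  times the transformed value of \<open>f\<close> on the form with the change of the coefficients of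
  \<open>f\<close>. The latter is 0 modulo the form, and a nonzero coordinate of \<open>w\<close>
  can be cancelled.\<close>

lemma deriv_form_dvd:
  assumes H: "H \<in> arrangement G" and f: "f \<in> invariant_derivs (inertia (ell H))"
  shows "linear_form (ell H) dvd deriv_form (ell H) f"
proof -
  let ?c = "ell H"
  obtain w where w: "w \<noteq> 0" "reflection_matrix ?c w \<in> G" using arrangement_reflection[OF H] .
  let ?s = "reflection_matrix ?c w"
  have s: "?s \<in> inertia ?c" using reflection_matrix_in_inertia[OF w(2)] .
  obtain k where k: "w $ k \<noteq> 0" using w(1) by (auto simp: vec_eq_iff)
  have "Const (w $ k) * act_poly ?s (deriv_form ?c f) = f $ k - act_poly ?s (f $ k)"
    using act_deriv_reflection_nth[OF invariant_derivsD[OF f s], of k] by (simp add: algebra_simps)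
  then have "linear_form ?c dvd Const (w $ k) * act_poly ?s (deriv_form ?c f)"
    using inertia_dvd'[OF s] by metis
  then have "linear_form ?c dvd act_poly ?s (deriv_form ?c f)"
    using k by (simp add: dvd_Const_mult_iff)
  moreover have "linear_form ?c dvd deriv_form ?c f - act_poly ?s (deriv_form ?c f)"
    by (rule inertia_dvd'[OF s])
  ultimately have "linear_form ?c dvd act_poly ?s (deriv_form ?c f) +
      (deriv_form ?c f - act_poly ?s (deriv_form ?c f))" by (rule dvd_add)
  then show ?thesis by simp
qed

text \<open>The transvections fix the members of the frame, so they must fix the coefficients; this
  is verified on the explicit coefficients of \<open>log_frame_decompose\<close>.\<close>

lemma log_frame_coordinates:
  assumes H: "H \<in> arrangement G" and n: "ell H $ n \<noteq> 0" and f: "f \<in> invariant_derivs (inertia (ell H))"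
  obtains d where "f = (\<Sum>j\<in>UNIV. d j *s log_frame (ell H) n j)"
    "\<And>j. j \<noteq> n \<Longrightarrow> f $ j = d j + Var j * d n"
    "\<And>w j. w \<in> transvection_vectors H \<Longrightarrow> act_poly (reflection_matrix (ell H) w) (d j) = d j"
proof -
  let ?c = "ell H"
  obtain g where g: "deriv_form ?c f = linear_form ?c * g"
    using deriv_form_dvd[OF H f] by (auto simp: dvd_def)
  define d where "d j = (if j = n then g else f $ j - Var j * g)" for j
  have f_eq: "f = (\<Sum>j\<in>UNIV. d j *s log_frame ?c n j)"
    using log_frame_decompose[OF n g] by (simp add: d_def)
  have "act_poly (reflection_matrix ?c w) (d j) = d j" if w: "w \<in> transvection_vectors H" for w j
  proof -
    let ?s = "reflection_matrix ?c w"
    have w': "covec_eval ?c w = 0" "?s \<in> G" using w by (auto simp: transvection_vectors_def)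
    have inv: "act_deriv ?s f = f"
      using f reflection_matrix_in_inertia[OF w'(2)] by (rule invariant_derivsD)
    note nth = act_deriv_reflection_nth[OF inv]
    have "deriv_form ?c f = (\<Sum>k\<in>UNIV. Const (?c $ k) * (act_poly ?s (f $ k) + Const (w $ k) * act_poly ?s (deriv_form ?c f)))"
      unfolding deriv_form_def[of ?c f] using nth by (simp only: deriv_form_def[symmetric] flip: nth)
    also have "\<dots> = act_poly ?s (deriv_form ?c f) + Const (covec_eval ?c w) * act_poly ?s (deriv_form ?c f)"
      by (simp add: distrib_left sum.distrib covec_eval_def Const.sum Const.mult sum_distrib_right mult.assoc)
        (simp add: deriv_form_def act.sum act.mult)
    finally have form: "act_poly ?s (deriv_form ?c f) = deriv_form ?c f" by (simp add: w')
    have ell: "act_poly ?s (linear_form ?c) = linear_form ?c"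
      using act_poly_reflection_linear_form[of ?c w] by (simp add: w')
    have sg: "act_poly ?s g = g"
      using form ell_nonzero[OF H] by (simp add: g act.mult ell)
    have var: "act_poly ?s (Var j) = Var j - Const (w $ j) * linear_form ?c" for j
      using act_poly_reflection_Var[of ?c w j] by (simp add: w')
    have "act_poly ?s (f $ j) = f $ j - Const (w $ j) * (linear_form ?c * g)" for j
      using nth[of j] unfolding form unfolding g by (simp add: algebra_simps)
    then show ?thesis by (simp add: d_def sg act.diff act.mult var algebra_simps)
  qed
  moreover have "f $ j = d j + Var j * d n" if "j \<noteq> n" for j using that by (simp add: d_def)
  ultimately show ?thesis using f_eq by (intro that[of d])
qed

lemma log_frame_spans:
  assumes "H \<in> arrangement G" "ell H $ n \<noteq> 0" "f \<in> invariant_derivs (inertia (ell H))"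
  shows "\<exists>d. f = (\<Sum>j\<in>UNIV. d $ j *s log_frame (ell H) n j)"
proof (rule log_frame_coordinates[OF assms])
  fix d assume "f = (\<Sum>j\<in>UNIV. d j *s log_frame (ell H) n j)"
  then show ?thesis by (intro exI[of _ "\<chi> j. d j"]) simp
qed

section \<open>Divisibility by the forms of the reflecting hyperplanes\<close>

lemma linear_form_proportional:
  assumes H: "H \<in> arrangement G" and c: "{v. covec_eval c v = 0} = H"
  obtains a where "c = a *s ell H"
proof -
  obtain v where v: "v \<notin> H" using arrangement_hyperplane[OF H] hyperplane_not_UNIV by (metis UNIV_eq_I)
  have ev: "covec_eval (ell H) v \<noteq> 0" using v ell_eval_iff[OF H] by blast
  define a where "a = covec_eval c v / covec_eval (ell H) v"
  have "covec_eval c x = covec_eval (a *s ell H) x" for x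
  proof -
    let ?b = "covec_eval (ell H) x / covec_eval (ell H) v"
    have "covec_eval (ell H) (x - ?b *s v) = 0" using ev by (simp add: covec_eval_diff covec_eval_smult)
    then have "covec_eval c (x - ?b *s v) = 0" using c ell_eval_iff[OF H] by blast
    then show ?thesis using ev by (simp add: covec_eval_diff covec_eval_smult covec_eval_smult_left a_def)
  qed
  then have "c = a *s ell H" by (rule covec_eval_eqD)
  then show ?thesis by (rule that)
qed

lemma ell_coprime:
  assumes "H \<in> arrangement G" "H' \<in> arrangement G" "H \<noteq> H'"
  shows "\<not> linear_form (ell H) dvd linear_form (ell H')"
proof
  assume "linear_form (ell H) dvd linear_form (ell H')"
  then obtain a where a: "ell H' = a *s ell H"
    using linear_form_dvd_linear_form[OF ell_nonzero[OF assms(1)]] by blast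
  have "H \<subseteq> H'"
    using ell_eval_iff[OF assms(1)] ell_eval_iff[OF assms(2)] by (auto simp: a covec_eval_smult_left)
  then show False using assms hyperplane_subset_eq arrangement_hyperplane by blast
qed

lemma Q_poly_split:
  assumes "H \<in> arrangement G"
  obtains q where "Q_poly G ell = linear_form (ell H) * q" "\<not> linear_form (ell H) dvd q"
proof (rule that)
  let ?q = "\<Prod>H'\<in>arrangement G - {H}. linear_form (ell H')"
  show "Q_poly G ell = linear_form (ell H) * ?q"
    unfolding Q_poly_def using assms finite_arrangement by (rule prod.remove[rotated])
  show "\<not> linear_form (ell H) dvd ?q"
    using linear_form_dvd_prod[OF ell_nonzero[OF assms]] ell_coprime[OF assms] by blast
qed

lemma Q_poly_nonzero: "Q_poly G ell \<noteq> 0"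
  using finite_arrangement ell_nonzero by (simp add: Q_poly_def)

lemma Q_poly_power_dvd:
  assumes "\<And>H. H \<in> arrangement G \<Longrightarrow> linear_form (ell H) ^ k dvd p"
  shows "Q_poly G ell ^ k dvd p"
  unfolding Q_poly_def
  by (rule prod_dvd_coprime_forms[OF finite_arrangement]) (use assms ell_nonzero ell_coprime in auto)

abbreviation e where "e \<equiv> common_e G"

lemma e_pos: "H \<in> arrangement G \<Longrightarrow> 0 < e"
  using e_at_pos common_e by metis

text \<open>By \<open>e_pos\<close> the truncated difference \<open>e_at G H - 1\<close> in the
  exponent is a true one.\<close>

lemma Q_det_mult_Q: "Q_det G ell * Q_poly G ell = Q_poly G ell ^ e"
proof -
  have "linear_form (ell H) ^ (e_at G H - 1) * linear_form (ell H) = linear_form (ell H) ^ e"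
    if "H \<in> arrangement G" for H
    using common_e[OF that] e_pos[OF that] by (simp add: power_eq_if mult.commute)
  then show ?thesis by (simp add: Q_det_def Q_poly_def prod_power_distrib flip: prod.distrib)
qed

text \<open>Take a reflection whose eigenvalue \<open>a\<close> has order exactly \<open>e\<close>.
  If \<open>p\<close> is the \<open>m\<close>-th power of the form times \<open>q\<close>, where
  \<open>0 < m < e\<close>, then the reflection multiplies \<open>q\<close> by \<open>a ^ m\<close>;
  yet it fixes \<open>q\<close> modulo the form. As \<open>a ^ m \<noteq> 1\<close>, the form
  divides \<open>q\<close>.\<close>

lemma invariant_dvd_power:
  assumes H: "H \<in> arrangement G" and p: "p \<in> invariant_polys G" "linear_form (ell H) dvd p"
  shows "linear_form (ell H) ^ e dvd p"
proof -
  let ?c = "ell H"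
  obtain w where w: "reflection_matrix ?c w \<in> G"
    "\<And>k. (1 + covec_eval ?c w) ^ k = 1 \<longleftrightarrow> e_at G H dvd k"
    using e_at_witness[OF H] by blast
  let ?s = "reflection_matrix ?c w" and ?a = "1 + covec_eval ?c w"
  have a: "?a \<noteq> 0" using reflection_matrix_eval[OF w(1)] .
  have "linear_form ?c ^ m dvd p" if "m \<le> e" for m
    using that
  proof (induction m)
    case (Suc m)
    then obtain q where q: "p = linear_form ?c ^ m * q" by (auto simp: dvd_def)
    have "linear_form ?c dvd q"
    proof (cases "m = 0")
      case True
      then show ?thesis using q p(2) by simp
    next
      case False
      have "Const (inverse ?a ^ m) * (linear_form ?c ^ m * act_poly ?s q) = linear_form ?c ^ m * q"
        using invariant_polysD[OF p(1) w(1)]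
        by (simp add: q act.mult act.power act_poly_reflection_linear_form[OF a] power_mult_distrib
            Const.power mult.assoc)
      then have "linear_form ?c ^ m * (Const (inverse ?a ^ m) * act_poly ?s q) = linear_form ?c ^ m * q"
        by (simp add: mult.left_commute)
      then have "Const (inverse ?a ^ m) * act_poly ?s q = q"
        using ell_nonzero[OF H] by simp
      then have "Const (?a ^ m) * q = Const (?a ^ m * inverse ?a ^ m) * act_poly ?s q"
        by (simp add: Const.mult mult.assoc)
      also have "?a ^ m * inverse ?a ^ m = 1" using a by (simp flip: power_mult_distrib)
      finally have "act_poly ?s q - q = Const (?a ^ m - 1) * q"
        by (simp add: Const.diff left_diff_distrib)
      then have "linear_form ?c dvd Const (?a ^ m - 1) * q"
        using inertia_dvd[OF reflection_matrix_in_inertia[OF w(1)]] by metis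
      moreover have "\<not> e_at G H dvd m" using False Suc.prems common_e[OF H] by (auto dest: dvd_imp_le)
      then have "?a ^ m - 1 \<noteq> 0" using w(2) by simp
      ultimately show ?thesis by (simp add: dvd_Const_mult_iff)
    qed
    then show ?case by (auto simp: q dvd_def)
  qed simp
  then show ?thesis by simp
qed

text \<open>Here the generation of \<open>G\<close> by reflections enters.\<close>

lemma invariant_polysI_reflections:
  assumes "\<And>H w. H \<in> arrangement G \<Longrightarrow> reflection_matrix (ell H) w \<in> G \<Longrightarrow>
    act_poly (reflection_matrix (ell H) w) p = p"
  shows "p \<in> invariant_polys G"
proof -
  have refl: "act_poly s p = p" if s: "s \<in> G" "reflection s" for s
  proof -
    obtain H where H: "reflection_about H s" using s(2) by (auto simp: reflection_def)
    then have "H \<in> arrangement G" using s(1) by (auto simp: arrangement_def)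
    note arr = this
    have "reflection_about {v. covec_eval (ell H) v = 0} s" using H by (simp only: kernel_ell[OF arr])
    then obtain w where w: "s = reflection_matrix (ell H) w"
      using reflection_aboutE ell_nonzero[OF arr] by blast
    show ?thesis using assms[OF arr, of w] s(1) unfolding w by blast
  qed
  have "g \<in> G \<and> act_poly g p = p" if "g \<in> generate GL {s \<in> G. reflection s}" for g
    using that
  proof (induction rule: generate.induct)
    case (inv h)
    then have "act_poly h p = p" using refl by simp
    then show ?case using inv act_poly_inv[of h p] by (simp add: inv_GL)
  qed (auto simp: refl act_poly_mult)
  then show ?thesis using gen by (auto simp: invariant_polys_def)
qed

end

section \<open>Factorization of the determinant\<close>

locale free_derivations = transvection_group G ell
  for G :: "('a::field, 'n::{finite,linorder}) sqmat set" and ell +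
  fixes \<theta> :: "'n \<Rightarrow> ('a, 'n) deriv"
  assumes free: "free_basis (invariant_polys G) (invariant_derivs G) UNIV \<theta>"
begin

lemma invariant_derivs_eq:
  "invariant_derivs G = {\<Sum>k\<in>UNIV. c k *s \<theta> k |c. \<forall>k\<in>UNIV. c k \<in> invariant_polys G}"
  using free unfolding free_basis_def by (elim conjE)

lemma theta_invariant: "\<theta> i \<in> invariant_derivs G"
proof -
  have "(\<Sum>k\<in>UNIV. (if k = i then 1 else 0) *s \<theta> k) = (\<Sum>k\<in>UNIV. if k = i then \<theta> i else 0)"
    by (intro sum.cong) auto
  then have "\<theta> i = (\<Sum>k\<in>UNIV. (if k = i then 1 else 0) *s \<theta> k)" by simp
  then have "\<theta> i \<in> {\<Sum>k\<in>UNIV. c k *s \<theta> k |c. \<forall>k\<in>UNIV. c k \<in> invariant_polys G}"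
    by (intro CollectI exI[of _ "\<lambda>k. if k = i then 1 else 0"]) simp
  then show ?thesis unfolding invariant_derivs_eq .
qed

lemma theta_inertia_invariant: "\<theta> i \<in> invariant_derivs (inertia c)"
  using theta_invariant inertia_subset by (auto simp: invariant_derivs_def)

lemma theta_coordinates:
  assumes "f \<in> invariant_derivs G"
  obtains a where "f = (\<Sum>k\<in>UNIV. a k *s \<theta> k)" "\<And>k. a k \<in> invariant_polys G"
  using assms unfolding invariant_derivs_eq by blast

text \<open>The span over all of \<open>S\<close>, not over the invariants; it is the module
  \<open>N\<close> for the elimination in traces.\<close>

definition theta_span :: "('a, 'n) deriv set" where
  "theta_span = {\<Sum>k\<in>UNIV. a k *s \<theta> k |a. True}"

lemma theta_spanI: "(\<Sum>k\<in>UNIV. a k *s \<theta> k) \<in> theta_span"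
  unfolding theta_span_def by blast

lemma theta_span_invariant: "invariant_derivs G \<subseteq> theta_span"
  using theta_coordinates unfolding theta_span_def by blast

lemma theta_span_add: "\<xi> \<in> theta_span \<Longrightarrow> \<eta> \<in> theta_span \<Longrightarrow> \<xi> + \<eta> \<in> theta_span"
proof -
  assume "\<xi> \<in> theta_span" "\<eta> \<in> theta_span"
  then obtain a b where "\<xi> = (\<Sum>k\<in>UNIV. a k *s \<theta> k)" "\<eta> = (\<Sum>k\<in>UNIV. b k *s \<theta> k)"
    unfolding theta_span_def by blast
  then have "\<xi> + \<eta> = (\<Sum>k\<in>UNIV. (a k + b k) *s \<theta> k)"
    by (simp add: vector_sadd_rdistrib sum.distrib)
  then show ?thesis by (simp only: theta_spanI)
qed

lemma theta_span_smult: "\<xi> \<in> theta_span \<Longrightarrow> p *s \<xi> \<in> theta_span"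
proof -
  assume "\<xi> \<in> theta_span"
  then obtain a where "\<xi> = (\<Sum>k\<in>UNIV. a k *s \<theta> k)" unfolding theta_span_def by blast
  then have "p *s \<xi> = (\<Sum>k\<in>UNIV. (p * a k) *s \<theta> k)"
    by (simp add: vec_eq_iff sum_distrib_left mult.assoc)
  then show ?thesis by (simp only: theta_spanI)
qed

lemma ext_det_theta_dvd:
  assumes "\<And>i. m *s \<gamma> i \<in> theta_span"
  shows "ext_det \<theta> dvd m ^ CARD('n) * ext_det \<gamma>"
proof -
  have "\<exists>b. m *s \<gamma> i = (\<Sum>k\<in>UNIV. b $ k *s \<theta> k)" for i
  proof -
    obtain a where "m *s \<gamma> i = (\<Sum>k\<in>UNIV. a k *s \<theta> k)" using assms[of i] unfolding theta_span_def by blast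
    then show ?thesis by (intro exI[of _ "\<chi> k. a k"]) simp
  qed
  then obtain B where B: "\<And>i. m *s \<gamma> i = (\<Sum>k\<in>UNIV. B i $ k *s \<theta> k)" by metis
  have "m ^ CARD('n) * ext_det \<gamma> = ext_det B * ext_det \<theta>"
    using ext_det_mult[of B \<theta>] ext_det_smult[of "\<lambda>_. m" \<gamma>] by (simp flip: B)
  then show ?thesis by simp
qed

lemma frame_multiplier:
  assumes "c $ n \<noteq> 0"
  obtains m where "\<not> linear_form c dvd m" "\<And>i. m *s log_frame c n i \<in> theta_span"
proof -
  have "c \<noteq> 0" using assms by auto
  from inertia_multiplier[OF fin this theta_span_invariant theta_span_add theta_span_smult]
  obtain m where "\<not> linear_form c dvd m" "\<And>\<eta>. \<eta> \<in> invariant_derivs (inertia c) \<Longrightarrow> m *s \<eta> \<in> theta_span"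
    by blast
  then show ?thesis using log_frame_invariant[where c = c and n = n] assms that by blast
qed

lemma ell_dvd_ext_det_theta:
  assumes H: "H \<in> arrangement G"
  shows "linear_form (ell H) dvd ext_det \<theta>"
proof -
  obtain n where n: "ell H $ n \<noteq> 0" using ell_nonzero[OF H] by (auto simp: vec_eq_iff)
  have "\<exists>d. \<theta> i = (\<Sum>j\<in>UNIV. d $ j *s log_frame (ell H) n j)" for i
    by (rule log_frame_spans[OF H n theta_inertia_invariant])
  then obtain A where A: "\<And>i. \<theta> i = (\<Sum>j\<in>UNIV. A i $ j *s log_frame (ell H) n j)" by metis
  have "ext_det \<theta> = ext_det A * ext_det (log_frame (ell H) n)"
    using ext_det_mult[of A "log_frame (ell H) n"] by (simp flip: A)
  moreover obtain u where "ext_det (log_frame (ell H) n) = linear_form (ell H) * u"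
    using ext_det_log_frame[OF n] by metis
  ultimately show ?thesis by simp
qed

text \<open>Up to the multiplier \<open>m\<close> the frame lies in the span of the
  \<open>\<theta> i\<close>. So \<open>ext_det \<theta>\<close> divides a power of \<open>m\<close>
  times the determinant of the frame, which contains the form only once.\<close>

lemma ell_square_not_dvd_ext_det_theta:
  assumes H: "H \<in> arrangement G"
  shows "\<not> linear_form (ell H) * linear_form (ell H) dvd ext_det \<theta>"
proof
  let ?L = "linear_form (ell H)"
  assume dvd: "?L * ?L dvd ext_det \<theta>"
  obtain n where n: "ell H $ n \<noteq> 0" using ell_nonzero[OF H] by (auto simp: vec_eq_iff)
  obtain m where m: "\<not> ?L dvd m" "\<And>i. m *s log_frame (ell H) n i \<in> theta_span"
    using frame_multiplier[OF n] by blast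
  obtain u where u: "ext_det (log_frame (ell H) n) = ?L * u" "u dvd 1" using ext_det_log_frame[OF n] by blast
  obtain v where v: "u * v = 1" using u(2) by (auto simp: dvd_def)
  have "?L * ?L dvd m ^ CARD('n) * (?L * u)"
    using dvd_trans[OF dvd ext_det_theta_dvd[of m "log_frame (ell H) n", OF m(2)]] by (simp only: u(1))
  then have "?L * ?L dvd ?L * (m ^ CARD('n) * u)" by (simp only: mult.left_commute)
  then have "?L dvd m ^ CARD('n) * u" using ell_nonzero[OF H] by simp
  then have "?L dvd m ^ CARD('n) * u * v" by (rule dvd_mult2)
  then have "?L dvd m ^ CARD('n)" using v by (simp add: mult.assoc)
  then have "?L dvd m" by (rule linear_form_dvd_power[OF ell_nonzero[OF H]])
  then show False using m(1) by simp
qed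

lemma nonreflecting_not_dvd_ext_det_theta:
  assumes c: "c \<noteq> 0" "{v. covec_eval c v = 0} \<notin> arrangement G"
  shows "\<not> linear_form c dvd ext_det \<theta>"
proof
  assume dvd: "linear_form c dvd ext_det \<theta>"
  from inertia_multiplier[OF fin c(1) theta_span_invariant theta_span_add theta_span_smult]
  obtain m where m: "\<not> linear_form c dvd m" "\<And>\<eta>. \<eta> \<in> invariant_derivs (inertia c) \<Longrightarrow> m *s \<eta> \<in> theta_span"
    by blast
  have "ext_det \<theta> dvd m ^ CARD('n) * ext_det (\<lambda>i. axis i 1 :: ('a, 'n) deriv)"
    by (rule ext_det_theta_dvd[of m "\<lambda>i. axis i 1"]) (simp add: m(2) inertia_trivial[OF c] invariant_derivs_def)
  from dvd_trans[OF dvd this] have "linear_form c dvd m ^ CARD('n)" by simp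
  then have "linear_form c dvd m" by (rule linear_form_dvd_power[OF c(1)])
  then show False using m(1) by simp
qed

text \<open>Every reflecting hyperplane contributes its form exactly once and no other linear form
  occurs. The cofactor divides a product of linear forms, hence is constant.\<close>

lemma ext_det_theta:
  obtains k where "k \<noteq> 0" "ext_det \<theta> = Const k * Q_poly G ell"
proof -
  have "Q_poly G ell ^ 1 dvd ext_det \<theta>"
    using ell_dvd_ext_det_theta by (intro Q_poly_power_dvd) simp
  then obtain u where u: "ext_det \<theta> = Q_poly G ell * u" by (auto simp: dvd_def)
  obtain m where m: "m \<in> linear_products" "\<And>\<eta>. m *s \<eta> \<in> theta_span"
    using linear_products_multiplier[OF fin theta_span_invariant theta_span_add theta_span_smult] by blast
  have "ext_det \<theta> dvd m ^ CARD('n) * ext_det (\<lambda>i. axis i 1 :: ('a, 'n) deriv)"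
    by (rule ext_det_theta_dvd[of m "\<lambda>i. axis i 1"]) (rule m(2))
  then have u_dvd: "u dvd m ^ CARD('n)" using u by (metis dvd_mult_right ext_det_axis mult_1_right)
  have no_factor: "\<not> linear_form c dvd u" if c: "c \<noteq> 0" for c
  proof
    assume dvd: "linear_form c dvd u"
    then have "linear_form c dvd ext_det \<theta>" using u by simp
    then have "{v. covec_eval c v = 0} \<in> arrangement G" (is "?H \<in> _")
      using nonreflecting_not_dvd_ext_det_theta[OF c] by blast
    note H = this
    obtain a where a: "c = a *s ell ?H" using linear_form_proportional[OF H refl] .
    then have "a \<noteq> 0" using c by auto
    moreover have "linear_form c = Const a * linear_form (ell ?H)"
      using arg_cong[OF a, of linear_form] by (simp only: linear_form_smult)
    ultimately have "linear_form (ell ?H) dvd u"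
      using dvd Const_mult_dvd_iff by metis
    moreover have "linear_form (ell ?H) dvd Q_poly G ell"
      using Q_poly_split[OF H] by (metis dvd_triv_left)
    ultimately have "linear_form (ell ?H) * linear_form (ell ?H) dvd ext_det \<theta>"
      unfolding u by (intro mult_dvd_mono)
    then show False using ell_square_not_dvd_ext_det_theta[OF H] by blast
  qed
  from dvd_linear_products[OF linear_products_power[OF m(1)] u_dvd no_factor]
  obtain k where "u = Const k" "k \<noteq> 0" by blast
  then show ?thesis using that u by (simp add: mult.commute)
qed

text \<open>By invariance of the \<open>\<theta> i\<close>, the group element transforms their
  coefficient matrix by a constant matrix. The determinant of the \<open>\<theta> i\<close>, which
  is \<open>Q\<close> up to a scalar, is multiplied by the determinant of that matrix.\<close>

lemma Q_poly_semi_invariant: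
  assumes g: "g \<in> G"
  obtains a where "act_poly g (Q_poly G ell) = Const a * Q_poly G ell"
proof -
  obtain k where k: "k \<noteq> 0" "ext_det \<theta> = Const k * Q_poly G ell" using ext_det_theta .
  define r where "r l = (\<chi> j. matrix_inv g $ j $ l)" for l
  have "vec_map (act_poly g) (\<theta> i) = (\<Sum>l\<in>UNIV. \<theta> i $ l *s vec_map Const (r l))" for i
  proof -
    have "act_poly g (\<theta> i $ j) = (\<Sum>l\<in>UNIV. Const (matrix_inv g $ j $ l) * \<theta> i $ l)" for j
      using matrix_inv_act_deriv[OF invertible[OF g], of j "\<theta> i"] invariant_derivsD[OF theta_invariant g]
      by simp
    then show ?thesis by (simp add: vec_eq_iff r_def mult.commute)
  qed
  then have "act_poly g (ext_det \<theta>) = ext_det \<theta> * Const (ext_det r)"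
    by (simp add: act.ext_det ext_det_mult Const.ext_det)
  then have "Const k * act_poly g (Q_poly G ell) = Const k * (Const (ext_det r) * Q_poly G ell)"
    by (simp add: k(2) act.mult mult_ac)
  then have "act_poly g (Q_poly G ell) = Const (ext_det r) * Q_poly G ell" using k(1) by simp
  then show ?thesis by (rule that)
qed

text \<open>A reflection about \<open>H\<close> with eigenvalue \<open>a\<close> divides the form of
  \<open>H\<close> by \<open>a\<close> and fixes the product of the other forms modulo it. So it
  multiplies \<open>Q\<close> by the inverse of \<open>a\<close>, whose \<open>e\<close>-th power is
  1.\<close>

lemma Q_poly_power_invariant: "Q_poly G ell ^ e \<in> invariant_polys G"
proof (rule invariant_polysI_reflections)
  fix H w assume H: "H \<in> arrangement G" and s: "reflection_matrix (ell H) w \<in> G"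
  let ?s = "reflection_matrix (ell H) w" and ?a = "1 + covec_eval (ell H) w" and ?L = "linear_form (ell H)"
  obtain q where q: "Q_poly G ell = ?L * q" "\<not> ?L dvd q" using Q_poly_split[OF H] .
  obtain b where b: "act_poly ?s (Q_poly G ell) = Const b * Q_poly G ell"
    using Q_poly_semi_invariant[OF s] .
  have a: "?a \<noteq> 0" by (rule reflection_matrix_eval[OF s])
  have "?L * (Const (inverse ?a) * act_poly ?s q) = ?L * (Const b * q)"
    using b by (simp add: q(1) act.mult act_poly_reflection_linear_form[OF a] mult_ac)
  then have "Const (inverse ?a) * act_poly ?s q = Const b * q" using ell_nonzero[OF H] by simp
  moreover have "Const ?a * (Const (inverse ?a) * act_poly ?s q) = act_poly ?s q"
  proof -
    have "Const ?a * Const (inverse ?a) = (1 :: ('a, 'n) mpoly)"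
      using Const_inverse[OF a] by (simp only: mult.commute)
    then show ?thesis by (simp only: mult.assoc[symmetric] mult_1)
  qed
  ultimately have "act_poly ?s q = Const ?a * (Const b * q)" by simp
  then have "act_poly ?s q - q = Const (?a * b - 1) * q"
    by (simp add: Const.diff Const.mult left_diff_distrib mult.assoc)
  then have "?L dvd Const (?a * b - 1) * q"
    using inertia_dvd[OF reflection_matrix_in_inertia[OF s]] by metis
  then have ab: "?a * b = 1" using q(2) dvd_Const_mult_iff[of "?a * b - 1"] by (metis right_minus_eq)
  have "?a ^ e = 1" using e_at_exponent[OF H s] common_e[OF H] by simp
  moreover have "(?a * b) ^ e = 1" using ab by simp
  ultimately have "b ^ e = 1" by (simp only: power_mult_distrib mult_1)
  then show "act_poly ?s (Q_poly G ell ^ e) = Q_poly G ell ^ e"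
    by (simp add: act.power b power_mult_distrib flip: Const.power)
qed

end

section \<open>Invariant differential derivations along a reflecting hyperplane\<close>

text \<open>A model of the pullback along a frame. The constant basis has been straightened to the
  \<open>axis i 1\<close>; the Euler derivation, at index \<open>n\<close>, has coordinates
  \<open>x k\<close> for \<open>k \<noteq> n\<close>, and its coordinate \<open>t\<close> at
  \<open>n\<close> vanishes on the hyperplane. \<open>\<sigma> k\<close> is the \<open>k\<close>-th
  coordinate covector evaluated on this frame.\<close>

context
  fixes x :: "'n::{finite,linorder} \<Rightarrow> 'r::comm_ring_1" and n :: 'n and t :: 'r and \<sigma> :: "'n \<Rightarrow> 'r ^ 'n::{finite,linorder}"
  defines "\<sigma> \<equiv> \<lambda>k. if k = n then t *s axis n 1 else axis k 1 + x k *s axis n 1"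
begin

text \<open>When the product of the \<open>axis {i} 1 + x i *s axis {n} 1\<close> is expanded, at
  most one factor can contribute \<open>axis {n} 1\<close>, whose square is 0.\<close>

lemma wedge_over_shear:
  assumes "n \<notin> I"
  shows "wedge_over I (\<lambda>k. ext_vec (\<sigma> k)) = axis I 1 +
    (\<Sum>i\<in>I. (x i * ext_sign {i} (I - {i})) *s (axis {n} 1 \<and>\<^sub>e axis (I - {i}) 1))"
  using assms
proof (induction I rule: min_insert_induct)
  case empty
  show ?case by (simp add: ext_one_def)
next
  case (insert m I)
  have m: "m \<notin> I" "m \<noteq> n" "n \<notin> I" using insert by auto
  let ?y = "axis {n} 1 :: ('r, 'n) ext"
  let ?a = "\<lambda>I i. x i * ext_sign {i} (I - {i})"
  have sm: "ext_vec (\<sigma> m) = axis {m} 1 + x m *s ?y"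
    using m by (simp add: \<sigma>_def ext_vec_add ext_vec_smult)
  have ym: "axis {m} 1 \<and>\<^sub>e axis K 1 = (axis (insert m K) 1 :: ('r, 'n) ext)" if "K \<subseteq> I" for K
  proof -
    have "ext_sign {m} K = (1 :: 'r)"
      using that insert.hyps by (intro ext_sign_eq_1) (auto intro: less_imp_le)
    then show ?thesis using that m by (auto simp: axis_wedge_axis)
  qed
  have comm: "axis {m} 1 \<and>\<^sub>e ?y \<and>\<^sub>e z = - (?y \<and>\<^sub>e axis {m} 1 \<and>\<^sub>e z)" for z
    using ext_vec_anticommute_left[of "axis m 1" "axis n 1" z] by simp
  have yy: "?y \<and>\<^sub>e ?y \<and>\<^sub>e z = 0" for z
    using ext_vec_wedge_self_left[of "axis n 1" z] by simp
  have a: "?a (insert m I) i = - ?a I i" if "i \<in> I" for i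
  proof -
    have "m < i" using insert.hyps that by blast
    moreover have "insert m I - {i} = insert m (I - {i})" using that m by auto
    moreover have "m \<notin> I - {i}" using m by simp
    ultimately show ?thesis
      using ext_sign_insert_right[of m "I - {i}" "{i}", where 'b = 'r] by (simp add: ext_sign_singletons)
  qed
  have am: "?a (insert m I) m = x m"
  proof -
    have "ext_sign {m} I = (1 :: 'r)"
      using insert.hyps by (intro ext_sign_eq_1) (auto intro: less_imp_le)
    then show ?thesis using m by simp
  qed
  have summand: "axis {m} 1 \<and>\<^sub>e (?a I i *s (?y \<and>\<^sub>e axis (I - {i}) 1)) =
      ?a (insert m I) i *s (?y \<and>\<^sub>e axis (insert m I - {i}) 1)" if "i \<in> I" for i
  proof -
    have "insert m (I - {i}) = insert m I - {i}" using that m by auto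
    then show ?thesis
      using ym[of "I - {i}"] by (simp only: a[OF that] wedge_smult_right comm) (simp add: vector_smult_lneg)
  qed
  have "wedge_over (insert m I) (\<lambda>k. ext_vec (\<sigma> k)) =
      ext_vec (\<sigma> m) \<and>\<^sub>e wedge_over I (\<lambda>k. ext_vec (\<sigma> k))"
    using insert.hyps by (rule wedge_over_insert_min)
  also have "\<dots> = (axis {m} 1 + x m *s ?y) \<and>\<^sub>e (axis I 1 + (\<Sum>i\<in>I. ?a I i *s (?y \<and>\<^sub>e axis (I - {i}) 1)))"
    by (simp only: sm insert.IH[OF m(3)])
  also have "\<dots> = axis (insert m I) 1 + (x m *s (?y \<and>\<^sub>e axis I 1) +
      (\<Sum>i\<in>I. ?a (insert m I) i *s (?y \<and>\<^sub>e axis (insert m I - {i}) 1)))"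
    by (simp add: wedge_add_left wedge_add_right wedge_smult_left wedge_sum_right summand ym)
      (simp add: wedge_smult_right yy)
  also have "x m *s (?y \<and>\<^sub>e axis I 1) +
      (\<Sum>i\<in>I. ?a (insert m I) i *s (?y \<and>\<^sub>e axis (insert m I - {i}) 1)) =
      (\<Sum>i\<in>insert m I. ?a (insert m I) i *s (?y \<and>\<^sub>e axis (insert m I - {i}) 1))"
    using m am by simp
  finally show ?case .
qed

lemma wedge_over_shear_dvd:
  assumes "n \<in> I"
  shows "t dvd wedge_over I (\<lambda>k. ext_vec (\<sigma> k)) $ J"
proof -
  have "ext_vec (\<sigma> n) \<and>\<^sub>e wedge_over (I - {n}) (\<lambda>k. ext_vec (\<sigma> k)) =
      ext_sign {n} (I - {n}) *s wedge_over I (\<lambda>k. ext_vec (\<sigma> k))"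
    using assms by (simp add: ext_vec_wedge_wedge_over insert_absorb)
  moreover have "t dvd (ext_vec (\<sigma> n) \<and>\<^sub>e wedge_over (I - {n}) (\<lambda>k. ext_vec (\<sigma> k))) $ J"
    by (simp add: \<sigma>_def ext_vec_smult wedge_smult_left)
  ultimately have "t dvd ext_sign {n} (I - {n}) * wedge_over I (\<lambda>k. ext_vec (\<sigma> k)) $ J" by simp
  then have "t dvd ext_sign {n} (I - {n}) * (ext_sign {n} (I - {n}) * wedge_over I (\<lambda>k. ext_vec (\<sigma> k)) $ J)"
    by (rule dvd_mult)
  then show ?thesis by simp
qed

lemma ext_map_shear_nth:
  "t dvd ext_map \<sigma> b $ J - (\<Sum>I | n \<notin> I. b $ I * wedge_over I (\<lambda>k. ext_vec (\<sigma> k)) $ J)"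
proof -
  have "ext_map \<sigma> b $ J = (\<Sum>I | n \<notin> I. b $ I * wedge_over I (\<lambda>k. ext_vec (\<sigma> k)) $ J) +
      (\<Sum>I | n \<in> I. b $ I * wedge_over I (\<lambda>k. ext_vec (\<sigma> k)) $ J)"
    unfolding ext_map_nth by (subst sum.union_disjoint[symmetric]) (auto intro!: sum.cong)
  moreover have "t dvd (\<Sum>I | n \<in> I. b $ I * wedge_over I (\<lambda>k. ext_vec (\<sigma> k)) $ J)"
    by (rule dvd_sum) (auto intro: dvd_mult wedge_over_shear_dvd)
  ultimately show ?thesis by simp
qed

lemma ext_map_shear_fixed:
  assumes J: "n \<notin> J"
  shows "t dvd ext_map \<sigma> b $ J - b $ J"
proof -
  have "wedge_over I (\<lambda>k. ext_vec (\<sigma> k)) $ J = (if I = J then 1 else 0)" if "n \<notin> I" for I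
  proof -
    have "(axis {n} 1 \<and>\<^sub>e axis (I - {i}) 1) $ J = (0 :: 'r)" for i
      using J by (auto simp: axis_wedge_axis axis_component)
    then show ?thesis by (auto simp: wedge_over_shear[OF that] axis_component)
  qed
  then have "(\<Sum>I | n \<notin> I. b $ I * wedge_over I (\<lambda>k. ext_vec (\<sigma> k)) $ J) =
      (\<Sum>I | n \<notin> I. if I = J then b $ J else 0)"
    by (intro sum.cong) auto
  also have "\<dots> = b $ J" using J by (simp add: sum.delta)
  finally show ?thesis using ext_map_shear_nth[of b J] by simp
qed

lemma ext_map_shear_moved:
  assumes J: "n \<notin> J"
  shows "t dvd ext_map \<sigma> b $ insert n J -
    (\<Sum>i\<in>- insert n J. x i * (ext_sign {i} J * ext_sign {n} J) * b $ insert i J)"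
proof -
  have coeff: "wedge_over I (\<lambda>k. ext_vec (\<sigma> k)) $ insert n J =
      (\<Sum>i\<in>UNIV. if i \<in> I \<and> I - {i} = J then x i * (ext_sign {i} J * ext_sign {n} J) else 0)"
    if I: "n \<notin> I" for I
  proof -
    have eq: "insert n J = insert n (I - {i}) \<longleftrightarrow> I - {i} = J" for i using I J by auto
    have "I \<noteq> insert n J" using I by auto
    then have "wedge_over I (\<lambda>k. ext_vec (\<sigma> k)) $ insert n J =
        (\<Sum>i\<in>I. x i * ext_sign {i} (I - {i}) * (axis {n} 1 \<and>\<^sub>e axis (I - {i}) 1) $ insert n J)"
      by (simp add: wedge_over_shear[OF I] axis_component)
    also have "\<dots> = (\<Sum>i\<in>I. if I - {i} = J then x i * (ext_sign {i} J * ext_sign {n} J) else 0)"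
      using I by (intro sum.cong refl) (auto simp: axis_wedge_axis axis_component eq mult.assoc)
    also have "\<dots> = (\<Sum>i\<in>UNIV. if i \<in> I \<and> I - {i} = J then x i * (ext_sign {i} J * ext_sign {n} J) else 0)"
      by (rule sum.mono_neutral_cong_left) auto
    finally show ?thesis .
  qed
  have "(\<Sum>I | n \<notin> I. b $ I * wedge_over I (\<lambda>k. ext_vec (\<sigma> k)) $ insert n J) =
      (\<Sum>I | n \<notin> I. \<Sum>i\<in>UNIV. if i \<in> I \<and> I - {i} = J then x i * (ext_sign {i} J * ext_sign {n} J) * b $ I else 0)"
    by (intro sum.cong refl) (simp add: coeff sum_distrib_left mult.commute if_distrib[of "(*) _"] cong: if_cong)
  also have "\<dots> = (\<Sum>i\<in>UNIV. \<Sum>I | n \<notin> I. if i \<in> I \<and> I - {i} = J then x i * (ext_sign {i} J * ext_sign {n} J) * b $ I else 0)"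
    by (rule sum.swap)
  also have "\<dots> = (\<Sum>i\<in>UNIV. if i \<in> - insert n J then x i * (ext_sign {i} J * ext_sign {n} J) * b $ insert i J else 0)"
  proof (intro sum.cong refl)
    fix i
    have iff: "i \<in> I \<and> I - {i} = J \<longleftrightarrow> I = insert i J \<and> i \<notin> J" for I by auto
    have "(\<Sum>I | n \<notin> I. if i \<in> I \<and> I - {i} = J then x i * (ext_sign {i} J * ext_sign {n} J) * b $ I else 0) =
        (\<Sum>I | n \<notin> I. if I = insert i J then if i \<notin> J then x i * (ext_sign {i} J * ext_sign {n} J) * b $ insert i J else 0 else 0)"
      by (intro sum.cong refl) (auto simp: iff)
    also have "\<dots> = (if i \<in> - insert n J then x i * (ext_sign {i} J * ext_sign {n} J) * b $ insert i J else 0)"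
      using J by (auto simp: sum.delta)
    finally show "(\<Sum>I | n \<notin> I. if i \<in> I \<and> I - {i} = J then x i * (ext_sign {i} J * ext_sign {n} J) * b $ I else 0) =
        (if i \<in> - insert n J then x i * (ext_sign {i} J * ext_sign {n} J) * b $ insert i J else 0)" .
  qed
  also have "\<dots> = (\<Sum>i\<in>- insert n J. x i * (ext_sign {i} J * ext_sign {n} J) * b $ insert i J)"
    by (subst sum.inter_restrict[symmetric]) simp_all
  finally show ?thesis using ext_map_shear_nth[of b "insert n J"] by simp
qed

text \<open>Modulo \<open>t\<close> the coordinates without \<open>n\<close> are unchanged and
  determine those with \<open>n\<close>. Substituting the first fact into the second leaves a
  relation among the transformed coordinates alone.\<close>

lemma ext_map_shear_relation:
  assumes J: "n \<notin> J"
  shows "t dvd ext_map \<sigma> b $ insert n J -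
    (\<Sum>i\<in>- insert n J. x i * (ext_sign {i} J * ext_sign {n} J) * ext_map \<sigma> b $ insert i J)"
proof -
  have "t dvd (\<Sum>i\<in>- insert n J. x i * (ext_sign {i} J * ext_sign {n} J) * (ext_map \<sigma> b $ insert i J - b $ insert i J))"
    using J by (intro dvd_sum dvd_mult ext_map_shear_fixed) auto
  from dvd_diff[OF ext_map_shear_moved[OF J, of b] this] show ?thesis
    by (simp add: right_diff_distrib sum_subtractf algebra_simps)
qed

end

lemma pullback_log_frame_relation:
  fixes \<eta> :: "('a::field, 'n::{finite,linorder}) dderiv"
  assumes n: "c $ n \<noteq> 0" and J: "n \<notin> J"
  defines "T \<equiv> pullback (log_frame c n) \<eta>"
  shows "linear_form c dvd T $ (insert n J, j) -
    (\<Sum>i\<in>- insert n J. Var i * (ext_sign {i} J * ext_sign {n} J) * T $ (insert i J, j))"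
proof -
  define t where "t = Const (inverse (c $ n)) * linear_form c"
  define \<sigma> :: "'n \<Rightarrow> ('a, 'n) deriv" where
    "\<sigma> k = (if k = n then t *s axis n 1 else axis k 1 + Var k *s axis n 1)" for k
  \<comment> \<open>Evaluation on the constant basis with \<open>axis n 1\<close> in place of
    \<open>euler\<close>. The pullback along the frame is this followed by the shear
    \<open>\<sigma>\<close>.\<close>
  define w0 :: "'n \<Rightarrow> ('a, 'n) deriv" where
    "w0 l = (\<chi> i. if i = n then if l = n then 1 else 0 else Const (kernel_vec c n i $ l))" for l
  have "(\<Sum>k\<in>UNIV. w0 l $ k *s \<sigma> k) = (\<chi> i. log_frame c n i $ l)" for l
  proof -
    have "(\<Sum>k\<in>UNIV. w0 l $ k *s \<sigma> k) $ i = log_frame c n i $ l" for i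
    proof (cases "i = n")
      case False
      have "(\<Sum>k\<in>UNIV. w0 l $ k * \<sigma> k $ i) = (\<Sum>k\<in>UNIV. if k = i then w0 l $ i else 0)"
        using False by (intro sum.cong) (auto simp: \<sigma>_def axis_component)
      then show ?thesis using False by (simp add: w0_def log_frame_def)
    next
      case True
      have "(\<Sum>k\<in>UNIV. w0 l $ k * \<sigma> k $ n) =
          (if l = n then t else 0) + (\<Sum>k\<in>UNIV - {n}. Const (kernel_vec c n k $ l) * Var k)"
        by (simp add: sum_remove_UNIV[of _ n] w0_def \<sigma>_def axis_component)
      also have "\<dots> = Var l"
        using euler_kernel_vec[OF n, of l]
        by (simp only: t_def mult.commute[of "Const (kernel_vec c n _ $ l)"])
      finally show ?thesis using True by (simp add: log_frame_def euler_def)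
    qed
    then show ?thesis by (intro iffD2[OF vec_eq_iff] allI) simp
  qed
  then have T: "T $ (K, j) = ext_map \<sigma> (ext_map w0 (slice \<eta> j)) $ K" for K
    unfolding T_def pullback_nth by (simp only: ext_map_ext_map)
  have \<sigma>: "\<sigma> = (\<lambda>k. if k = n then t *s axis n 1 else axis k 1 + Var k *s axis n 1)"
    by (rule ext) (simp add: \<sigma>_def)
  have "t dvd T $ (insert n J, j) -
      (\<Sum>i\<in>- insert n J. Var i * (ext_sign {i} J * ext_sign {n} J) * T $ (insert i J, j))"
    unfolding T \<sigma> by (rule ext_map_shear_relation[OF J])
  then show ?thesis using n by (simp add: t_def Const_mult_dvd_iff)
qed

section \<open>Derivatives along the hyperplane and the twofold differentiation\<close>

context transvection_group
begin

text \<open>A finite difference: for a transvection, \<open>act_poly\<close> replaces the argument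
  \<open>v\<close> by \<open>v - covec_eval (ell H) v *s w\<close>. For \<open>w\<close> in
  \<open>transvection_vectors H\<close> the quotient exists, and it is unique because the form is
  not 0.\<close>

definition diff_quotient :: "('a ^ 'n::{finite,linorder}) set \<Rightarrow> 'a ^ 'n::{finite,linorder} \<Rightarrow> ('a, 'n) mpoly \<Rightarrow> ('a, 'n) mpoly" where
  "diff_quotient H w p = (SOME q. p - act_poly (reflection_matrix (ell H) w) p = linear_form (ell H) * q)"

context
  fixes H n
  assumes H: "H \<in> arrangement G" and n: "ell H $ n \<noteq> 0"
begin

interpretation res: ring_homo "restrict_poly (ell H) n"
  by (rule restrict_poly_homo)

abbreviation (input) "res \<equiv> restrict_poly (ell H) n"

text \<open>The directional derivative along \<open>w\<close> on the hyperplane, obtained from the action of the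
  transvection with root vector \<open>w\<close>\<close>
abbreviation (input) "der w p \<equiv> res (diff_quotient H w p)"

lemma res_eq_0_iff: "res p = 0 \<longleftrightarrow> linear_form (ell H) dvd p"
  by (simp add: linear_form_dvd_iff[OF n])

context
  fixes w
  assumes w: "w \<in> transvection_vectors H"
begin

lemma diff_quotient:
  "p - act_poly (reflection_matrix (ell H) w) p = linear_form (ell H) * diff_quotient H w p"
proof -
  have "linear_form (ell H) dvd p - act_poly (reflection_matrix (ell H) w) p"
    using w by (intro inertia_dvd' reflection_matrix_in_inertia) (simp add: transvection_vectors_def)
  then show ?thesis unfolding diff_quotient_def dvd_def by (rule someI_ex)
qed

lemma diff_quotient_unique:
  "p - act_poly (reflection_matrix (ell H) w) p = linear_form (ell H) * q \<Longrightarrow> diff_quotient H w p = q"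
  using diff_quotient[of p] ell_nonzero[OF H] by simp

lemma res_act: "res (act_poly (reflection_matrix (ell H) w) p) = res p"
proof -
  have "linear_form (ell H) dvd p - act_poly (reflection_matrix (ell H) w) p"
    by (simp add: diff_quotient)
  then show ?thesis by (simp add: res.diff flip: res_eq_0_iff)
qed

lemma der_add: "der w (p + q) = der w p + der w q"
proof -
  have "diff_quotient H w (p + q) = diff_quotient H w p + diff_quotient H w q"
    using diff_quotient[of p] diff_quotient[of q]
    by (intro diff_quotient_unique) (simp add: act.add algebra_simps)
  then show ?thesis by (simp add: res.add)
qed

lemma der_mult: "der w (p * q) = der w p * res q + res p * der w q"
proof -
  let ?s = "act_poly (reflection_matrix (ell H) w)"
  have "p * q - ?s (p * q) = (p - ?s p) * q + ?s p * (q - ?s q)"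
    by (simp add: act.mult algebra_simps)
  also have "\<dots> = linear_form (ell H) * (diff_quotient H w p * q + ?s p * diff_quotient H w q)"
    by (simp add: diff_quotient algebra_simps)
  finally have "diff_quotient H w (p * q) = diff_quotient H w p * q + ?s p * diff_quotient H w q"
    by (rule diff_quotient_unique)
  then show ?thesis by (simp add: res.add res.mult res_act)
qed

lemma der_fixed: "act_poly (reflection_matrix (ell H) w) p = p \<Longrightarrow> der w p = 0"
  using diff_quotient_unique[of p 0] by simp

lemma der_minus: "der w (- p) = - der w p"
  using der_add[of p "- p"] der_fixed[of 0] by (simp add: eq_neg_iff_add_eq_0 add.commute)

lemma der_diff: "der w (p - q) = der w p - der w q"
  using der_add[of p "- q"] by (simp add: der_minus)

lemma der_sum: "der w (\<Sum>x\<in>X. f x) = (\<Sum>x\<in>X. der w (f x))"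
  using der_fixed[of 0] by (induction X rule: infinite_finite_induct) (simp_all add: der_add)

lemma der_Var: "der w (Var i) = Const (w $ i)"
proof -
  have "covec_eval (ell H) w = 0" using w by (simp add: transvection_vectors_def)
  then have "diff_quotient H w (Var i) = Const (w $ i)"
    by (intro diff_quotient_unique) (simp add: act_poly_reflection_Var)
  then show ?thesis by (simp add: restrict_poly_def)
qed

text \<open>A transvection fixes the form, so the quotient for a multiple of the form is the change
  of the cofactor, which vanishes on the hyperplane. The derivative thus depends only on the
  restriction of its argument.\<close>

lemma der_eq_0: "res p = 0 \<Longrightarrow> der w p = 0"
proof -
  assume "res p = 0"
  then obtain q where q: "p = linear_form (ell H) * q" by (auto simp: res_eq_0_iff dvd_def)
  have "covec_eval (ell H) w = 0" using w by (simp add: transvection_vectors_def)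
  then have "act_poly (reflection_matrix (ell H) w) p =
      linear_form (ell H) * act_poly (reflection_matrix (ell H) w) q"
    using act_poly_reflection_linear_form[of "ell H" w] by (simp add: q act.mult)
  then have "diff_quotient H w p = q - act_poly (reflection_matrix (ell H) w) q"
    by (intro diff_quotient_unique) (simp add: q algebra_simps)
  then show ?thesis by (simp add: res.diff res_act)
qed

end

text \<open>The relation is linear in \<open>w\<close>, so it extends from the root vectors to their
  span, which by maximality is \<open>H\<close>. There the kernel vector of index \<open>a\<close>
  isolates \<open>F a\<close>.\<close>

lemma transvections_separate:
  assumes F: "\<And>w. w \<in> transvection_vectors H \<Longrightarrow> (\<Sum>i\<in>UNIV - {n}. Const (w $ i) * F i) = 0"
    and a: "a \<noteq> n"
  shows "F a = (0 :: ('a, 'n) mpoly)"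
proof -
  have "w \<in> {w. (\<Sum>i\<in>UNIV - {n}. Const (w $ i) * F i) = 0}" if "w \<in> H" for w
  proof -
    have "vec.subspace {w. (\<Sum>i\<in>UNIV - {n}. Const (w $ i) * F i) = 0}"
      by (rule vec.subspaceI)
        (simp_all add: Const.add Const.mult distrib_right sum.distrib mult.assoc flip: sum_distrib_left)
    then have "vec.span (transvection_vectors H) \<subseteq> {w. (\<Sum>i\<in>UNIV - {n}. Const (w $ i) * F i) = 0}"
      using F by (intro vec.span_minimal) auto
    then show ?thesis using that span_transvection_vectors[OF H] by blast
  qed
  moreover have "kernel_vec (ell H) n a \<in> H"
    using kernel_vec_eval[of "ell H" n, OF n] ell_eval_iff[OF H] by blast
  ultimately have "(\<Sum>i\<in>UNIV - {n}. Const (kernel_vec (ell H) n a $ i) * F i) = 0" by blast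
  moreover have "(\<Sum>i\<in>UNIV - {n}. Const (kernel_vec (ell H) n a $ i) * F i) =
      (\<Sum>i\<in>UNIV - {n}. if i = a then F a else 0)"
    by (intro sum.cong) (auto simp: kernel_vec_nth)
  ultimately show ?thesis using a by (simp add: sum.delta)
qed

text \<open>Differentiating the relation twice along the hyperplane isolates the coefficients of
  \<open>Var i * Var j\<close>. The diagonal ones are doubled in this way, which is why the characteristic must
  not be \<open>2\<close>.\<close>
lemma transvection_relation:
  assumes char: "(2 :: 'a) \<noteq> 0"
    and E: "\<And>j w. w \<in> transvection_vectors H \<Longrightarrow> act_poly (reflection_matrix (ell H) w) (E j) = E j"
    and X: "\<And>i j w. w \<in> transvection_vectors H \<Longrightarrow> act_poly (reflection_matrix (ell H) w) (X i j) = X i j"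
    and rel: "\<And>j. j \<noteq> n \<Longrightarrow>
      linear_form (ell H) dvd E j + Var j * E n - (\<Sum>i\<in>UNIV - {n}. Var i * (X i j + Var j * X i n))"
  shows "i \<noteq> n \<Longrightarrow> linear_form (ell H) dvd X i n"
    and "i \<noteq> n \<Longrightarrow> j \<noteq> n \<Longrightarrow> linear_form (ell H) dvd X i j - (if i = j then E n else 0)"
    and "j \<noteq> n \<Longrightarrow> linear_form (ell H) dvd E j"
proof -
  have dE: "der w (E j) = 0" and dX: "der w (X i j) = 0" if "w \<in> transvection_vectors H" for w i j
    using der_fixed[OF that] E[OF that] X[OF that] by auto
  define \<xi> where "\<xi> i = res (Var i)" for i
  note der = der_add der_diff der_sum der_mult der_Var dE dX
  note res = res.add res.diff res.sum res.mult \<xi>_def[symmetric]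
  \<comment> \<open>The \<open>E j\<close> and \<open>X i j\<close> have derivative 0. So the
    derivative of the relation in direction \<open>w\<close> is linear in the coordinates of
    \<open>w\<close>, and the coefficient of each \<open>w $ a\<close> with
    \<open>a \<noteq> n\<close> vanishes.\<close>
  have first: "res (if a = j then E n - (\<Sum>i\<in>UNIV - {n}. Var i * X i n) else 0) - res (X a j + Var j * X a n) = 0"
    if j: "j \<noteq> n" and a: "a \<noteq> n" for a j
  proof (rule transvections_separate[OF _ a])
    fix w assume w: "w \<in> transvection_vectors H"
    let ?T = "E n - (\<Sum>i\<in>UNIV - {n}. Var i * X i n)"
    have "(\<Sum>i\<in>UNIV - {n}. Const (w $ i) * (res (if i = j then ?T else 0) - res (X i j + Var j * X i n))) =
        (\<Sum>i\<in>UNIV - {n}. if i = j then Const (w $ j) * res ?T else 0) -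
        (\<Sum>i\<in>UNIV - {n}. Const (w $ i) * res (X i j + Var j * X i n))"
      unfolding sum_subtractf[symmetric] by (intro sum.cong) (auto simp: algebra_simps)
    also have "\<dots> = Const (w $ j) * res ?T - (\<Sum>i\<in>UNIV - {n}. Const (w $ i) * res (X i j + Var j * X i n))"
      using j by (simp add: sum.delta)
    also have "\<dots> = der w (E j + Var j * E n - (\<Sum>i\<in>UNIV - {n}. Var i * (X i j + Var j * X i n)))"
      using w by (simp add: der res sum.distrib algebra_simps sum_distrib_left)
    also have "\<dots> = 0" using der_eq_0[OF w] rel[OF j] by (simp add: res_eq_0_iff)
    finally show "(\<Sum>i\<in>UNIV - {n}. Const (w $ i) * (res (if i = j then ?T else 0) - res (X i j + Var j * X i n))) = 0" .
  qed
  have second: "(if b = j then res (X a n) else 0) + (if a = j then res (X b n) else 0) = 0"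
    if j: "j \<noteq> n" and a: "a \<noteq> n" and b: "b \<noteq> n" for a b j
  proof (rule transvections_separate[OF _ b])
    fix w assume w: "w \<in> transvection_vectors H"
    let ?U = "(if a = j then E n - (\<Sum>i\<in>UNIV - {n}. Var i * X i n) else 0) - (X a j + Var j * X a n)"
    have "(\<Sum>i\<in>UNIV - {n}. Const (w $ i) * ((if i = j then res (X a n) else 0) + (if a = j then res (X i n) else 0))) =
        (\<Sum>i\<in>UNIV - {n}. if i = j then Const (w $ j) * res (X a n) else 0) +
        (if a = j then \<Sum>i\<in>UNIV - {n}. Const (w $ i) * res (X i n) else 0)"
    proof -
      have "Const (w $ i) * ((if i = j then res (X a n) else 0) + (if a = j then res (X i n) else 0)) =
          (if i = j then Const (w $ j) * res (X a n) else 0) + (if a = j then Const (w $ i) * res (X i n) else 0)" for i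
        by (auto simp: distrib_left)
      then show ?thesis by (simp add: sum.distrib)
    qed
    also have "\<dots> = Const (w $ j) * res (X a n) + (if a = j then \<Sum>i\<in>UNIV - {n}. Const (w $ i) * res (X i n) else 0)"
      using j by (simp add: sum.delta)
    also have "\<dots> = - der w ?U"
      using w der_fixed[OF w, of 0] by (simp add: der)
    also have "\<dots> = 0" using der_eq_0[OF w, of ?U] first[OF j a] by (simp add: res.diff)
    finally show "(\<Sum>i\<in>UNIV - {n}. Const (w $ i) *
        ((if i = j then res (X a n) else 0) + (if a = j then res (X i n) else 0))) = 0" .
  qed
  \<comment> \<open>With all three indices equal, the second derivative counts \<open>X i n\<close>
    twice.\<close>
  have Xn: "res (X i n) = 0" if "i \<noteq> n" for i
  proof -
    have "Const 2 * res (X i n) = 0"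
      using second[OF that that that]
      by (simp only: one_add_one[symmetric] Const.add Const.one distrib_right mult_1 simp_thms if_True)
    then show ?thesis using char by (simp only: mult_eq_0_iff Const_eq_0_iff simp_thms)
  qed
  have Xij: "res (X i j) = (if i = j then res (E n) else 0)" if "i \<noteq> n" "j \<noteq> n" for i j
  proof -
    have "res (\<Sum>i\<in>UNIV - {n}. Var i * X i n) = 0"
      unfolding res.sum res.mult by (intro sum.neutral) (simp add: Xn)
    then have "res (if i = j then E n - (\<Sum>i\<in>UNIV - {n}. Var i * X i n) else 0) = (if i = j then res (E n) else 0)"
      by (cases "i = j") (simp_all only: res.diff simp_thms if_True if_False diff_zero res.zero)
    moreover have "res (X i j + Var j * X i n) = res (X i j)"
      by (simp only: res.add res.mult Xn[OF that(1)] mult_zero_right add_0_right)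
    ultimately show ?thesis using first[OF that(2,1)] by (simp only: right_minus_eq)
  qed
  show "i \<noteq> n \<Longrightarrow> linear_form (ell H) dvd X i n"
    using Xn by (simp add: res_eq_0_iff)
  show "i \<noteq> n \<Longrightarrow> j \<noteq> n \<Longrightarrow> linear_form (ell H) dvd X i j - (if i = j then E n else 0)"
  proof -
    assume ij: "i \<noteq> n" "j \<noteq> n"
    have "res (if i = j then E n else 0) = (if i = j then res (E n) else 0)" by simp
    then have "res (X i j - (if i = j then E n else 0)) = 0"
      by (simp only: res.diff Xij[OF ij] diff_self)
    then show ?thesis by (simp only: res_eq_0_iff)
  qed
  show "linear_form (ell H) dvd E j" if j: "j \<noteq> n"
  proof -
    have "res (\<Sum>i\<in>UNIV - {n}. Var i * (X i j + Var j * X i n)) =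
        (\<Sum>i\<in>UNIV - {n}. if i = j then res (Var j) * res (E n) else 0)"
      unfolding res.sum res.mult res.add using j by (intro sum.cong) (auto simp: Xn Xij)
    also have "\<dots> = res (Var j) * res (E n)" using j by (simp add: sum.delta)
    finally have "res (E j) = 0"
      using rel[OF j] unfolding res_eq_0_iff[symmetric] by (simp only: res.diff res.add res.mult) simp
    then show ?thesis by (simp only: res_eq_0_iff)
  qed
qed

text \<open>Each \<open>J\<close> without \<open>n\<close> yields one relation, between the rows at
  \<open>insert n J\<close> and at the sets \<open>insert i J\<close>; together these cover all
  nonempty sets.\<close>

lemma log_frame_pullback_coordinates:
  assumes char: "(2 :: 'a) \<noteq> 0" and \<eta>: "\<eta> \<in> invariant_dderivs G"
  obtains d where "\<And>J. deriv_row (pullback (log_frame (ell H) n) \<eta>) J = (\<Sum>j\<in>UNIV. d J j *s log_frame (ell H) n j)"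
    "\<And>J j. 2 \<le> card J \<Longrightarrow> linear_form (ell H) dvd d J j"
    "\<And>i j. linear_form (ell H) dvd d {i} j - (if i = j then d {n} n else 0)"
proof -
  let ?T = "pullback (log_frame (ell H) n) \<eta>" and ?L = "linear_form (ell H)"
  have inv: "deriv_row ?T J \<in> invariant_derivs (inertia (ell H))" for J
  proof -
    have "act_deriv g (deriv_row ?T J) = deriv_row ?T J" if g: "g \<in> inertia (ell H)" for g
    proof -
      have gG: "g \<in> G" using g inertia_subset by blast
      have "act_dderiv g \<eta> = \<eta>" using \<eta> gG by (simp add: invariant_dderivs_def)
      moreover have "act_deriv g (log_frame (ell H) n i) = log_frame (ell H) n i" for i
        using log_frame_invariant[of "ell H" n, OF n] g by (rule invariant_derivsD)
      ultimately show ?thesis using deriv_row_pullback_act[OF invertible[OF gG], of "log_frame (ell H) n" \<eta> J] by simp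
    qed
    then show ?thesis by (simp add: invariant_derivs_def)
  qed
  have "\<exists>d. deriv_row ?T J = (\<Sum>j\<in>UNIV. d j *s log_frame (ell H) n j) \<and>
      (\<forall>j. j \<noteq> n \<longrightarrow> ?T $ (J, j) = d j + Var j * d n) \<and>
      (\<forall>w j. w \<in> transvection_vectors H \<longrightarrow> act_poly (reflection_matrix (ell H) w) (d j) = d j)" for J
  proof -
    from log_frame_coordinates[OF H n inv[of J]] obtain d where d:
      "deriv_row ?T J = (\<Sum>j\<in>UNIV. d j *s log_frame (ell H) n j)"
      "\<And>j. j \<noteq> n \<Longrightarrow> deriv_row ?T J $ j = d j + Var j * d n"
      "\<And>w j. w \<in> transvection_vectors H \<Longrightarrow> act_poly (reflection_matrix (ell H) w) (d j) = d j"
      by blast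
    show ?thesis using d(1,3) d(2)[unfolded deriv_row_nth] by blast
  qed
  then obtain d where d_all: "\<forall>J. deriv_row ?T J = (\<Sum>j\<in>UNIV. d J j *s log_frame (ell H) n j) \<and>
      (\<forall>j. j \<noteq> n \<longrightarrow> ?T $ (J, j) = d J j + Var j * d J n) \<and>
      (\<forall>w j. w \<in> transvection_vectors H \<longrightarrow> act_poly (reflection_matrix (ell H) w) (d J j) = d J j)"
    using choice[of "\<lambda>J d. deriv_row ?T J = (\<Sum>j\<in>UNIV. d j *s log_frame (ell H) n j) \<and>
      (\<forall>j. j \<noteq> n \<longrightarrow> ?T $ (J, j) = d j + Var j * d n) \<and>
      (\<forall>w j. w \<in> transvection_vectors H \<longrightarrow> act_poly (reflection_matrix (ell H) w) (d j) = d j)"]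
    by blast
  have d: "\<And>J. deriv_row ?T J = (\<Sum>j\<in>UNIV. d J j *s log_frame (ell H) n j)"
    "\<And>J j. j \<noteq> n \<Longrightarrow> ?T $ (J, j) = d J j + Var j * d J n"
    "\<And>J w j. w \<in> transvection_vectors H \<Longrightarrow> act_poly (reflection_matrix (ell H) w) (d J j) = d J j"
    using d_all by blast+
  \<comment> \<open>The signs are those of the relation between the coordinates. The value 0 at
    \<open>i \<in> J\<close> extends its sum to all of \<open>UNIV - {n}\<close>, and is exploited
    once more in \<open>En\<close>.\<close>
  define X where "X J i j = (if i \<in> J then 0 else ext_sign {i} J * ext_sign {n} J * d (insert i J) j)" for J i j
  have rel: "?L dvd d (insert n J) j + Var j * d (insert n J) n - (\<Sum>i\<in>UNIV - {n}. Var i * (X J i j + Var j * X J i n))"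
    if J: "n \<notin> J" and j: "j \<noteq> n" for J j
  proof -
    have "(\<Sum>i\<in>- insert n J. Var i * (ext_sign {i} J * ext_sign {n} J) * ?T $ (insert i J, j)) =
        (\<Sum>i\<in>UNIV - {n}. Var i * (X J i j + Var j * X J i n))"
      using d(2)[OF j] by (intro sum.mono_neutral_cong_left) (auto simp: X_def algebra_simps)
    then show ?thesis
      using pullback_log_frame_relation[OF n J, of \<eta> j] by (simp add: d(2)[OF j])
  qed
  have X_inv: "act_poly (reflection_matrix (ell H) w) (X J i j) = X J i j"
    if "w \<in> transvection_vectors H" for w J i j
    using d(3)[OF that] by (simp add: X_def act.mult)
  have facts: "i \<noteq> n \<Longrightarrow> ?L dvd X J i n"
    "i \<noteq> n \<Longrightarrow> j \<noteq> n \<Longrightarrow> ?L dvd X J i j - (if i = j then d (insert n J) n else 0)"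
    "j \<noteq> n \<Longrightarrow> ?L dvd d (insert n J) j" if J: "n \<notin> J" for J i j
    using transvection_relation[of "d (insert n J)" "X J", OF char d(3) X_inv rel[OF J]] by blast+
  have sign: "?L dvd p" if "?L dvd ext_sign I J * (ext_sign I' J' * p)" for I J I' J' :: "'n set" and p
  proof -
    have "?L dvd ext_sign I' J' * (ext_sign I J * (ext_sign I J * (ext_sign I' J' * p)))"
      by (intro dvd_mult that)
    also have "ext_sign I' J' * (ext_sign I J * (ext_sign I J * (ext_sign I' J' * p))) = p"
      by (simp only: ext_sign_square_left)
    finally show ?thesis .
  qed
  \<comment> \<open>For \<open>i \<in> J\<close> the entry \<open>X J i i\<close> is 0 by
    definition, yet congruent to \<open>d (insert n J) n\<close>. For \<open>J = {}\<close> there is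
    no such \<open>i\<close>, which is why a scalar survives in degree one.\<close>
  have En: "?L dvd d (insert n J) n" if J: "n \<notin> J" "J \<noteq> {}" for J
  proof -
    obtain i where i: "i \<in> J" using J(2) by blast
    then have "i \<noteq> n" using J(1) by auto
    then show ?thesis using facts(2)[of J i i] i J by (simp add: X_def)
  qed
  have big: "?L dvd d (insert i J) j" if "n \<notin> J" "J \<noteq> {}" "i \<notin> J" for i j J
  proof (cases "i = n")
    case True
    then show ?thesis using En facts(3)[of J j] that by (cases "j = n") auto
  next
    case False
    have "?L dvd X J i j"
    proof (cases "j = n")
      case True
      then show ?thesis using facts(1)[of J i] that False by simp
    next
      case jn: False
      have "?L dvd X J i j - (if i = j then d (insert n J) n else 0)" using facts(2)[of J i j] that False jn by simp
      moreover have "?L dvd (if i = j then d (insert n J) n else 0)" using En that by simp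
      ultimately have "?L dvd (X J i j - (if i = j then d (insert n J) n else 0)) + (if i = j then d (insert n J) n else 0)"
        by (rule dvd_add)
      then show ?thesis by simp
    qed
    moreover have "X J i j = ext_sign {i} J * (ext_sign {n} J * d (insert i J) j)"
      using that(3) by (simp only: X_def if_False mult.assoc)
    ultimately have "?L dvd ext_sign {i} J * (ext_sign {n} J * d (insert i J) j)" by (simp only:)
    then show ?thesis by (rule sign)
  qed
  have two: "?L dvd d J j" if J: "2 \<le> card J" for J j
  proof -
    obtain i where i: "i \<in> J" "n \<notin> J - {i}"
    proof (cases "n \<in> J")
      case True
      then show ?thesis using that[of n] by simp
    next
      case False
      have "J \<noteq> {}" using J by auto
      then show ?thesis using that False by blast
    qed
    have "card (J - {i}) \<noteq> 0" using J i by simp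
    then have "J - {i} \<noteq> {}" by auto
    then show ?thesis using big[of "J - {i}" i j] i by (simp add: insert_absorb)
  qed
  have one: "?L dvd d {i} j - (if i = j then d {n} n else 0)" for i j
  proof (cases "i = n")
    case True
    then show ?thesis using facts(3)[of "{}" j] by auto
  next
    case False
    then show ?thesis using facts(1)[of "{}" i] facts(2)[of "{}" i j] by (cases "j = n") (auto simp: X_def)
  qed
  show ?thesis using d(1) two one by (rule that)
qed

end

end

section \<open>From the frame along a hyperplane to the basic derivations\<close>

context free_derivations
begin

text \<open>Freeness concerns invariant coefficients; here they are arbitrary. The identity matrix
  with row \<open>k\<close> replaced by \<open>a\<close> has determinant \<open>a k\<close>, and its
  product with the matrix of the \<open>\<theta> i\<close> has a zero row.\<close>

lemma theta_independent:
  assumes "(\<Sum>k\<in>UNIV. a k *s \<theta> k) = 0"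
  shows "a k = 0"
proof -
  define v where "v i = (if i = k then (\<chi> l. a l) else axis i 1)" for i
  have "(\<Sum>j\<in>UNIV. v k $ j *s \<theta> j) = 0" using assms by (simp add: v_def)
  then have "(\<lambda>i. (if i = k then 0 else 1) *s (\<Sum>j\<in>UNIV. v i $ j *s \<theta> j)) =
      (\<lambda>i. \<Sum>j\<in>UNIV. v i $ j *s \<theta> j)"
    by (intro ext) auto
  then have "ext_det (\<lambda>i. \<Sum>j\<in>UNIV. v i $ j *s \<theta> j) =
      (\<Prod>i\<in>UNIV. if i = k then 0 else 1) * ext_det (\<lambda>i. \<Sum>j\<in>UNIV. v i $ j *s \<theta> j)"
    using ext_det_smult[of "\<lambda>i. if i = k then 0 else 1" "\<lambda>i. \<Sum>j\<in>UNIV. v i $ j *s \<theta> j"]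
    by (simp only:)
  moreover have "(\<Prod>i\<in>UNIV. if i = k then 0 else 1) = (0 :: ('a, 'n) mpoly)"
    by (rule prod_zero) auto
  ultimately have "ext_det v * ext_det \<theta> = 0" by (simp add: ext_det_mult)
  moreover have "ext_det \<theta> \<noteq> 0"
  proof -
    obtain b where "b \<noteq> 0" "ext_det \<theta> = Const b * Q_poly G ell" using ext_det_theta .
    then show ?thesis using Q_poly_nonzero by simp
  qed
  moreover have "ext_det v = a k" unfolding v_def by (simp add: ext_det_axis_except)
  ultimately show ?thesis by simp
qed

lemma theta_coordinates_unique:
  assumes "(\<Sum>k\<in>UNIV. a k *s \<theta> k) = (\<Sum>k\<in>UNIV. b k *s \<theta> k)"
  shows "a k = b k"
proof -
  have "(\<Sum>k\<in>UNIV. (a k - b k) *s \<theta> k) = 0"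
    using assms by (simp add: vector_sub_rdistrib sum_subtractf)
  then show ?thesis using theta_independent[of "\<lambda>k. a k - b k"] by simp
qed

lemma deriv_row_pullback_invariant:
  assumes "\<eta> \<in> invariant_dderivs G"
  shows "deriv_row (pullback \<theta> \<eta>) I \<in> invariant_derivs G"
proof -
  have "act_deriv g (deriv_row (pullback \<theta> \<eta>) I) = deriv_row (pullback \<theta> \<eta>) I" if g: "g \<in> G" for g
  proof -
    have "act_dderiv g \<eta> = \<eta>" using assms g by (simp add: invariant_dderivs_def)
    then show ?thesis
      using deriv_row_pullback_act[of g \<theta> \<eta> I] invertible[OF g] invariant_derivsD[OF theta_invariant g]
      by simp
  qed
  then show ?thesis by (simp add: invariant_derivs_def)
qed

text \<open>\<open>A\<close> expresses the \<open>\<theta> i\<close> in the frame, and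
  \<open>B\<close> expresses \<open>m\<close> times the frame in the \<open>\<theta> i\<close>. Rows
  are recombined with minors of \<open>A\<close> and coefficients with \<open>B\<close>. As the
  product of \<open>A\<close> and \<open>B\<close> is \<open>m\<close> times the identity, a scalar
  matrix stays scalar; \<open>m\<close> can be cancelled since the form does not divide it.\<close>

lemma pullback_coordinates_dvd:
  assumes char: "(2 :: 'a) \<noteq> 0" and \<eta>: "\<eta> \<in> invariant_dderivs G"
    and c: "\<And>I. deriv_row (pullback \<theta> \<eta>) I = (\<Sum>l\<in>UNIV. c I l *s \<theta> l)"
    and H: "H \<in> arrangement G"
  shows "2 \<le> card I \<Longrightarrow> linear_form (ell H) dvd c I l"
    and "linear_form (ell H) dvd c {i} l - (if i = l then c {r} r else 0)"
proof -
  let ?L = "linear_form (ell H)"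
  obtain n where n: "ell H $ n \<noteq> 0" using ell_nonzero[OF H] by (auto simp: vec_eq_iff)
  let ?\<beta> = "log_frame (ell H) n"
  obtain d where d: "\<And>J. deriv_row (pullback ?\<beta> \<eta>) J = (\<Sum>j\<in>UNIV. d J j *s ?\<beta> j)"
    and two: "\<And>J j. 2 \<le> card J \<Longrightarrow> ?L dvd d J j"
    and one: "\<And>i j. ?L dvd d {i} j - (if i = j then d {n} n else 0)"
    using log_frame_pullback_coordinates[OF H n char \<eta>] by blast
  obtain m where m: "\<not> ?L dvd m" "\<And>i. m *s ?\<beta> i \<in> theta_span" using frame_multiplier[OF n] by blast
  have "\<exists>b. m *s ?\<beta> j = (\<Sum>l\<in>UNIV. b l *s \<theta> l)" for j using m(2)[of j] unfolding theta_span_def by blast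
  then obtain B where B: "\<And>j. m *s ?\<beta> j = (\<Sum>l\<in>UNIV. B j l *s \<theta> l)" by metis
  obtain A where A: "\<And>i. \<theta> i = (\<Sum>j\<in>UNIV. A i $ j *s ?\<beta> j)"
    using log_frame_spans[OF H n theta_inertia_invariant] by metis
  define \<alpha> where "\<alpha> j = (\<chi> i. A i $ j)" for j
  have "(\<Sum>j\<in>UNIV. (\<chi> i. ?\<beta> i $ l) $ j *s \<alpha> j) = (\<chi> i. \<theta> i $ l)" for l
    using arg_cong[OF A, of "\<lambda>v. v $ l"] by (simp add: vec_eq_iff \<alpha>_def mult.commute)
  then have slice: "slice (pullback \<theta> \<eta>) j = ext_map \<alpha> (slice (pullback ?\<beta> \<eta>) j)" for j
    by (simp only: slice_pullback ext_map_ext_map)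
  let ?K = "\<lambda>J I. wedge_over J (\<lambda>i. ext_vec (\<alpha> i)) $ I"
  have rows: "deriv_row (pullback \<theta> \<eta>) I = (\<Sum>J | card J = card I. ?K J I *s deriv_row (pullback ?\<beta> \<eta>) J)" for I
  proof -
    have "deriv_row (pullback \<theta> \<eta>) I $ j = (\<Sum>J | card J = card I. ?K J I *s deriv_row (pullback ?\<beta> \<eta>) J) $ j" for j
      using arg_cong[OF slice[of j], of "\<lambda>v. v $ I"] by (simp add: ext_map_degree mult.commute)
    then show ?thesis by (intro iffD2[OF vec_eq_iff] allI)
  qed
  have mc: "m * c I l = (\<Sum>J | card J = card I. ?K J I * (\<Sum>j\<in>UNIV. d J j * B j l))" for I l
  proof (rule theta_coordinates_unique[of "\<lambda>l. m * c I l"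
        "\<lambda>l. \<Sum>J | card J = card I. ?K J I * (\<Sum>j\<in>UNIV. d J j * B j l)"])
    have "(\<Sum>l\<in>UNIV. (m * c I l) *s \<theta> l) = m *s deriv_row (pullback \<theta> \<eta>) I"
      unfolding c by (simp add: vec_eq_iff sum_distrib_left mult.assoc)
    also have "\<dots> = (\<Sum>J | card J = card I. ?K J I *s (\<Sum>j\<in>UNIV. d J j *s (m *s ?\<beta> j)))"
      unfolding rows d by (simp add: vec_eq_iff sum_distrib_left mult_ac)
    also have "\<dots> = (\<Sum>J | card J = card I. ?K J I *s (\<Sum>l\<in>UNIV. (\<Sum>j\<in>UNIV. d J j * B j l) *s \<theta> l))"
    proof -
      have "(\<Sum>j\<in>UNIV. d J j *s (m *s ?\<beta> j)) = (\<Sum>l\<in>UNIV. (\<Sum>j\<in>UNIV. d J j * B j l) *s \<theta> l)" for J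
        unfolding B by (simp add: vec_eq_iff sum_distrib_left sum_distrib_right mult.assoc) (auto intro: sum.swap)
      then show ?thesis by simp
    qed
    also have "\<dots> = (\<Sum>l\<in>UNIV. (\<Sum>J | card J = card I. ?K J I * (\<Sum>j\<in>UNIV. d J j * B j l)) *s \<theta> l)"
      by (simp add: vec_eq_iff sum_distrib_left sum_distrib_right mult.assoc) (auto intro: sum.swap)
    finally show "(\<Sum>l\<in>UNIV. (m * c I l) *s \<theta> l) =
      (\<Sum>l\<in>UNIV. (\<Sum>J | card J = card I. ?K J I * (\<Sum>j\<in>UNIV. d J j * B j l)) *s \<theta> l)" .
  qed
  show "?L dvd c I l" if I: "2 \<le> card I" for I l
  proof -
    have "?L dvd m * c I l" unfolding mc using I two by (intro dvd_sum dvd_mult dvd_mult2) auto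
    then show ?thesis using m(1) linear_form_prime[OF ell_nonzero[OF H]] by blast
  qed
  have scalar: "?L dvd c {i} l - (if i = l then d {n} n else 0)" for i l
  proof -
    have AB: "(\<Sum>j\<in>UNIV. A i $ j * B j l) = (if l = i then m else 0)"
    proof (rule theta_coordinates_unique[of "\<lambda>l. \<Sum>j\<in>UNIV. A i $ j * B j l" "\<lambda>l. if l = i then m else 0"])
      have "(\<Sum>l\<in>UNIV. (\<Sum>j\<in>UNIV. A i $ j * B j l) *s \<theta> l) = (\<Sum>j\<in>UNIV. A i $ j *s (m *s ?\<beta> j))"
        unfolding B by (simp add: vec_eq_iff sum_distrib_left sum_distrib_right mult.assoc) (auto intro: sum.swap)
      also have "\<dots> = m *s \<theta> i"
        unfolding A[of i] by (simp add: vec_eq_iff sum_distrib_left mult_ac)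
      also have "\<dots> = (\<Sum>l\<in>UNIV. if l = i then m *s \<theta> l else 0)" by simp
      also have "\<dots> = (\<Sum>l\<in>UNIV. (if l = i then m else 0) *s \<theta> l)" by (intro sum.cong) auto
      finally show "(\<Sum>l\<in>UNIV. (\<Sum>j\<in>UNIV. A i $ j * B j l) *s \<theta> l) = (\<Sum>l\<in>UNIV. (if l = i then m else 0) *s \<theta> l)" .
    qed
    have singles: "{J :: 'n set. card J = card {i}} = (\<lambda>j. {j}) ` UNIV"
      by (auto simp: card_1_singleton_iff image_iff)
    have "m * c {i} l = (\<Sum>j\<in>UNIV. A i $ j * (\<Sum>k\<in>UNIV. d {j} k * B k l))"
      unfolding mc singles by (subst sum.reindex) (auto simp: wedge_over_singleton \<alpha>_def inj_on_def)
    moreover have "(\<Sum>j\<in>UNIV. A i $ j * (\<Sum>k\<in>UNIV. (if j = k then d {n} n else 0) * B k l)) =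
        m * (if i = l then d {n} n else 0)"
    proof -
      have "(if j = k then d {n} n else 0) * B k l = (if j = k then d {n} n * B k l else 0)" for j k
        by simp
      then have "(\<Sum>j\<in>UNIV. A i $ j * (\<Sum>k\<in>UNIV. (if j = k then d {n} n else 0) * B k l)) =
          d {n} n * (\<Sum>j\<in>UNIV. A i $ j * B j l)"
        by (simp add: sum_distrib_left mult.left_commute)
      then show ?thesis by (simp add: AB)
    qed
    ultimately have "m * (c {i} l - (if i = l then d {n} n else 0)) =
        (\<Sum>j\<in>UNIV. A i $ j * (\<Sum>k\<in>UNIV. (d {j} k - (if j = k then d {n} n else 0)) * B k l))"
      by (simp only: left_diff_distrib right_diff_distrib sum_subtractf)
    then have "?L dvd m * (c {i} l - (if i = l then d {n} n else 0))"
      by (simp only:) (intro dvd_sum dvd_mult[OF dvd_sum] dvd_mult2 one)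
    then show ?thesis using m(1) linear_form_prime[OF ell_nonzero[OF H]] by blast
  qed
  show "?L dvd c {i} l - (if i = l then c {r} r else 0)"
  proof (cases "i = l")
    case True
    then show ?thesis using dvd_diff[OF scalar[of i l] scalar[of r r]] by simp
  qed (use scalar[of i l] in simp)
qed

end

section \<open>Dual forms\<close>

lemma Phi_smult: "Phi (c *s \<beta>) = c *s Phi \<beta>"
  unfolding Phi_def by (simp add: wedge_smult_right flip: ext_vec_smult)
    (simp add: vec_eq_iff ext_vec_nth if_distrib[of "(*) _"] sum_distrib_left cong: if_cong)

lemma ext_vec_wedge_UNIV:
  "(ext_vec a \<and>\<^sub>e \<beta>) $ UNIV = (\<Sum>l\<in>UNIV. a $ l * (axis {l} 1 \<and>\<^sub>e \<beta>) $ UNIV)"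
  by (simp add: ext_vec_def wedge_sum_left wedge_smult_left)

text \<open>At most one factor of each term is parallel to \<open>c\<close>, so
  \<open>card I - 1\<close> factors \<open>p\<close> can be taken out. The additional
  \<open>p\<close> on the left avoids that difference and admits \<open>I = {}\<close>.\<close>

lemma wedge_over_almost_parallel:
  fixes p :: "'r::comm_ring_1"
  assumes \<rho>: "\<And>i. \<rho> i = \<mu> i *s ext_vec c + p *s ext_vec (\<tau> i)"
  shows "\<exists>a b. p *s wedge_over I \<rho> = p ^ card I *s (ext_vec c \<and>\<^sub>e a + p *s b)"
proof (induction I rule: min_insert_induct)
  case empty
  show ?case by (intro exI[of _ 0] exI[of _ ext_one]) simp
next
  case (insert m I)
  then obtain a b where ab: "p *s wedge_over I \<rho> = p ^ card I *s (ext_vec c \<and>\<^sub>e a + p *s b)" by blast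
  have m: "m \<notin> I" using insert.hyps by blast
  have anti: "ext_vec (\<tau> m) \<and>\<^sub>e ext_vec c \<and>\<^sub>e a = - (ext_vec c \<and>\<^sub>e ext_vec (\<tau> m) \<and>\<^sub>e a)"
    by (rule ext_vec_anticommute_left)
  have "p *s wedge_over (insert m I) \<rho> = \<rho> m \<and>\<^sub>e (p *s wedge_over I \<rho>)"
    using insert.hyps by (simp add: wedge_over_insert_min wedge_smult_right)
  also have "\<dots> = p ^ card I *s ((\<mu> m *s ext_vec c + p *s ext_vec (\<tau> m)) \<and>\<^sub>e (ext_vec c \<and>\<^sub>e a + p *s b))"
    by (simp only: ab wedge_smult_right \<rho>)
  also have "(\<mu> m *s ext_vec c + p *s ext_vec (\<tau> m)) \<and>\<^sub>e (ext_vec c \<and>\<^sub>e a + p *s b) =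
      p *s (ext_vec c \<and>\<^sub>e (\<mu> m *s b - ext_vec (\<tau> m) \<and>\<^sub>e a) + p *s (ext_vec (\<tau> m) \<and>\<^sub>e b))"
  proof -
    have "ext_vec c \<and>\<^sub>e (\<mu> m *s b - ext_vec (\<tau> m) \<and>\<^sub>e a) =
        \<mu> m *s (ext_vec c \<and>\<^sub>e b) - (ext_vec c \<and>\<^sub>e ext_vec (\<tau> m) \<and>\<^sub>e a)"
      using wedge_add_right[of "ext_vec c" "\<mu> m *s b" "- (ext_vec (\<tau> m) \<and>\<^sub>e a)"]
      by (simp add: wedge_smult_right wedge_minus_right)
    then show ?thesis
      by (simp only: wedge_add_left wedge_add_right wedge_smult_left wedge_smult_right anti
          ext_vec_wedge_self_left) (simp add: vec_eq_iff algebra_simps)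
  qed
  finally have "p *s wedge_over (insert m I) \<rho> = p ^ card (insert m I) *s
      (ext_vec c \<and>\<^sub>e (\<mu> m *s b - ext_vec (\<tau> m) \<and>\<^sub>e a) + p *s (ext_vec (\<tau> m) \<and>\<^sub>e b))"
    using m by (simp add: vector_smult_assoc mult_ac)
  then show ?case by blast
qed

context free_derivations
begin

text \<open>The dual form without \<open>Q_det\<close>, as a covector. Up to signs these covectors
  make up the adjugate of the matrix of the \<open>\<theta> j\<close>.\<close>

definition complement_form :: "'n \<Rightarrow> ('a, 'n) deriv" where
  "complement_form i = (\<chi> l. (axis {l} 1 \<and>\<^sub>e wedge_over (UNIV - {i}) (\<lambda>j. ext_vec (\<theta> j))) $ UNIV)"

lemma dual_form_eq: "dual_form G ell \<theta> i = Q_det G ell *s ext_vec (complement_form i)"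
  unfolding dual_form_def Phi_smult by (simp add: Phi_def complement_form_def)

lemma complement_form_pairing:
  "(\<Sum>l\<in>UNIV. a $ l * complement_form i $ l) =
    ext_sign {i} (UNIV - {i}) * ext_det (\<lambda>j. if j = i then a else \<theta> j)"
proof -
  let ?v = "\<lambda>j. if j = i then a else \<theta> j"
  have "wedge_over (UNIV - {i}) (\<lambda>j. ext_vec (?v j)) = wedge_over (UNIV - {i}) (\<lambda>j. ext_vec (\<theta> j))"
    by (rule wedge_over_cong) auto
  then show ?thesis using ext_det_row[of ?v i] by (simp add: ext_vec_wedge_UNIV complement_form_def)
qed

lemma complement_form_theta:
  "(\<Sum>l\<in>UNIV. \<theta> j $ l * complement_form i $ l) =
    (if j = i then ext_sign {i} (UNIV - {i}) * ext_det \<theta> else 0)"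
proof -
  have "(ext_vec (\<theta> j) \<and>\<^sub>e wedge_over (UNIV - {i}) (\<lambda>j. ext_vec (\<theta> j))) $ UNIV =
      (if j = i then ext_sign {i} (UNIV - {i}) * ext_det \<theta> else 0)"
  proof (cases "j = i")
    case True
    then show ?thesis by (simp add: ext_det_row)
  next
    case False
    then show ?thesis using ext_vec_wedge_wedge_over[of \<theta> j "UNIV - {i}"] by simp
  qed
  then show ?thesis by (simp add: ext_vec_wedge_UNIV complement_form_def)
qed

text \<open>Pairing with a kernel vector gives, up to sign, the determinant of the family in which
  that vector replaces \<open>\<theta> i\<close>. This family lies in the span of the frame, whose
  determinant contains the form. So modulo the form each \<open>complement_form i\<close> is
  parallel to \<open>ell H\<close>.\<close>

lemma complement_form_kernel_dvd:
  assumes H: "H \<in> arrangement G" and n: "ell H $ n \<noteq> 0" and a: "a \<noteq> n"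
  shows "linear_form (ell H) dvd complement_form i $ a -
    Const (ell H $ a * inverse (ell H $ n)) * complement_form i $ n"
proof -
  let ?\<beta> = "log_frame (ell H) n" and ?L = "linear_form (ell H)"
  let ?v = "\<lambda>j. if j = i then ?\<beta> a else \<theta> j"
  have "\<exists>d. ?v j = (\<Sum>k\<in>UNIV. d $ k *s ?\<beta> k)" for j
    using log_frame_invariant[OF n] theta_inertia_invariant
    by (intro log_frame_spans[OF H n]) auto
  then obtain A where A: "\<And>j. ?v j = (\<Sum>k\<in>UNIV. A j $ k *s ?\<beta> k)" by metis
  have "ext_det ?v = ext_det A * ext_det ?\<beta>" using ext_det_mult[of A ?\<beta>] by (simp only: A[symmetric])
  moreover obtain u where "ext_det ?\<beta> = ?L * u" using ext_det_log_frame[OF n] by blast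
  ultimately have "?L dvd ext_det ?v" by simp
  then have "?L dvd (\<Sum>l\<in>UNIV. ?\<beta> a $ l * complement_form i $ l)"
    unfolding complement_form_pairing by (rule dvd_mult)
  moreover have "(\<Sum>l\<in>UNIV. ?\<beta> a $ l * complement_form i $ l) =
      complement_form i $ a - Const (ell H $ a * inverse (ell H $ n)) * complement_form i $ n"
  proof -
    have "?\<beta> a $ l * complement_form i $ l =
        (if l = a then complement_form i $ a else 0) -
        (if l = n then Const (ell H $ a * inverse (ell H $ n)) * complement_form i $ n else 0)" for l
      using a by (auto simp: log_frame_def kernel_vec_def axis_component Const.minus)
    then show ?thesis by (simp add: sum_subtractf)
  qed
  ultimately show ?thesis by simp
qed

lemma ell_power_dvd_wedge_complement_forms:
  assumes H: "H \<in> arrangement G"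
  shows "linear_form (ell H) ^ (card I - 1) dvd wedge_over I (\<lambda>i. ext_vec (complement_form i)) $ K"
proof (cases "I = {}")
  case False
  let ?L = "linear_form (ell H)"
  obtain n where n: "ell H $ n \<noteq> 0" using ell_nonzero[OF H] by (auto simp: vec_eq_iff)
  have "\<exists>t. complement_form i $ l = Const (ell H $ l * inverse (ell H $ n)) * complement_form i $ n + ?L * t" for i l
  proof (cases "l = n")
    case True
    then show ?thesis using n by (intro exI[of _ 0]) simp
  next
    case False
    then show ?thesis using complement_form_kernel_dvd[OF H n False, of i]
      by (auto simp: dvd_def algebra_simps)
  qed
  then obtain t where t: "\<And>i l. complement_form i $ l =
      Const (ell H $ l * inverse (ell H $ n)) * complement_form i $ n + ?L * t i l" by metis
  have "complement_form i = (Const (inverse (ell H $ n)) * complement_form i $ n) *s vec_map Const (ell H) +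
      ?L *s (\<chi> l. t i l)" for i
    unfolding vec_eq_iff by (rule allI, subst t) (simp add: Const.mult mult_ac)
  from arg_cong[OF this, of ext_vec]
  have "ext_vec (complement_form i) = (Const (inverse (ell H $ n)) * complement_form i $ n) *s
      ext_vec (vec_map Const (ell H)) + ?L *s ext_vec (\<chi> l. t i l)" for i
    by (simp only: ext_vec_add ext_vec_smult)
  from wedge_over_almost_parallel[of "\<lambda>i. ext_vec (complement_form i)", OF this, of I]
  obtain z where "?L *s wedge_over I (\<lambda>i. ext_vec (complement_form i)) = ?L ^ card I *s z" by blast
  then have "?L * wedge_over I (\<lambda>i. ext_vec (complement_form i)) $ K = ?L ^ card I * z $ K"
    by (metis vector_smult_component)
  moreover have "?L ^ card I = ?L * ?L ^ (card I - 1)" using False by (simp add: power_eq_if)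
  ultimately have "?L * wedge_over I (\<lambda>i. ext_vec (complement_form i)) $ K = ?L * (?L ^ (card I - 1) * z $ K)"
    by (simp only: mult.assoc)
  then show ?thesis using ell_nonzero[OF H] by simp
qed simp

text \<open>The exact division is justified here. For \<open>k = card I\<close> the wedge of the
  complement forms is divisible by \<open>Q ^ (k - 1)\<close>, and
  \<open>Q_det ^ k * Q ^ (k - 1) = Q_det * Q ^ (e * (k - 1))\<close>.\<close>

lemma curly_form_quotient:
  assumes "I \<noteq> {}"
  shows "Q_poly G ell ^ (e * (card I - 1)) *s curly_form G ell \<theta> I = wedge_over I (dual_form G ell \<theta>)"
proof -
  let ?Q = "Q_poly G ell" and ?W = "wedge_over I (\<lambda>i. ext_vec (complement_form i))"
  have "?Q ^ (card I - 1) dvd ?W $ K" for K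
    by (rule Q_poly_power_dvd) (rule ell_power_dvd_wedge_complement_forms)
  then obtain z where z: "\<And>K. ?W $ K = ?Q ^ (card I - 1) * z K" unfolding dvd_def by metis
  have "dual_form G ell \<theta> = (\<lambda>i. Q_det G ell *s ext_vec (complement_form i))"
    by (rule ext) (rule dual_form_eq)
  then have "wedge_over I (dual_form G ell \<theta>) = Q_det G ell ^ card I *s ?W"
    by (simp add: wedge_over_smult[of I "\<lambda>_. Q_det G ell"])
  also have "Q_det G ell ^ card I = Q_det G ell * Q_det G ell ^ (card I - 1)"
    using assms by (simp add: power_eq_if)
  also have "(Q_det G ell * Q_det G ell ^ (card I - 1)) *s ?W =
      ?Q ^ (e * (card I - 1)) *s (\<chi> K. Q_det G ell * z K)"
    by (simp add: vec_eq_iff z power_mult mult_ac power_mult_distrib flip: Q_det_mult_Q)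
  finally have *: "wedge_over I (dual_form G ell \<theta>) = ?Q ^ (e * (card I - 1)) *s (\<chi> K. Q_det G ell * z K)" .
  have "\<exists>!y. ?Q ^ (e * (card I - 1)) *s y = wedge_over I (dual_form G ell \<theta>)"
    unfolding * using Q_poly_nonzero by (intro ex1I[of _ "\<chi> K. Q_det G ell * z K"]) (auto simp: vec_eq_iff)
  from theI'[OF this] show ?thesis using assms by (simp add: curly_form_def exact_quotient_def)
qed

definition theta_transpose :: "'n \<Rightarrow> ('a, 'n) deriv" where
  "theta_transpose l = (\<chi> i. \<theta> i $ l)"

lemma theta_transpose_eq: "(\<lambda>l. \<chi> i. \<theta> i $ l) = theta_transpose"
  by (rule ext) (simp add: theta_transpose_def)

definition det_scalar :: 'a where
  "det_scalar = (SOME k. k \<noteq> 0 \<and> ext_det \<theta> = Const k * Q_poly G ell)"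

lemma det_scalar: "det_scalar \<noteq> 0" "ext_det \<theta> = Const det_scalar * Q_poly G ell"
proof -
  have "\<exists>k. k \<noteq> 0 \<and> ext_det \<theta> = Const k * Q_poly G ell" using ext_det_theta by blast
  from someI_ex[OF this] show "det_scalar \<noteq> 0" "ext_det \<theta> = Const det_scalar * Q_poly G ell"
    by (simp_all add: det_scalar_def)
qed

definition curly_scalar :: "'n set \<Rightarrow> 'a" where
  "curly_scalar I = (\<Prod>i\<in>I. ext_sign {i} (UNIV - {i}) * det_scalar)"

lemma curly_scalar_nonzero: "curly_scalar I \<noteq> 0"
proof -
  have "ext_sign J K \<noteq> (0 :: 'a)" for J K :: "'n set"
    by (simp add: ext_sign_def)
  then show ?thesis using det_scalar(1) by (simp add: curly_scalar_def)
qed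

text \<open>Each dual form becomes \<open>Q ^ e\<close> times a scalar and a basis covector. Of the
  factor \<open>Q ^ (e * k)\<close> in a product of \<open>k \<ge> 1\<close> of them, the division
  leaves \<open>Q ^ e\<close>, whatever \<open>k\<close> is.\<close>

definition curly_factor :: "'n set \<Rightarrow> ('a, 'n) mpoly" where
  "curly_factor I = (if I = {} then 1 else Const (curly_scalar I) * Q_poly G ell ^ e)"

lemma curly_factor_nonzero: "curly_factor I \<noteq> 0"
  using curly_scalar_nonzero Q_poly_nonzero by (simp add: curly_factor_def)

lemma curly_factor_invariant: "curly_factor I \<in> invariant_polys G"
  using Q_poly_power_invariant by (simp add: curly_factor_def invariant_polys_mult)

lemma ext_map_dual_form:
  "ext_map theta_transpose (dual_form G ell \<theta> i) =
    Const (ext_sign {i} (UNIV - {i}) * det_scalar) *s (Q_poly G ell ^ e *s axis {i} 1)"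
proof -
  have "(\<Sum>l\<in>UNIV. complement_form i $ l *s theta_transpose l) =
      (ext_sign {i} (UNIV - {i}) * ext_det \<theta>) *s axis i 1"
    using complement_form_theta[of _ i]
    by (auto simp: vec_eq_iff theta_transpose_def axis_component mult.commute)
  then have "ext_map theta_transpose (dual_form G ell \<theta> i) =
      Q_det G ell *s ((ext_sign {i} (UNIV - {i}) * ext_det \<theta>) *s axis {i} 1)"
    by (simp add: dual_form_eq ext_map_smult ext_map_ext_vec ext_vec_smult)
  also have "\<dots> = Const (ext_sign {i} (UNIV - {i}) * det_scalar) *s (Q_poly G ell ^ e *s axis {i} 1)"
    by (simp add: det_scalar vector_smult_assoc Const.mult mult_ac flip: Q_det_mult_Q)
  finally show ?thesis .
qed

lemma ext_map_curly_form: "ext_map theta_transpose (curly_form G ell \<theta> I) = curly_factor I *s axis I 1"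
proof (cases "I = {}")
  case True
  then show ?thesis by (simp add: curly_form_def curly_factor_def) (simp add: ext_one_def)
next
  case False
  let ?Q = "Q_poly G ell"
  have "?Q ^ (e * (card I - 1)) *s ext_map theta_transpose (curly_form G ell \<theta> I) =
      ext_map theta_transpose (wedge_over I (dual_form G ell \<theta>))"
    by (simp only: ext_map_smult[symmetric] curly_form_quotient[OF False])
  also have "\<dots> = wedge_over I (\<lambda>i. (Const (ext_sign {i} (UNIV - {i}) * det_scalar) * ?Q ^ e) *s axis {i} 1)"
    by (simp add: ext_map_wedge_over ext_map_dual_form vector_smult_assoc)
  also have "\<dots> = (Const (curly_scalar I) * (?Q ^ e) ^ card I) *s axis I 1"
  proof -
    have "(\<Prod>i\<in>I. Const (ext_sign {i} (UNIV - {i}) * det_scalar) * ?Q ^ e) =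
        Const (curly_scalar I) * (?Q ^ e) ^ card I"
      by (subst prod.distrib) (simp only: prod_constant curly_scalar_def Const.prod)
    then show ?thesis by (simp only: wedge_over_smult wedge_over_axis)
  qed
  also have "(?Q ^ e) ^ card I = ?Q ^ e * ?Q ^ (e * (card I - 1))"
  proof -
    have "card I = Suc (card I - 1)" using False by (simp add: card_gt_0_iff)
    then show ?thesis by (metis power_Suc power_mult)
  qed
  also have "(Const (curly_scalar I) * (?Q ^ e * ?Q ^ (e * (card I - 1)))) *s axis I 1 =
      ?Q ^ (e * (card I - 1)) *s (curly_factor I *s axis I 1)"
    using False by (simp only: curly_factor_def if_False vector_smult_assoc mult_ac)
  finally have "?Q ^ (e * (card I - 1)) * ext_map theta_transpose (curly_form G ell \<theta> I) $ K =
      ?Q ^ (e * (card I - 1)) * (curly_factor I *s axis I 1) $ K" for K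
    by (metis vector_smult_component)
  then have "ext_map theta_transpose (curly_form G ell \<theta> I) $ K = (curly_factor I *s axis I 1) $ K" for K
    using Q_poly_nonzero by (metis mult_cancel_left power_not_zero)
  then show ?thesis by (intro iffD2[OF vec_eq_iff] allI)
qed

section \<open>The basis of the invariant differential derivations\<close>

lemma slice_pullback_theta: "slice (pullback \<theta> \<eta>) j = ext_map theta_transpose (slice \<eta> j)"
  by (simp only: slice_pullback theta_transpose_eq)

text \<open>The matrix \<open>B\<close> inverts that of the \<open>\<theta> i\<close> up to
  \<open>m\<close>: a further pullback with \<open>B\<close> multiplies the coordinate at
  \<open>I\<close> by \<open>m ^ card I\<close>.\<close>

lemma pullback_theta_eq_0D:
  assumes "pullback \<theta> \<eta> = 0"
  shows "\<eta> = 0"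
proof -
  obtain m where m: "m \<in> linear_products" "\<And>\<eta>. m *s \<eta> \<in> theta_span"
    using linear_products_multiplier[OF fin theta_span_invariant theta_span_add theta_span_smult] by blast
  have m0: "m \<noteq> 0" using m(1) by induction auto
  have "\<exists>b. m *s axis l 1 = (\<Sum>k\<in>UNIV. b k *s \<theta> k)" for l using m(2)[of "axis l 1"] unfolding theta_span_def by blast
  then obtain B where B: "\<And>l. m *s axis l 1 = (\<Sum>k\<in>UNIV. B l k *s \<theta> k)" by metis
  have "(\<Sum>i\<in>UNIV. theta_transpose l $ i *s (\<chi> k. B k i)) = m *s axis l 1" for l
  proof -
    have "(\<Sum>i\<in>UNIV. \<theta> i $ l * B k i) = m * axis l 1 $ k" for k
      using arg_cong[OF B[of k], of "\<lambda>v. v $ l"] by (simp add: axis_component mult.commute eq_commute)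
    then show ?thesis by (simp add: vec_eq_iff theta_transpose_def)
  qed
  then have "ext_map (\<lambda>i. \<chi> k. B k i) (ext_map theta_transpose (slice \<eta> j)) = (\<chi> I. m ^ card I * slice \<eta> j $ I)" for j
    by (simp add: ext_map_ext_map ext_map_scalar)
  moreover have "ext_map theta_transpose (slice \<eta> j) = 0" for j
    using assms by (simp add: vec_eq_iff flip: slice_pullback_theta)
  ultimately have "\<forall>I. m ^ card I * slice \<eta> j $ I = 0" for j
    by (simp add: vec_eq_iff)
  then show ?thesis using m0 by (simp add: vec_eq_iff split_paired_all)
qed

lemma pullback_theta_inj:
  assumes "\<And>I. deriv_row (pullback \<theta> \<eta>) I = deriv_row (pullback \<theta> \<eta>') I"
  shows "\<eta> = \<eta>'"
proof -
  have "pullback \<theta> \<eta> $ (I, j) = pullback \<theta> \<eta>' $ (I, j)" for I j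
    using assms[of I] by (metis deriv_row_nth)
  then have eq: "pullback \<theta> \<eta> = pullback \<theta> \<eta>'" by (simp add: vec_eq_iff split_paired_all)
  have "pullback \<theta> (\<eta> + (- 1) *s \<eta>') = 0"
    unfolding pullback_add pullback_smult eq by (simp add: vec_eq_iff)
  then have "\<eta> + (- 1) *s \<eta>' = 0" by (rule pullback_theta_eq_0D)
  then show ?thesis by (simp add: vec_eq_iff)
qed

lemma invariant_dderivsI:
  assumes "\<And>I. deriv_row (pullback \<theta> \<eta>) I \<in> invariant_derivs G"
  shows "\<eta> \<in> invariant_dderivs G"
proof -
  have "act_dderiv g \<eta> = \<eta>" if g: "g \<in> G" for g
  proof (rule pullback_theta_inj)
    fix I
    show "deriv_row (pullback \<theta> (act_dderiv g \<eta>)) I = deriv_row (pullback \<theta> \<eta>) I"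
      using deriv_row_pullback_act[of g \<theta> \<eta> I] invertible[OF g] invariant_derivsD[OF theta_invariant g]
        invariant_derivsD[OF assms g] by simp
  qed
  then show ?thesis by (simp add: invariant_dderivs_def)
qed

lemma invariant_derivsI_coordinates:
  "(\<And>k. a k \<in> invariant_polys G) \<Longrightarrow> (\<Sum>k\<in>UNIV. a k *s \<theta> k) \<in> invariant_derivs G"
  unfolding invariant_derivs_eq by blast

lemma deriv_row_family_Some:
  "deriv_row (pullback \<theta> (dderiv_family G ell \<theta> (I, Some j))) K =
    (if K = I then curly_factor I *s \<theta> j else 0)"
proof -
  have "slice (pullback \<theta> (dderiv_family G ell \<theta> (I, Some j))) l = \<theta> j $ l *s (curly_factor I *s axis I 1)" for l
    unfolding dderiv_family_def using slice_pullback_embed[of \<theta> "curly_form G ell \<theta> I" "\<theta> j" l] ext_map_curly_form[of I]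
    by (simp add: theta_transpose_eq)
  then have "slice (pullback \<theta> (dderiv_family G ell \<theta> (I, Some j))) l $ K =
      (\<theta> j $ l *s (curly_factor I *s axis I 1)) $ K" for l by simp
  then show ?thesis by (simp add: vec_eq_iff axis_component mult.commute)
qed

lemma deriv_row_family_None:
  "deriv_row (pullback \<theta> (dderiv_family G ell \<theta> (I, None))) K =
    (\<Sum>i\<in>UNIV. (if i \<in> K \<and> I = K - {i} then curly_factor I * ext_sign I {i} else 0) *s \<theta> i)"
proof -
  have "slice (pullback \<theta> (dderiv_family G ell \<theta> (I, None))) l =
      (\<Sum>i\<in>UNIV. \<theta> i $ l *s (curly_factor I *s (axis I 1 \<and>\<^sub>e axis {i} 1)))" for l
    unfolding dderiv_family_def using slice_pullback_d_euler[of \<theta> "curly_form G ell \<theta> I" l] ext_map_curly_form[of I]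
    by (simp add: theta_transpose_eq wedge_smult_left)
  then have "slice (pullback \<theta> (dderiv_family G ell \<theta> (I, None))) l $ K =
      (\<Sum>i\<in>UNIV. \<theta> i $ l *s (curly_factor I *s (axis I 1 \<and>\<^sub>e axis {i} 1))) $ K" for l by simp
  moreover have "(axis I 1 \<and>\<^sub>e axis {i} 1) $ K = (if i \<in> K \<and> I = K - {i} then ext_sign I {i} else (0 :: ('a, 'n) mpoly))" for i
    by (auto simp: axis_wedge_axis axis_component)
  ultimately have "pullback \<theta> (dderiv_family G ell \<theta> (I, None)) $ (K, l) =
      (\<Sum>i\<in>UNIV. \<theta> i $ l * (curly_factor I * (if i \<in> K \<and> I = K - {i} then ext_sign I {i} else 0)))" for l
    by (simp add: mult.assoc)
  then show ?thesis by (simp add: vec_eq_iff if_distrib[of "(*) _"] if_distrib[of "\<lambda>x. x * _"] mult.commute cong: if_cong)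
qed

section \<open>The triangular system of the coordinates\<close>

lemma sum_UNIV_option: "(\<Sum>t\<in>UNIV. f t) = f None + (\<Sum>j\<in>UNIV. f (Some j))" for f :: "'n option \<Rightarrow> 'z::comm_monoid_add"
  unfolding UNIV_option_conv by (subst sum.insert) (auto simp: sum.reindex)

context
  fixes r :: 'n
begin

lemma dderiv_index_iff [simp]:
  "(I, None) \<in> dderiv_index r \<longleftrightarrow> r \<notin> I"
  "(I, Some j) \<in> dderiv_index r \<longleftrightarrow> r \<notin> I \<or> j \<noteq> r"
  by (auto simp: dderiv_index_def)

text \<open>The two terms come from the members \<open>(K, Some j)\<close> and
  \<open>(K - {j}, None)\<close>, as far as these belong to the index set.\<close>

definition family_coeff :: "('n set \<times> 'n option \<Rightarrow> ('a, 'n) mpoly) \<Rightarrow> 'n set \<Rightarrow> 'n \<Rightarrow> ('a, 'n) mpoly" where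
  "family_coeff a K j =
    (if r \<notin> K \<or> j \<noteq> r then a (K, Some j) * curly_factor K else 0) +
    (if j \<in> K \<and> r \<notin> K - {j} then a (K - {j}, None) * (curly_factor (K - {j}) * ext_sign (K - {j}) {j}) else 0)"

lemma deriv_row_combination:
  "deriv_row (pullback \<theta> (\<Sum>k\<in>dderiv_index r. a k *s dderiv_family G ell \<theta> k)) K =
    (\<Sum>j\<in>UNIV. family_coeff a K j *s \<theta> j)"
proof -
  let ?F = "\<lambda>k. deriv_row (pullback \<theta> (dderiv_family G ell \<theta> k)) K"
  have "deriv_row (pullback \<theta> (\<Sum>k\<in>dderiv_index r. a k *s dderiv_family G ell \<theta> k)) K =
      (\<Sum>k\<in>dderiv_index r. a k *s ?F k)"
    by (simp add: vec_eq_iff pullback_sum pullback_smult)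
  also have "\<dots> = (\<Sum>k\<in>UNIV. if k \<in> dderiv_index r then a k *s ?F k else 0)"
    by (simp add: sum.If_cases)
  also have "\<dots> = (\<Sum>I\<in>UNIV. \<Sum>t\<in>UNIV. if (I, t) \<in> dderiv_index r then a (I, t) *s ?F (I, t) else 0)"
    by (simp add: sum.cartesian_product flip: UNIV_Times_UNIV)
  also have "\<dots> = (\<Sum>I\<in>UNIV. (if r \<notin> I then a (I, None) *s ?F (I, None) else 0)) +
      (\<Sum>I\<in>UNIV. \<Sum>j\<in>UNIV. if r \<notin> I \<or> j \<noteq> r then a (I, Some j) *s ?F (I, Some j) else 0)"
    by (simp add: sum_UNIV_option sum.distrib)
  also have "(\<Sum>I\<in>UNIV. \<Sum>j\<in>UNIV. if r \<notin> I \<or> j \<noteq> r then a (I, Some j) *s ?F (I, Some j) else 0) =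
      (\<Sum>j\<in>UNIV. (if r \<notin> K \<or> j \<noteq> r then a (K, Some j) * curly_factor K else 0) *s \<theta> j)"
  proof -
    have "(\<Sum>j\<in>UNIV. if r \<notin> I \<or> j \<noteq> r then a (I, Some j) *s ?F (I, Some j) else 0) =
        (if I = K then (\<Sum>j\<in>UNIV. (if r \<notin> K \<or> j \<noteq> r then a (K, Some j) * curly_factor K else 0) *s \<theta> j) else 0)" for I
    proof (cases "I = K")
      case True
      then show ?thesis
        unfolding deriv_row_family_Some by (auto simp: vector_smult_assoc intro!: sum.cong)
    next
      case False
      then have "(if r \<notin> I \<or> j \<noteq> r then a (I, Some j) *s ?F (I, Some j) else 0) = 0" for j
        unfolding deriv_row_family_Some by simp
      then show ?thesis using False by simp
    qed
    then show ?thesis by simp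
  qed
  also have "(\<Sum>I\<in>UNIV. (if r \<notin> I then a (I, None) *s ?F (I, None) else 0)) =
      (\<Sum>j\<in>UNIV. (if j \<in> K \<and> r \<notin> K - {j} then a (K - {j}, None) * (curly_factor (K - {j}) * ext_sign (K - {j}) {j}) else 0) *s \<theta> j)"
  proof -
    let ?f = "\<lambda>j. a (K - {j}, None) * (curly_factor (K - {j}) * ext_sign (K - {j}) {j})"
    have "(if r \<notin> I then a (I, None) *s ?F (I, None) else 0) =
        (\<Sum>j\<in>UNIV. if I = K - {j} then (if j \<in> K \<and> r \<notin> K - {j} then ?f j else 0) *s \<theta> j else 0)" for I
    proof (cases "r \<in> I")
      case True
      then show ?thesis by (auto intro!: sum.neutral)
    next
      case False
      have "a (I, None) *s (\<Sum>i\<in>UNIV. (if i \<in> K \<and> I = K - {i} then curly_factor I * ext_sign I {i} else 0) *s \<theta> i) =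
          (\<Sum>i\<in>UNIV. a (I, None) *s ((if i \<in> K \<and> I = K - {i} then curly_factor I * ext_sign I {i} else 0) *s \<theta> i))"
        by (simp add: vec_eq_iff sum_distrib_left mult.assoc)
      then show ?thesis using False unfolding deriv_row_family_None
        by (auto simp: vector_smult_assoc intro!: sum.cong)
    qed
    then have "(\<Sum>I\<in>UNIV. (if r \<notin> I then a (I, None) *s ?F (I, None) else 0)) =
        (\<Sum>I\<in>UNIV. \<Sum>j\<in>UNIV. if I = K - {j} then (if j \<in> K \<and> r \<notin> K - {j} then ?f j else 0) *s \<theta> j else 0)"
      by simp
    also have "\<dots> = (\<Sum>j\<in>UNIV. \<Sum>I\<in>UNIV. if I = K - {j} then (if j \<in> K \<and> r \<notin> K - {j} then ?f j else 0) *s \<theta> j else 0)"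
      by (rule sum.swap)
    also have "\<dots> = (\<Sum>j\<in>UNIV. (if j \<in> K \<and> r \<notin> K - {j} then ?f j else 0) *s \<theta> j)"
      by (simp add: sum.delta)
    finally show ?thesis .
  qed
  finally show ?thesis
    by (simp add: family_coeff_def vector_sadd_rdistrib sum.distrib add.commute)
qed

lemma family_combination_invariant:
  assumes "\<And>k. k \<in> dderiv_index r \<Longrightarrow> a k \<in> invariant_polys G"
  shows "(\<Sum>k\<in>dderiv_index r. a k *s dderiv_family G ell \<theta> k) \<in> invariant_dderivs G"
proof (rule invariant_dderivsI)
  fix K
  show "deriv_row (pullback \<theta> (\<Sum>k\<in>dderiv_index r. a k *s dderiv_family G ell \<theta> k)) K \<in> invariant_derivs G"
    unfolding deriv_row_combination
  proof (rule invariant_derivsI_coordinates)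
    fix j
    show "family_coeff a K j \<in> invariant_polys G"
      unfolding family_coeff_def using assms
      by (auto intro!: invariant_polys_add invariant_polys_mult curly_factor_invariant)
  qed
qed

text \<open>At coordinate \<open>(insert r I, r)\<close> the member
  \<open>(insert r I, Some r)\<close> is missing, so \<open>(I, None)\<close> stands alone. Once
  these coefficients vanish, coordinate \<open>(I, j)\<close> involves \<open>(I, Some j)\<close>
  only.\<close>

lemma family_independent:
  assumes 0: "(\<Sum>k\<in>dderiv_index r. a k *s dderiv_family G ell \<theta> k) = 0" and k: "k \<in> dderiv_index r"
  shows "a k = 0"
proof -
  have coeff: "family_coeff a K j = 0" for K j
  proof (rule theta_independent[of "family_coeff a K"])
    show "(\<Sum>j\<in>UNIV. family_coeff a K j *s \<theta> j) = 0"
      using deriv_row_combination[of a K] unfolding 0 by (simp add: vec_eq_iff)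
  qed
  have sign: "ext_sign I J \<noteq> (0 :: ('a, 'n) mpoly)" for I J :: "'n set"
    by (simp add: ext_sign_def)
  have None: "a (I, None) = 0" if "r \<notin> I" for I
    using coeff[of "insert r I" r] that curly_factor_nonzero sign by (simp add: family_coeff_def)
  have Some: "a (I, Some j) = 0" if "r \<notin> I \<or> j \<noteq> r" for I j
    using coeff[of I j] that None[of "I - {j}"] curly_factor_nonzero by (auto simp: family_coeff_def split: if_splits)
  obtain I t where "k = (I, t)" by (cases k)
  then show ?thesis using k None Some by (cases t) auto
qed

lemma family_spans:
  assumes char: "(2 :: 'a) \<noteq> 0" and \<eta>: "\<eta> \<in> invariant_dderivs G"
  obtains a where "\<And>k. k \<in> dderiv_index r \<Longrightarrow> a k \<in> invariant_polys G"
    "\<eta> = (\<Sum>k\<in>dderiv_index r. a k *s dderiv_family G ell \<theta> k)"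
proof -
  let ?q = "Q_poly G ell ^ e"
  have "\<exists>c. deriv_row (pullback \<theta> \<eta>) I = (\<Sum>j\<in>UNIV. c j *s \<theta> j) \<and> (\<forall>j. c j \<in> invariant_polys G)" for I
    using theta_coordinates[OF deriv_row_pullback_invariant[OF \<eta>, of I]] by blast
  then have "\<exists>c. \<forall>I. deriv_row (pullback \<theta> \<eta>) I = (\<Sum>j\<in>UNIV. c I j *s \<theta> j) \<and> (\<forall>j. c I j \<in> invariant_polys G)"
    by (intro choice allI)
  then obtain c where c: "\<And>I. deriv_row (pullback \<theta> \<eta>) I = (\<Sum>j\<in>UNIV. c I j *s \<theta> j)"
    and c_inv: "\<And>I j. c I j \<in> invariant_polys G" by blast
  \<comment> \<open>One formula for all positive degrees: \<open>I = {j}\<close> singles out the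
    diagonal in degree one, and the scalar is normalized to the entry at \<open>r\<close>.\<close>
  have "?q dvd c I j - (if I = {j} then c {r} r else 0)" if "I \<noteq> {}" for I j
  proof (rule Q_poly_power_dvd, rule invariant_dvd_power)
    fix H assume H: "H \<in> arrangement G"
    show "c I j - (if I = {j} then c {r} r else 0) \<in> invariant_polys G"
      using c_inv by (simp add: invariant_polys_diff)
    show "linear_form (ell H) dvd c I j - (if I = {j} then c {r} r else 0)"
    proof (cases "card I = 1")
      case True
      then obtain i where "I = {i}" by (rule card_1_singletonE)
      then show ?thesis using pullback_coordinates_dvd(2)[OF char \<eta> c H, of i j r] by simp
    next
      case False
      have "card I \<noteq> 0" using that by simp
      then have "2 \<le> card I" using False by linarith
      moreover have "I \<noteq> {j}" using False by auto
      ultimately show ?thesis using pullback_coordinates_dvd(1)[OF char \<eta> c H, of I j] by simp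
    qed
  qed
  then have "\<exists>x. I \<noteq> {} \<longrightarrow> c I j - (if I = {j} then c {r} r else 0) = ?q * x" for I j
    unfolding dvd_def by blast
  then obtain c' where c': "\<And>I j. I \<noteq> {} \<Longrightarrow> c I j - (if I = {j} then c {r} r else 0) = ?q * c' I j" by metis
  have c'_inv: "c' I j \<in> invariant_polys G" if "I \<noteq> {}" for I j
  proof (rule invariant_polys_cancel)
    show "?q * c' I j \<in> invariant_polys G"
      unfolding c'[OF that, symmetric] using c_inv by (simp add: invariant_polys_diff)
  qed (use Q_poly_power_invariant Q_poly_nonzero in auto)
  have c_eq: "c I j = ?q * c' I j + (if I = {j} then c {r} r else 0)" if "I \<noteq> {}" for I j
    using c'[OF that, of j] by (simp add: algebra_simps)
  \<comment> \<open>\<open>?q * x K j\<close> is what the members with \<open>d_euler\<close>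
    contribute at \<open>(K, j)\<close> when \<open>j \<in> K\<close>, \<open>r \<notin> K\<close>
    and \<open>K \<noteq> {j}\<close>. For \<open>K = {j}\<close> the contribution is the scalar
    \<open>c {r} r\<close>, which \<open>c_eq\<close> lists separately.\<close>
  define x where "x K j = (if j \<in> K \<and> r \<notin> K \<and> K \<noteq> {j} then
      ext_sign (K - {j}) {r} * ext_sign (K - {j}) {j} * c' (insert r (K - {j})) r else 0)" for K j
  \<comment> \<open>The \<open>None\<close> coefficients are read off at
    \<open>(insert r K, r)\<close>, and the \<open>Some\<close> coefficients take what then remains.
    At \<open>K = {}\<close> the factor is 1, so \<open>d_euler\<close> itself takes up the scalar
    \<open>c {r} r\<close>.\<close>
  define a where "a = (\<lambda>(K, t). case t of
      None \<Rightarrow> if K = {} then c {r} r else ext_sign K {r} * Const (inverse (curly_scalar K)) * c' (insert r K) r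
    | Some j \<Rightarrow> if K = {} then c {} j else Const (inverse (curly_scalar K)) * (c' K j - x K j))"
  have x_inv: "x K j \<in> invariant_polys G" for K j
    by (simp add: x_def c'_inv invariant_polys_mult)
  have "a (K, t) \<in> invariant_polys G" for K t
    by (cases t; cases "K = {}")
      (simp_all add: a_def c_inv c'_inv x_inv invariant_polys_mult invariant_polys_diff)
  then have a_inv: "a k \<in> invariant_polys G" for k by (cases k) simp
  have cancel: "Const (inverse (curly_scalar K)) * (Const (curly_scalar K) * p) = p" for K p
    by (rule Const_inverse_left[OF curly_scalar_nonzero])
  have None: "a (I, None) * curly_factor I = (if I = {} then c {r} r else ext_sign I {r} * (?q * c' (insert r I) r))" for I
    using cancel[of I "?q * (ext_sign I {r} * c' (insert r I) r)"]
    by (simp add: a_def curly_factor_def mult_ac)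
  have Some: "a (K, Some j) * curly_factor K = (if K = {} then c {} j else ?q * (c' K j - x K j))" for K j
    using cancel[of K "?q * (c' K j - x K j)"] by (simp add: a_def curly_factor_def mult_ac)
  have second: "a (K - {j}, None) * (curly_factor (K - {j}) * ext_sign (K - {j}) {j}) =
      (if K = {j} then c {r} r else ?q * (ext_sign (K - {j}) {r} * ext_sign (K - {j}) {j} * c' (insert r (K - {j})) r))"
    if "j \<in> K" for K j
  proof -
    have "K - {j} = {} \<longleftrightarrow> K = {j}" using that by auto
    then have "a (K - {j}, None) * curly_factor (K - {j}) = (if K = {j} then c {r} r
        else ext_sign (K - {j}) {r} * (?q * c' (insert r (K - {j})) r))"
      using None[of "K - {j}"] by (simp only:)
    moreover have "K = {j} \<Longrightarrow> ext_sign (K - {j}) {j} = (1 :: ('a, 'n) mpoly)" by simp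
    ultimately show ?thesis
      by (cases "K = {j}") (simp_all only: mult.assoc[symmetric] if_True if_False refl, simp_all only: mult_ac mult_1)
  qed
  have coeff: "family_coeff a K j = c K j" for K j
  proof (cases "r \<in> K \<and> j = r")
    case True
    then have "insert r (K - {r}) = K" by auto
    then have "family_coeff a K j = (if K = {r} then c {r} r else ?q * c' K r)"
      using True second[of r K] by (simp add: family_coeff_def)
    moreover have "K \<noteq> {}" using True by blast
    ultimately show ?thesis using True c_eq[of K r] by (cases "K = {r}") simp_all
  next
    case False
    then have iff: "j \<in> K \<and> r \<notin> K - {j} \<longleftrightarrow> j \<in> K \<and> r \<notin> K" by auto
    have first: "r \<notin> K \<or> j \<noteq> r" using False by auto
    show ?thesis
    proof (cases "K = {}")
      case True
      then show ?thesis using Some[of K j] first by (simp add: family_coeff_def)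
    next
      case K: False
      have "family_coeff a K j = ?q * (c' K j - x K j) +
          (if j \<in> K \<and> r \<notin> K then if K = {j} then c {r} r else ?q * x K j else 0)"
        unfolding family_coeff_def iff using first K Some[of K j] second[of j K] by (auto simp: x_def)
      also have "\<dots> = ?q * c' K j + (if K = {j} then c {r} r else 0)"
        using False by (auto simp: x_def algebra_simps)
      finally show ?thesis using c_eq[OF K, of j] by simp
    qed
  qed
  have "\<eta> = (\<Sum>k\<in>dderiv_index r. a k *s dderiv_family G ell \<theta> k)"
    by (rule pullback_theta_inj) (simp only: deriv_row_combination coeff c)
  with a_inv show ?thesis by (rule that)
qed

end

end

theorem theorem6p5:
  fixes G :: "('a::field, 'n::{finite,linorder}) sqmat set"
    and ell :: "('a, 'n) hforms"
    and \<theta> :: "'n \<Rightarrow> ('a, 'n) deriv"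
    and r :: 'n
  assumes "reflection_group G"
    and "CHAR('a) \<noteq> 2"
    and "defining_forms G ell"
    and "maximal_transvection_root_spaces G ell"
    and "basic_derivations G \<theta>"
  shows "free_basis (invariant_polys G) (invariant_dderivs G)
           (dderiv_index r) (dderiv_family G ell \<theta>)"
proof -
  interpret free_derivations G ell \<theta>
    using assms unfolding reflection_group_def basic_derivations_def
    by (intro free_derivations.intro transvection_group.intro transvection_group_axioms.intro
        matrix_group.intro free_derivations_axioms.intro) auto
  have char: "(2 :: 'a) \<noteq> 0"
  proof
    assume "(2 :: 'a) = 0"
    then have "of_nat 2 = (0 :: 'a)" by simp
    then have "CHAR('a) dvd 2" by (simp only: of_nat_eq_0_iff_char_dvd)
    then have "CHAR('a) = 1 \<or> CHAR('a) = 2" using prime_nat_iff two_is_prime_nat by blast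
    then show False using assms(2) by simp
  qed
  have "invariant_dderivs G = {\<Sum>k\<in>dderiv_index r. c k *s dderiv_family G ell \<theta> k |c.
      \<forall>k\<in>dderiv_index r. c k \<in> invariant_polys G}"
    using family_combination_invariant[of r] family_spans[OF char, of _ r] by blast
  moreover have "finite (dderiv_index r)" by simp
  ultimately show ?thesis
    unfolding free_basis_def using family_independent by blast
qed

end
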